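(* Consider the linear Gaussian model described in the context, with horizon $T\ge 1$ and capacity $B>0$, and the capacity-constrained prediction problem $$\min_{q_1,\dots,q_T}\ \sum_{t=1}^T \mathbb{E}\big[\|\theta_t-\hat\theta_t\|_2^2\big]\quad\text{s.t.}\quad \hat\theta_t\sim q_t(\cdot\mid H_t),\ \ \mathbb{I}(\hat\theta_t;H_t)\le B,\ \ t=1,\dots,T.$$ For each $t$, let $\bar\theta_t=\mathbb{E}[\theta_t\mid H_t]$, let $\lambda_{t1},\dots,\lambda_{td}$ be the eigenvalues of $\mathrm{Cov}[\bar\theta_t]$ and $U_t\in\mathbb{R}^{d\times d}$ an orthogonal matrix whose columns are corresponding eigenvectors. Let $\eta_t$ be the unique solution of $\sum_{i=1}^d[\log(2\lambda_{ti}/\eta)]^+=2B$, and set $B_{ti}=\frac12[\log(2\lambda_{ti}/\eta_t)]^+$. Define $D^F_t=\mathrm{diag}(1-e^{-2B_{t1}},\dots,1-e^{-2B_{td}})$ and $D^\Psi_t=\mathrm{diag}\big((1-e^{-2B_{t1}})e^{-2B_{t1}}\lambda_{t1},\dots,(1-e^{-2B_{td}})e^{-2B_{td}}\lambda_{td}\big)$, and $F_t=U_tD^F_tU_t^\top$, $\Psi_t=U_tD^\Psi_tU_t^\top$. Then an optimal solution of this problem is $$\hat\theta_t=F_t\bar\theta_t+\epsilon_t,\qquad t=1,\dots,T,$$ where $\epsilon_t\sim N(0,\Psi_t)$ is independent of $\theta_0$, $(\omega_s)$ and $(\nu_s)$.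
   Context: Model: $\theta_0\sim N(0,\Sigma_0)$ in $\mathbb{R}^d$; $\theta_{t+1}=A\theta_t+\omega_t$ for $t\ge0$ with $\omega_t$ i.i.d. $N(0,\Sigma_\omega)$; observations $Y_t=C\theta_t+\nu_t\in\mathbb{R}^m$ with $C\in\mathbb{R}^{m\times d}$ and $\nu_t$ i.i.d. $N(0,\Sigma_\nu)$; $\theta_0$, $(\omega_t)$, $(\nu_t)$ are mutually independent, and $A,C,\Sigma_0,\Sigma_\omega,\Sigma_\nu$ are known. $H_t=(Y_1,\dots,Y_t)$. "$\hat\theta_t\sim q_t(\cdot\mid H_t)$" means $\hat\theta_t$ is drawn from a conditional distribution given $H_t$ (so it is conditionally independent of the latent variables given $H_t$). $\mathbb{I}$ denotes mutual information; logarithms are natural, $[x]^+=\max\{x,0\}$. *)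

theory Defs
  imports "HOL-Probability.Probability"
begin

definition normal1 :: "real \<Rightarrow> real \<Rightarrow> real measure" where
  "normal1 m v = (if v = 0 then return borel m
                  else density lborel (normal_density m (sqrt v)))"

definition is_normal_vec :: "(real^'n) measure \<Rightarrow> real^'n \<Rightarrow> real^'n^'n \<Rightarrow> bool" where
  "is_normal_vec P mu S \<longleftrightarrow> prob_space P \<and> sets P = sets borel \<and>
     (\<forall>a. distr P borel (\<lambda>x. a \<bullet> x) = normal1 (a \<bullet> mu) (a \<bullet> (S *v a)))"

definition KL_div :: "'a measure \<Rightarrow> 'a measure \<Rightarrow> ereal" where
  "KL_div P Q = (if sets P = sets Q \<and> absolutely_continuous Q P then
     (let f = (\<lambda>x. enn2real (RN_deriv Q P x)) in
        enn2ereal (\<integral>\<^sup>+ x. ennreal (ln (f x)) \<partial>P) - enn2ereal (\<integral>\<^sup>+ x. ennreal (- ln (f x)) \<partial>P))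
     else \<infinity>)"

definition mutual_info :: "'a measure \<Rightarrow> 'b measure \<Rightarrow> ('a \<times> 'b) measure \<Rightarrow> ereal" where
  "mutual_info S T P = KL_div P (distr P S fst \<Otimes>\<^sub>M distr P T snd)"

definition Hspace :: "nat \<Rightarrow> (nat \<Rightarrow> real^'m) measure" where
  "Hspace t = PiM {1..t} (\<lambda>_. borel)"

definition Hvec :: "(nat \<Rightarrow> 'w \<Rightarrow> real^'m) \<Rightarrow> nat \<Rightarrow> 'w \<Rightarrow> (nat \<Rightarrow> real^'m)" where
  "Hvec Y t \<omega> = (\<lambda>s\<in>{1..t}. Y s \<omega>)"

definition Hsigma :: "'w measure \<Rightarrow> (nat \<Rightarrow> 'w \<Rightarrow> real^'m) \<Rightarrow> nat \<Rightarrow> 'w measure" where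
  "Hsigma M Y t = vimage_algebra (space M) (Hvec Y t) (Hspace t)"

definition cond_mean :: "'w measure \<Rightarrow> (nat \<Rightarrow> 'w \<Rightarrow> real^'d) \<Rightarrow> (nat \<Rightarrow> 'w \<Rightarrow> real^'m) \<Rightarrow> nat \<Rightarrow> 'w \<Rightarrow> real^'d" where
  "cond_mean M theta Y t \<omega> = (\<chi> i. real_cond_exp M (Hsigma M Y t) (\<lambda>w. theta t w $ i) \<omega>)"

definition cov_mat :: "'w measure \<Rightarrow> ('w \<Rightarrow> real^'d) \<Rightarrow> real^'d^'d" where
  "cov_mat M X = (\<chi> i j. integral\<^sup>L M (\<lambda>w. (X w $ i - integral\<^sup>L M (\<lambda>v. X v $ i)) *
                                         (X w $ j - integral\<^sup>L M (\<lambda>v. X v $ j))))"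

text \<open>Joint law of (theta_t, H_t, hat-theta_t) when, given the sample point w,
  hat-theta_t is drawn from K w (K w depends on w only through H_t for admissible policies).\<close>
definition joint_law :: "'w measure \<Rightarrow> ('w \<Rightarrow> real^'d) \<Rightarrow> ('w \<Rightarrow> 'h) \<Rightarrow> 'h measure
    \<Rightarrow> ('w \<Rightarrow> (real^'d) measure) \<Rightarrow> ((real^'d) \<times> 'h \<times> (real^'d)) measure" where
  "joint_law M th H S K = M \<bind> (\<lambda>w. distr (K w) (borel \<Otimes>\<^sub>M S \<Otimes>\<^sub>M borel) (\<lambda>x. (th w, H w, x)))"

definition sq_loss :: "((real^'d) \<times> 'h \<times> (real^'d)) measure \<Rightarrow> ennreal" where
  "sq_loss J = (\<integral>\<^sup>+ z. ennreal ((norm (fst z - snd (snd z)))\<^sup>2) \<partial>J)"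

definition info_HX :: "'h measure \<Rightarrow> ((real^'d) \<times> 'h \<times> (real^'d)) measure \<Rightarrow> ereal" where
  "info_HX S J = mutual_info S borel (distr J (S \<Otimes>\<^sub>M borel) snd)"

definition diag_mat :: "('d \<Rightarrow> real) \<Rightarrow> real^'d^'d" where
  "diag_mat l = (\<chi> i j. if i = j then l i else 0)"

definition water_level :: "('d::finite \<Rightarrow> real) \<Rightarrow> real \<Rightarrow> real" where
  "water_level lam B = (THE eta. eta > 0 \<and> (\<Sum>i\<in>UNIV. max (ln (2 * lam i / eta)) 0) = 2 * B)"

definition bits :: "('d::finite \<Rightarrow> real) \<Rightarrow> real \<Rightarrow> 'd \<Rightarrow> real" where
  "bits lam B i = max (ln (2 * lam i / water_level lam B)) 0 / 2"

definition F_mat :: "real^'d^'d \<Rightarrow> ('d::finite \<Rightarrow> real) \<Rightarrow> real \<Rightarrow> real^'d^'d" where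
  "F_mat U lam B = U ** diag_mat (\<lambda>i. 1 - exp (- 2 * bits lam B i)) ** transpose U"

definition Psi_mat :: "real^'d^'d \<Rightarrow> ('d::finite \<Rightarrow> real) \<Rightarrow> real \<Rightarrow> real^'d^'d" where
  "Psi_mat U lam B = U ** diag_mat (\<lambda>i. (1 - exp (- 2 * bits lam B i)) * exp (- 2 * bits lam B i) * lam i)
                     ** transpose U"

end

theory Submission
  imports Defs
begin

text \<open>
  The problem decouples over time, so fix \<open>t\<close> and let \<open>m\<close> be the conditional mean.
  By the Cramer--Wold device \<open>(\<theta>\<^sub>t, Y\<^sub>1, \<dots>, Y\<^sub>t)\<close> is determined by its
  covariance, hence the residual of the \<open>L\<^sup>2\<close>-projection of \<open>\<theta>\<^sub>t\<close> on the observations is independent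
  of them: \<open>m\<close> is a linear function of \<open>H\<^sub>t\<close> and centered Gaussian with independent
  eigencoordinates.  The loss of every policy is a constant plus \<open>\<bbbE> |m - x|\<^sup>2\<close>, where \<open>x\<close> is
  the prediction, and what remains is Gaussian rate-distortion theory.

  Lower bound: by the Donsker--Varadhan inequality the information is at least \<open>\<bbbE> g(m, x)\<close> whenever
  \<open>exp (g(\<cdot>, x))\<close> integrates to at most 1 under the law of \<open>m\<close> for each \<open>x\<close>.  For the water level \<open>\<eta>\<close> take
  \<open>g(y, x) = B + \<Sum>\<^sub>i a\<^sub>i y\<^sub>i\<^sup>2 - |y - x|\<^sup>2 / \<eta>\<close> with
  \<open>a\<^sub>i = min (1 / (2 \<lambda>\<^sub>i)) (1 / \<eta>)\<close>.

  Upper bound: the information of the proposed channel is bounded by the divergence of its transition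
  kernel from the Gaussian law with the covariance of the output, which only involves second moments.
\<close>

text \<open>Two obstacles shape the proof. The covariance of the conditional mean may be singular,
  so Gaussian vectors are not given Lebesgue densities: they are handled through their coordinates
  along the columns of \<open>U\<close>, where variance 0 means a point mass, and densities of the
  channel are taken against its noise law.

  The constants of the tilting function come from Lagrangian duality. Optimal rate allocation leaves
  distortion D_i = min(lam_i, eta / 2) in coordinate i, and - 1 / eta is the slope of the rate as a
  function of the distortion. The coefficients satisfy eta * a_i * lam_i = D_i, so the mean of the
  tilting function is B + (sum of D_i - mean of |m - x|^2) / eta. Information at most B then forces
  the mean of |m - x|^2 to be at least the sum of the D_i, which is what the proposed channel
  attains.\<close>

section \<open>One-dimensional Gaussian measures\<close>

text \<open>The absolute value is needed because \<^const>\<open>normal1\<close> at a negative \<open>v\<close> is the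
  normal law of variance \<open>- v\<close>.\<close>

lemma normal1_eq_distr_std_normal:
  "normal1 0 v = distr std_normal_distribution borel (\<lambda>x. sqrt \<bar>v\<bar> * x)"
proof (cases "v = 0")
  case True
  interpret real_distribution std_normal_distribution by (rule real_dist_normal_dist)
  show ?thesis using True by (simp add: normal1_def distr_const)
next
  case False
  interpret real_distribution std_normal_distribution by (rule real_dist_normal_dist)
  have "distributed std_normal_distribution lborel (\<lambda>x. x) std_normal_density"
    by (auto simp: distributed_def intro!: measure_eqI simp: emeasure_distr)
  from normal_density_affine[OF this, of "sqrt \<bar>v\<bar>" 0] False
  have "distributed std_normal_distribution lborel (\<lambda>x. sqrt \<bar>v\<bar> * x) (normal_density 0 (sqrt \<bar>v\<bar>))"
    by simp
  then have "distr std_normal_distribution lborel (\<lambda>x. sqrt \<bar>v\<bar> * x) = density lborel (normal_density 0 (sqrt \<bar>v\<bar>))"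
    by (simp add: distributed_def)
  moreover have "normal_density 0 (sqrt v) = normal_density 0 (sqrt \<bar>v\<bar>)"
    by (simp add: normal_density_def fun_eq_iff power2_eq_square real_sqrt_mult_self)
  moreover have "distr std_normal_distribution lborel (\<lambda>x. sqrt \<bar>v\<bar> * x) = distr std_normal_distribution borel (\<lambda>x. sqrt \<bar>v\<bar> * x)"
    by (intro distr_cong) auto
  ultimately show ?thesis using False by (simp add: normal1_def)
qed

lemma sets_normal1 [simp, measurable_cong]: "sets (normal1 0 v) = sets borel"
  by (simp add: normal1_eq_distr_std_normal)

lemma space_normal1 [simp]: "space (normal1 0 v) = UNIV"
  by (simp add: normal1_eq_distr_std_normal)

lemma real_distribution_normal1: "real_distribution (normal1 0 v)"
proof -
  interpret real_distribution std_normal_distribution by (rule real_dist_normal_dist)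
  show ?thesis
    unfolding normal1_eq_distr_std_normal by (intro real_distribution_distr) auto
qed

lemma prob_space_normal1: "prob_space (normal1 0 v)"
  using real_distribution_normal1[of v] by (simp add: real_distribution_def)

lemma char_normal1: "char (normal1 0 v) s = complex_of_real (exp (- \<bar>v\<bar> * s\<^sup>2 / 2))"
proof -
  have "char (normal1 0 v) s = char std_normal_distribution (s * sqrt \<bar>v\<bar>)"
    unfolding normal1_eq_distr_std_normal char_def
    by (subst integral_distr) (auto simp: mult_ac)
  then show ?thesis
    by (simp add: char_std_normal_distribution power_mult_distrib mult.commute)
qed

lemma integrable_normal1_moment: "integrable (normal1 0 v) (\<lambda>x. x ^ k)"
  unfolding normal1_eq_distr_std_normal
  by (subst integrable_distr_eq)
     (auto simp: power_mult_distrib intro!: integrable_mult_right integrable_std_normal_distribution_moment)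

lemma mean_normal1: "(\<integral>x. x \<partial>normal1 0 v) = 0"
  unfolding normal1_eq_distr_std_normal
  using integral_std_normal_distribution_moment_odd[of 1]
  by (subst integral_distr) auto

lemma second_moment_normal1: "(\<integral>x. x\<^sup>2 \<partial>normal1 0 v) = \<bar>v\<bar>"
  unfolding normal1_eq_distr_std_normal
  using std_normal_distribution_even_moments(1)[of 1]
  by (subst integral_distr) (auto simp: power_mult_distrib)

lemma normal1_0_eq: "normal1 0 0 = return borel 0"
  by (simp add: normal1_def)

lemma nn_integral_normal1_pos:
  assumes "v > 0" and [measurable]: "f \<in> borel_measurable borel"
  shows "(\<integral>\<^sup>+x. f x \<partial>normal1 0 v) = (\<integral>\<^sup>+x. ennreal (normal_density 0 (sqrt v) x) * f x \<partial>lborel)"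
  using assms(1) by (simp add: normal1_def nn_integral_density)

lemma nn_integral_normal_density:
  assumes "s > 0"
  shows "(\<integral>\<^sup>+x. ennreal (normal_density m s x) \<partial>lborel) = 1"
  by (rule trans[OF nn_integral_eq_integral]) (use assms in auto)

text \<open>Completing the square turns the integrand into a multiple of the normal density with
  variance \<open>w = v / k\<close> and mean \<open>b * w\<close>. The condition on
  \<open>1 + 2 * a * v\<close> admits negative \<open>a\<close>, which occur when a reference law
  wider than the noise is compared with the noise.\<close>

lemma nn_integral_exp_quadratic_normal1:
  assumes v: "v \<ge> 0" and pos: "1 + 2 * a * v > 0"
  shows "(\<integral>\<^sup>+x. ennreal (exp (- a * x\<^sup>2 + b * x)) \<partial>normal1 0 v)
     = ennreal (exp (b\<^sup>2 * v / (2 * (1 + 2 * a * v))) / sqrt (1 + 2 * a * v))"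
proof (cases "v = 0")
  case True
  then show ?thesis by (simp add: normal1_0_eq nn_integral_return)
next
  case False
  with v have v: "v > 0" by simp
  define k where "k = 1 + 2 * a * v"
  define w where "w = v / k"
  have k: "k > 0" and w: "w > 0" using pos v by (auto simp: k_def w_def)
  have a: "a = (k - 1) / (2 * v)" using v by (simp add: k_def)
  have eq: "normal_density 0 (sqrt v) x * exp (- a * x\<^sup>2 + b * x)
     = exp (b\<^sup>2 * v / (2 * k)) / sqrt k * normal_density (b * w) (sqrt w) x" for x
  proof -
    have "- (x\<^sup>2 / (2 * v)) + (- a * x\<^sup>2 + b * x) = b\<^sup>2 * v / (2 * k) - (x - b * w)\<^sup>2 / (2 * w)"
      using v k unfolding a w_def by (simp add: field_simps power2_eq_square)
    then have e: "exp (- (x\<^sup>2 / (2 * v))) * exp (- a * x\<^sup>2 + b * x)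
        = exp (b\<^sup>2 * v / (2 * k)) * exp (- (x - b * w)\<^sup>2 / (2 * w))"
      by (simp add: exp_add[symmetric])
    have "1 / sqrt (2 * pi * v) = 1 / sqrt k * (1 / sqrt (2 * pi * w))"
      using v k unfolding w_def by (simp add: real_sqrt_mult real_sqrt_divide)
    then show ?thesis
      using v w e by (simp add: normal_density_def mult_ac)
  qed
  have "(\<integral>\<^sup>+x. ennreal (exp (- a * x\<^sup>2 + b * x)) \<partial>normal1 0 v)
      = (\<integral>\<^sup>+x. ennreal (exp (b\<^sup>2 * v / (2 * k)) / sqrt k) * ennreal (normal_density (b * w) (sqrt w) x) \<partial>lborel)"
    using v k
    by (subst nn_integral_normal1_pos)
      (auto simp: ennreal_mult[symmetric] eq[simplified] intro!: nn_integral_cong)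
  also have "\<dots> = ennreal (exp (b\<^sup>2 * v / (2 * k)) / sqrt k)"
    using w by (simp add: nn_integral_cmult nn_integral_normal_density)
  finally show ?thesis by (simp add: k_def)
qed

text \<open>The weight is the density of the normal law with mean \<open>m\<close> and variance
  \<open>v\<close> relative to the centered one: the Cameron-Martin formula in one
  dimension.\<close>

lemma nn_integral_normal1_shift:
  assumes v: "v > 0" and [measurable]: "f \<in> borel_measurable borel"
  shows "(\<integral>\<^sup>+x. ennreal (exp (m * x / v - m\<^sup>2 / (2 * v))) * f x \<partial>normal1 0 v)
       = (\<integral>\<^sup>+x. f (m + x) \<partial>normal1 0 v)"
proof -
  have eq: "normal_density 0 (sqrt v) x * exp (m * x / v - m\<^sup>2 / (2 * v)) = normal_density 0 (sqrt v) (x - m)" for x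
  proof -
    have "- (x\<^sup>2 / (2 * v)) + (m * x / v - m\<^sup>2 / (2 * v)) = - (x - m)\<^sup>2 / (2 * v)"
      using v by (simp add: field_simps power2_eq_square)
    then have e: "exp (- (x\<^sup>2 / (2 * v))) * exp (m * x / v - m\<^sup>2 / (2 * v)) = exp (- (x - m)\<^sup>2 / (2 * v))"
      by (simp add: exp_add[symmetric])
    then show ?thesis using v by (simp add: normal_density_def mult_ac)
  qed
  have "(\<integral>\<^sup>+x. ennreal (exp (m * x / v - m\<^sup>2 / (2 * v))) * f x \<partial>normal1 0 v)
      = (\<integral>\<^sup>+x. ennreal (normal_density 0 (sqrt v) (x - m)) * f x \<partial>lborel)"
    using v by (subst nn_integral_normal1_pos)
      (auto simp: eq[symmetric] ennreal_mult mult.assoc)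
  also have "\<dots> = (\<integral>\<^sup>+x. ennreal (normal_density 0 (sqrt v) (m + x - m)) * f (m + x) \<partial>lborel)"
    by (subst lborel_distr_plus[symmetric, of m], subst nn_integral_distr) auto
  also have "\<dots> = (\<integral>\<^sup>+x. f (m + x) \<partial>normal1 0 v)"
    using v by (subst nn_integral_normal1_pos) auto
  finally show ?thesis .
qed

section \<open>The Cramer--Wold device\<close>

text \<open>Levy uniqueness for the image laws of the weighted measures, normalised to mass 1.
  Frequency 0 shows that both weights have the same mass \<open>c\<close>; if \<open>c = 0\<close>,
  both weights vanish almost everywhere and no normalisation is possible.\<close>

lemma weighted_Levy_uniqueness:
  fixes X :: "'a \<Rightarrow> real" and Z :: "'b \<Rightarrow> real"
  assumes M: "prob_space M" and N: "prob_space N"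
    and [measurable]: "X \<in> borel_measurable M" "Z \<in> borel_measurable N"
      "f \<in> borel_measurable M" "g \<in> borel_measurable N" "A \<in> sets borel"
    and f: "\<And>w. 0 \<le> f w" "\<And>w. f w \<le> K" and g: "\<And>w. 0 \<le> g w" "\<And>w. g w \<le> K"
    and eq: "\<And>s. (CLINT w|M. complex_of_real (f w) * iexp (s * X w)) = (CLINT w|N. complex_of_real (g w) * iexp (s * Z w))"
  shows "(\<integral>w. f w * indicator A (X w) \<partial>M) = (\<integral>w. g w * indicator A (Z w) \<partial>N)"
proof -
  interpret M: prob_space M by fact
  interpret N: prob_space N by fact
  define c where "c = (\<integral>w. f w \<partial>M)"
  have int_f: "integrable M f" and int_g: "integrable N g"
    using f g by (auto intro!: M.integrable_const_bound[of _ K] N.integrable_const_bound[of _ K])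
  have "complex_of_real c = complex_of_real (\<integral>w. g w \<partial>N)"
    using eq[of 0] by (simp add: c_def)
  then have c_g: "c = (\<integral>w. g w \<partial>N)" by (simp only: of_real_eq_iff)
  have "c \<ge> 0" unfolding c_def using f by simp
  show ?thesis
  proof (cases "c = 0")
    case True
    then have "AE w in M. f w = 0" "AE w in N. g w = 0"
      using c_g int_f int_g f g integral_nonneg_eq_0_iff_AE[OF int_f] integral_nonneg_eq_0_iff_AE[OF int_g]
      by (auto simp: c_def)
    then have "AE w in M. f w * indicator A (X w) = 0" "AE w in N. g w * indicator A (Z w) = 0"
      by auto
    then show ?thesis by (simp add: integral_eq_zero_AE)
  next
    case False
    with \<open>c \<ge> 0\<close> have c: "c > 0" by simp
    define D1 where "D1 = distr (density M (\<lambda>w. ennreal (f w / c))) borel X"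
    define D2 where "D2 = distr (density N (\<lambda>w. ennreal (g w / c))) borel Z"
    have "prob_space (density M (\<lambda>w. ennreal (f w / c)))"
    proof
      have "(\<integral>\<^sup>+w. ennreal (f w / c) \<partial>M) = ennreal (\<integral>w. f w / c \<partial>M)"
        using c f int_f by (intro nn_integral_eq_integral) auto
      then show "emeasure (density M (\<lambda>w. ennreal (f w / c))) (space (density M (\<lambda>w. ennreal (f w / c)))) = 1"
        using c by (subst emeasure_density) (auto simp: c_def cong: nn_integral_cong)
    qed
    then have d1: "real_distribution D1"
      unfolding D1_def by (intro prob_space.real_distribution_distr) auto
    have "prob_space (density N (\<lambda>w. ennreal (g w / c)))"
    proof
      have "(\<integral>\<^sup>+w. ennreal (g w / c) \<partial>N) = ennreal (\<integral>w. g w / c \<partial>N)"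
        using c g int_g by (intro nn_integral_eq_integral) auto
      then show "emeasure (density N (\<lambda>w. ennreal (g w / c))) (space (density N (\<lambda>w. ennreal (g w / c)))) = 1"
        using c by (subst emeasure_density) (auto simp: c_g cong: nn_integral_cong)
    qed
    then have d2: "real_distribution D2"
      unfolding D2_def by (intro prob_space.real_distribution_distr) auto
    have int1: "(LINT x|D1. h x) = (LINT w|M. (f w / c) *\<^sub>R h (X w))" if [measurable]: "h \<in> borel_measurable borel" for h :: "real \<Rightarrow> 'c::{banach,second_countable_topology}"
      unfolding D1_def using c f by (simp add: integral_distr integral_density)
    have int2: "(LINT x|D2. h x) = (LINT w|N. (g w / c) *\<^sub>R h (Z w))" if [measurable]: "h \<in> borel_measurable borel" for h :: "real \<Rightarrow> 'c::{banach,second_countable_topology}"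
      unfolding D2_def using c g by (simp add: integral_distr integral_density)
    have "char D1 s = char D2 s" for s
      unfolding char_def using eq[of s]
      by (simp add: int1 int2 scaleR_conv_of_real)
    then have D: "D1 = D2" using d1 d2 by (intro Levy_uniqueness) auto
    have "(\<integral>w. f w / c * indicator A (X w) \<partial>M) = (\<integral>w. g w / c * indicator A (Z w) \<partial>N)"
      using int1[of "indicator A :: real \<Rightarrow> real"] int2[of "indicator A :: real \<Rightarrow> real"] D
      by simp
    then show ?thesis using c by simp
  qed
qed

text \<open>By Euler's formulas an integral with weight \<open>1 + cos b\<close> or
  \<open>1 + sin b\<close> is a combination of integrals without that weight, at the phases
  \<open>a\<close>, \<open>a + b\<close> and \<open>a - b\<close>.\<close>

lemma integral_cos_sin_iexp:
  fixes a b p :: "'a \<Rightarrow> real"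
  assumes "prob_space M"
    and [measurable]: "a \<in> borel_measurable M" "b \<in> borel_measurable M" "p \<in> borel_measurable M"
    and p: "\<And>w. \<bar>p w\<bar> \<le> 1"
  shows "(CLINT w|M. complex_of_real (p w * (1 + cos (b w))) * iexp (a w)) =
      (CLINT w|M. complex_of_real (p w) * iexp (a w))
       + ((CLINT w|M. complex_of_real (p w) * iexp (a w + b w)) + (CLINT w|M. complex_of_real (p w) * iexp (a w - b w))) / 2"
    and "(CLINT w|M. complex_of_real (p w * (1 + sin (b w))) * iexp (a w)) =
      (CLINT w|M. complex_of_real (p w) * iexp (a w))
       + ((CLINT w|M. complex_of_real (p w) * iexp (a w + b w)) - (CLINT w|M. complex_of_real (p w) * iexp (a w - b w))) / (2 * \<i>)"
proof -
  interpret prob_space M by fact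
  have int: "integrable M (\<lambda>w. complex_of_real (p w) * iexp (h w))" if [measurable]: "h \<in> borel_measurable M" for h
    using p by (intro integrable_const_bound[of _ 1]) (auto simp: norm_mult)
  have c: "complex_of_real (cos y) = (iexp y + iexp (- y)) / 2"
    and s: "complex_of_real (sin y) = (iexp y - iexp (- y)) / (2 * \<i>)" for y
    by (simp_all add: cos_exp_eq sin_exp_eq del: cos_of_real sin_of_real flip: cos_of_real sin_of_real)
  have ad: "iexp (x + y) = iexp x * iexp y" and df: "iexp (x - y) = iexp x * iexp (- y)" for x y
    by (simp_all add: exp_add[symmetric] algebra_simps)
  have alg: "q * (1 + (u + v) / 2) * x = q * x + (q * (x * u) + q * (x * v)) / 2"
    "q * (1 + (u - v) / (2 * \<i>)) * x = q * x + (q * (x * u) - q * (x * v)) / (2 * \<i>)" for q u v x :: complex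
    by (simp_all add: field_simps)
  have "complex_of_real (p w * (1 + cos (b w))) * iexp (a w) = complex_of_real (p w) * iexp (a w)
      + (complex_of_real (p w) * iexp (a w + b w) + complex_of_real (p w) * iexp (a w - b w)) / 2" for w
    unfolding ad df unfolding of_real_mult of_real_add of_real_1 c alg ..
  then show "(CLINT w|M. complex_of_real (p w * (1 + cos (b w))) * iexp (a w)) =
      (CLINT w|M. complex_of_real (p w) * iexp (a w))
       + ((CLINT w|M. complex_of_real (p w) * iexp (a w + b w)) + (CLINT w|M. complex_of_real (p w) * iexp (a w - b w))) / 2"
    using int[of a] int[of "\<lambda>w. a w + b w"] int[of "\<lambda>w. a w - b w"]
    by (simp del: of_real_mult of_real_add)
  have "complex_of_real (p w * (1 + sin (b w))) * iexp (a w) = complex_of_real (p w) * iexp (a w)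
      + (complex_of_real (p w) * iexp (a w + b w) - complex_of_real (p w) * iexp (a w - b w)) / (2 * \<i>)" for w
    unfolding ad df unfolding of_real_mult of_real_add of_real_1 s alg ..
  then show "(CLINT w|M. complex_of_real (p w * (1 + sin (b w))) * iexp (a w)) =
      (CLINT w|M. complex_of_real (p w) * iexp (a w))
       + ((CLINT w|M. complex_of_real (p w) * iexp (a w + b w)) - (CLINT w|M. complex_of_real (p w) * iexp (a w - b w))) / (2 * \<i>)"
    using int[of a] int[of "\<lambda>w. a w + b w"] int[of "\<lambda>w. a w - b w"]
    by (simp del: of_real_mult of_real_add)
qed

lemma integral_of_real_mult_iexp:
  assumes "integrable M u" "integrable M v" "\<And>w. x w * cos (y w) = u w" "\<And>w. x w * sin (y w) = v w"
  shows "(CLINT w|M. complex_of_real (x w) * iexp (y w)) =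
    complex_of_real (\<integral>w. u w \<partial>M) + \<i> * complex_of_real (\<integral>w. v w \<partial>M)"
proof -
  have "complex_of_real (x w) * iexp (y w) = complex_of_real (u w) + \<i> * complex_of_real (v w)" for w
    using assms(3)[of w] assms(4)[of w] by (simp add: complex_eq_iff Re_exp Im_exp)
  then show ?thesis
    using assms(1,2) by simp
qed

text \<open>Coordinates are handled one at a time: weighting the measure by the nonnegative function
  \<open>1 + cos S\<close> or \<open>1 + sin S\<close>, where \<open>S\<close> is a linear combination, reduces to one-dimensional
  Levy uniqueness.\<close>

lemma char_eq_imp_box_integral_eq:
  fixes X :: "'i \<Rightarrow> 'a \<Rightarrow> real" and Z :: "'i \<Rightarrow> 'b \<Rightarrow> real"
  assumes M: "prob_space M" and N: "prob_space N" and I: "finite I"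
    and X [measurable]: "\<And>i. i \<in> I \<Longrightarrow> X i \<in> borel_measurable M"
    and Z [measurable]: "\<And>i. i \<in> I \<Longrightarrow> Z i \<in> borel_measurable N"
    and eq: "\<And>c. (CLINT w|M. iexp (\<Sum>i\<in>I. c i * X i w)) = (CLINT w|N. iexp (\<Sum>i\<in>I. c i * Z i w))"
    and A [measurable]: "\<And>i. A i \<in> sets borel"
    and J: "J \<subseteq> I"
  shows "(CLINT w|M. complex_of_real (\<Prod>i\<in>J. indicator (A i) (X i w)) * iexp (\<Sum>i\<in>I. c i * X i w))
       = (CLINT w|N. complex_of_real (\<Prod>i\<in>J. indicator (A i) (Z i w)) * iexp (\<Sum>i\<in>I. c i * Z i w))"
proof -
  interpret M: prob_space M by fact
  interpret N: prob_space N by fact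
  have "finite J" using J I by (rule finite_subset)
  then show ?thesis using J
  proof (induction J arbitrary: c rule: finite_induct)
    case empty
    then show ?case using eq by simp
  next
    case (insert j J)
    then have j: "j \<in> I" and J: "J \<subseteq> I" by auto
    have [measurable]: "X j \<in> borel_measurable M" "Z j \<in> borel_measurable N" using j by auto
    have [measurable]: "\<And>i. i \<in> J \<Longrightarrow> X i \<in> borel_measurable M" "\<And>i. i \<in> J \<Longrightarrow> Z i \<in> borel_measurable N"
      using J by auto
    define p where "p w = (\<Prod>i\<in>J. indicator (A i) (X i w) :: real)" for w
    define q where "q w = (\<Prod>i\<in>J. indicator (A i) (Z i w) :: real)" for w
    define S where "S w = (\<Sum>i\<in>I. c i * X i w)" for w
    define R where "R w = (\<Sum>i\<in>I. c i * Z i w)" for w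
    have [measurable]: "p \<in> borel_measurable M" "q \<in> borel_measurable N" "S \<in> borel_measurable M" "R \<in> borel_measurable N"
      unfolding p_def q_def S_def R_def by measurable
    have p: "0 \<le> p w" "p w \<le> 1" for w
      unfolding p_def by (auto intro!: prod_nonneg prod_le_1)
    have q: "0 \<le> q w" "q w \<le> 1" for w
      unfolding q_def by (auto intro!: prod_nonneg prod_le_1)
    \<comment> \<open>The three phases above arise from the frequency vectors that are
      \<open>s\<close> at \<open>j\<close> and 0 elsewhere, plus 0, \<open>c\<close> or
      \<open>- c\<close>; the induction hypothesis is used at these.\<close>
    have comb: "(\<Sum>i\<in>I. (if i = j then s else 0) * V i) = s * V j"
      "(\<Sum>i\<in>I. ((if i = j then s else 0) + c i) * V i) = s * V j + (\<Sum>i\<in>I. c i * V i)"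
      "(\<Sum>i\<in>I. ((if i = j then s else 0) - c i) * V i) = s * V j - (\<Sum>i\<in>I. c i * V i)"
      for s and V :: "'i \<Rightarrow> real"
      using I j by (simp_all add: distrib_right left_diff_distrib sum.distrib sum_subtractf if_distrib[of "\<lambda>x. x * _"] cong: if_cong)
    have IH: "(CLINT w|M. complex_of_real (p w) * iexp (s * X j w)) = (CLINT w|N. complex_of_real (q w) * iexp (s * Z j w))"
      "(CLINT w|M. complex_of_real (p w) * iexp (s * X j w + S w)) = (CLINT w|N. complex_of_real (q w) * iexp (s * Z j w + R w))"
      "(CLINT w|M. complex_of_real (p w) * iexp (s * X j w - S w)) = (CLINT w|N. complex_of_real (q w) * iexp (s * Z j w - R w))"
      for s
      using insert.IH[OF J, of "\<lambda>i. if i = j then s else 0"]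
        insert.IH[OF J, of "\<lambda>i. (if i = j then s else 0) + c i"]
        insert.IH[OF J, of "\<lambda>i. (if i = j then s else 0) - c i"]
      unfolding comb p_def q_def S_def R_def by auto
    let ?A = "\<lambda>x. indicator (A j) x :: real"
    have pq1: "\<bar>p w\<bar> \<le> 1" "\<bar>q w'\<bar> \<le> 1" for w w' using p q by auto
    have e0: "(\<integral>w. p w * ?A (X j w) \<partial>M) = (\<integral>w. q w * ?A (Z j w) \<partial>N)"
      using p q IH by (intro weighted_Levy_uniqueness[OF M N, where K = 1]) auto
    have bd: "x * (1 + cos y) \<le> 2" "x * (1 + sin y) \<le> 2" "0 \<le> x * (1 + cos y)" "0 \<le> x * (1 + sin y)"
      if "0 \<le> x" "x \<le> 1" for x y :: real
    proof -
      have "0 \<le> 1 + cos y" "1 + cos y \<le> 2" "0 \<le> 1 + sin y" "1 + sin y \<le> 2"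
        using cos_ge_minus_one[of y] cos_le_one[of y] sin_ge_minus_one[of y] sin_le_one[of y] by linarith+
      with that show "x * (1 + cos y) \<le> 2" "x * (1 + sin y) \<le> 2" "0 \<le> x * (1 + cos y)" "0 \<le> x * (1 + sin y)"
        using mult_mono[of x 1 "1 + cos y" 2] mult_mono[of x 1 "1 + sin y" 2] by auto
    qed
    have e1: "(\<integral>w. (p w * (1 + cos (S w))) * ?A (X j w) \<partial>M) = (\<integral>w. (q w * (1 + cos (R w))) * ?A (Z j w) \<partial>N)"
      using p q bd IH pq1
      by (intro weighted_Levy_uniqueness[OF M N, where K = 2])
         (simp_all add: integral_cos_sin_iexp(1)[OF M] integral_cos_sin_iexp(1)[OF N] del: of_real_mult of_real_add)
    have e2: "(\<integral>w. (p w * (1 + sin (S w))) * ?A (X j w) \<partial>M) = (\<integral>w. (q w * (1 + sin (R w))) * ?A (Z j w) \<partial>N)"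
      using p q bd IH pq1
      by (intro weighted_Levy_uniqueness[OF M N, where K = 2])
         (simp_all add: integral_cos_sin_iexp(2)[OF M] integral_cos_sin_iexp(2)[OF N] del: of_real_mult of_real_add)
    have ind: "\<bar>x * ?A y\<bar> \<le> 1" if "\<bar>x\<bar> \<le> 1" for x y using that by (auto simp: indicator_def)
    have ind2: "\<bar>x * z * ?A y\<bar> \<le> 1" if "\<bar>x\<bar> \<le> 1" "\<bar>z\<bar> \<le> 1" for x y z :: real
      using that mult_mono[of "\<bar>x\<bar>" 1 "\<bar>z\<bar>" 1] by (auto simp: indicator_def abs_mult)
    have i[simp]: "integrable M (\<lambda>w. p w * ?A (X j w))" "integrable N (\<lambda>w. q w * ?A (Z j w))"
      "integrable M (\<lambda>w. p w * cos (S w) * ?A (X j w))" "integrable N (\<lambda>w. q w * cos (R w) * ?A (Z j w))"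
      "integrable M (\<lambda>w. p w * sin (S w) * ?A (X j w))" "integrable N (\<lambda>w. q w * sin (R w) * ?A (Z j w))"
      by (rule M.integrable_const_bound[of _ 1] N.integrable_const_bound[of _ 1];
          (simp add: ind ind2 pq1 del: abs_mult; fail)?; measurable)+
    \<comment> \<open>The summand 1 in the weights ensured nonnegativity. Subtracting
      \<open>e0\<close> leaves the cosine and sine parts, from which the integral with
      \<open>iexp (S w)\<close> is reassembled.\<close>
    have c: "(\<integral>w. p w * cos (S w) * ?A (X j w) \<partial>M) = (\<integral>w. q w * cos (R w) * ?A (Z j w) \<partial>N)"
      and s: "(\<integral>w. p w * sin (S w) * ?A (X j w) \<partial>M) = (\<integral>w. q w * sin (R w) * ?A (Z j w) \<partial>N)"
      using e0 e1 e2 by (simp_all add: distrib_left distrib_right)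
    have "(CLINT w|M. complex_of_real (p w * ?A (X j w)) * iexp (S w)) =
      complex_of_real (\<integral>w. p w * cos (S w) * ?A (X j w) \<partial>M) + \<i> * complex_of_real (\<integral>w. p w * sin (S w) * ?A (X j w) \<partial>M)"
      by (rule integral_of_real_mult_iexp) (use i in \<open>simp_all add: mult_ac\<close>)
    moreover have "(CLINT w|N. complex_of_real (q w * ?A (Z j w)) * iexp (R w)) =
      complex_of_real (\<integral>w. q w * cos (R w) * ?A (Z j w) \<partial>N) + \<i> * complex_of_real (\<integral>w. q w * sin (R w) * ?A (Z j w) \<partial>N)"
      by (rule integral_of_real_mult_iexp) (use i in \<open>simp_all add: mult_ac\<close>)
    ultimately show ?case
      using c s insert.hyps by (simp add: p_def q_def S_def R_def mult.commute)
  qed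
qed

theorem cramer_wold:
  fixes X :: "'i \<Rightarrow> 'a \<Rightarrow> real" and Z :: "'i \<Rightarrow> 'b \<Rightarrow> real"
  assumes M: "prob_space M" and N: "prob_space N" and I: "finite I"
    and X [measurable]: "\<And>i. i \<in> I \<Longrightarrow> X i \<in> borel_measurable M"
    and Z [measurable]: "\<And>i. i \<in> I \<Longrightarrow> Z i \<in> borel_measurable N"
    and eq: "\<And>c. (CLINT w|M. iexp (\<Sum>i\<in>I. c i * X i w)) = (CLINT w|N. iexp (\<Sum>i\<in>I. c i * Z i w))"
  shows "distr M (PiM I (\<lambda>_. borel)) (\<lambda>w. \<lambda>i\<in>I. X i w) = distr N (PiM I (\<lambda>_. borel)) (\<lambda>w. \<lambda>i\<in>I. Z i w)"
    (is "?P = ?Q")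
proof (rule measure_eqI_PiM_finite[OF I])
  interpret M: prob_space M by fact
  interpret N: prob_space N by fact
  interpret D: prob_space ?P by (intro M.prob_space_distr) measurable
  show "sets ?P = sets (PiM I (\<lambda>_. borel))" "sets ?Q = sets (PiM I (\<lambda>_. borel))" by auto
  show "range (\<lambda>_. Pi\<^sub>E I (\<lambda>_. UNIV)) \<subseteq> prod_algebra I (\<lambda>_. borel :: real measure)"
    using I by (auto intro!: prod_algebraI_finite)
  show "(\<Union>i. Pi\<^sub>E I (\<lambda>_. UNIV)) = space (PiM I (\<lambda>_. borel :: real measure))"
    by (simp add: space_PiM)
  show "emeasure ?P (Pi\<^sub>E I (\<lambda>_. UNIV)) \<noteq> \<infinity>" by simp
  fix A :: "'i \<Rightarrow> real set" assume A: "\<And>i. i \<in> I \<Longrightarrow> A i \<in> sets borel"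
  \<comment> \<open>The box lemma asks for a Borel set at every index, whereas \<open>A\<close> is
    controlled only on \<open>I\<close>.\<close>
  define A' where "A' i = (if i \<in> I then A i else {})" for i
  have A'[measurable]: "A' i \<in> sets borel" for i using A by (auto simp: A'_def)
  have PiE: "Pi\<^sub>E I A = Pi\<^sub>E I A'" by (intro PiE_cong) (auto simp: A'_def)
  have [measurable]: "Pi\<^sub>E I A' \<in> sets (PiM I (\<lambda>_. borel))" using I by (intro sets_PiM_I_finite) auto
  have ind: "(\<Prod>i\<in>I. indicator (A' i) (V i)) = (indicator (Pi\<^sub>E I A') (\<lambda>i\<in>I. V i) :: real)" for V :: "'i \<Rightarrow> real"
    using I by (auto simp: indicator_def PiE_iff prod_zero_iff split: if_splits intro!: prod.neutral)
  have "(CLINT w|M. complex_of_real (\<Prod>i\<in>I. indicator (A' i) (X i w)) * iexp (\<Sum>i\<in>I. 0 * X i w))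
       = (CLINT w|N. complex_of_real (\<Prod>i\<in>I. indicator (A' i) (Z i w)) * iexp (\<Sum>i\<in>I. 0 * Z i w))"
    by (rule char_eq_imp_box_integral_eq[OF M N I]; fact X Z eq A' subset_refl)
  then have "complex_of_real (\<integral>w. indicator (Pi\<^sub>E I A') (\<lambda>i\<in>I. X i w) \<partial>M) = complex_of_real (\<integral>w. indicator (Pi\<^sub>E I A') (\<lambda>i\<in>I. Z i w) \<partial>N)"
    unfolding ind by simp
  then have r: "(\<integral>w. indicator (Pi\<^sub>E I A') (\<lambda>i\<in>I. X i w) \<partial>M) = (\<integral>w. indicator (Pi\<^sub>E I A') (\<lambda>i\<in>I. Z i w) \<partial>N :: real)"
    by (simp only: of_real_eq_iff)
  interpret D': prob_space ?Q by (intro N.prob_space_distr) measurable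
  have "measure ?P (Pi\<^sub>E I A') = (\<integral>w. indicator (Pi\<^sub>E I A') (\<lambda>i\<in>I. X i w) \<partial>M)"
    by (subst integral_distr[symmetric, where N = "PiM I (\<lambda>_. borel)"]) auto
  moreover have "measure ?Q (Pi\<^sub>E I A') = (\<integral>w. indicator (Pi\<^sub>E I A') (\<lambda>i\<in>I. Z i w) \<partial>N)"
    by (subst integral_distr[symmetric, where N = "PiM I (\<lambda>_. borel)"]) auto
  ultimately show "emeasure ?P (Pi\<^sub>E I A) = emeasure ?Q (Pi\<^sub>E I A)"
    unfolding PiE using r by (simp add: D.emeasure_eq_measure D'.emeasure_eq_measure)
qed

section \<open>Bounds on the Kullback--Leibler divergence\<close>

text \<open>An infinite negative part would make \<^const>\<open>KL_div\<close> equal to \<open>-\<infinity>\<close>.  It is excluded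
  by \<open>- ln y \<le> 1 / y\<close>, since the reciprocal of a density integrates to at most 1.\<close>

lemma nn_integral_inverse_density_le:
  assumes Q: "prob_space Q" and [measurable]: "f \<in> borel_measurable Q" "h \<in> borel_measurable Q"
    and f: "\<And>z. 0 \<le> f z" and h: "\<And>z. 0 \<le> h z" and P: "P = density Q (\<lambda>z. ennreal (f z))"
  shows "(\<integral>\<^sup>+z. ennreal (h z / f z) \<partial>P) \<le> (\<integral>\<^sup>+z. ennreal (h z) \<partial>Q)"
proof -
  have "(\<integral>\<^sup>+z. ennreal (h z / f z) \<partial>P) = (\<integral>\<^sup>+z. ennreal (f z) * ennreal (h z / f z) \<partial>Q)"
    unfolding P by (subst nn_integral_density) auto
  also have "\<dots> \<le> (\<integral>\<^sup>+z. ennreal (h z) \<partial>Q)"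
    using f h by (intro nn_integral_mono) (auto simp: ennreal_mult[symmetric] intro!: ennreal_leI)
  finally show ?thesis .
qed

text \<open>\<open>KL_div\<close> refers to \<open>RN_deriv\<close>, which agrees with a given
  density only almost everywhere under \<open>Q\<close>, and hence under \<open>P\<close>.
  Finiteness of the negative part rules out an undetermined difference of infinities.\<close>

lemma KL_div_density:
  assumes P: "prob_space P" and Q: "prob_space Q" and [measurable]: "f \<in> borel_measurable Q"
    and f: "\<And>z. 0 \<le> f z" and PQ: "P = density Q (\<lambda>z. ennreal (f z))"
  shows "KL_div P Q = enn2ereal (\<integral>\<^sup>+z. ennreal (ln (f z)) \<partial>P) - enn2ereal (\<integral>\<^sup>+z. ennreal (- ln (f z)) \<partial>P)"
    and "(\<integral>\<^sup>+z. ennreal (- ln (f z)) \<partial>P) < \<infinity>"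
    and "AE z in P. 0 < f z"
proof -
  interpret P: prob_space P by fact
  interpret Q: prob_space Q by fact
  have sets[measurable_cong]: "sets P = sets Q" by (simp add: PQ)
  have ac: "absolutely_continuous Q P" unfolding PQ by (intro absolutely_continuousI_density) auto
  have "AE z in Q. ennreal (f z) = RN_deriv Q P z"
    by (rule Q.RN_deriv_unique) (auto simp: PQ)
  then have "AE z in Q. enn2real (RN_deriv Q P z) = f z"
    by eventually_elim (metis f enn2real_ennreal)
  then have ae: "AE z in P. enn2real (RN_deriv Q P z) = f z"
    by (rule absolutely_continuous_AE[OF sets ac])
  show pos: "AE z in P. 0 < f z"
    unfolding PQ by (subst AE_density) (use f in \<open>auto simp: less_le\<close>)
  show "KL_div P Q = enn2ereal (\<integral>\<^sup>+z. ennreal (ln (f z)) \<partial>P) - enn2ereal (\<integral>\<^sup>+z. ennreal (- ln (f z)) \<partial>P)"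
    unfolding KL_div_def Let_def using sets ac ae
    by (auto intro!: arg_cong2[where f = minus] arg_cong[where f = enn2ereal] nn_integral_cong_AE)
  have "(\<integral>\<^sup>+z. ennreal (- ln (f z)) \<partial>P) \<le> (\<integral>\<^sup>+z. ennreal (1 / f z) \<partial>P)"
  proof (intro nn_integral_mono_AE, use pos in eventually_elim)
    fix z assume z: "0 < f z"
    have "- ln (f z) = ln (1 / f z)" using z by (simp add: ln_div)
    also have "\<dots> \<le> 1 / f z" using z ln_le_minus_one[of "1 / f z"] by simp
    finally show "ennreal (- ln (f z)) \<le> ennreal (1 / f z)" by (rule ennreal_leI)
  qed
  also have "\<dots> \<le> (\<integral>\<^sup>+z. ennreal 1 \<partial>Q)"
    by (rule nn_integral_inverse_density_le[OF Q _ _ f _ PQ]) auto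
  also have "\<dots> = 1" by (simp add: Q.emeasure_space_1)
  finally show "(\<integral>\<^sup>+z. ennreal (- ln (f z)) \<partial>P) < \<infinity>"
    by (rule le_less_trans) simp
qed

lemma enn2ereal_diff_eq_integral:
  assumes [measurable]: "g \<in> borel_measurable P"
    and "(\<integral>\<^sup>+z. ennreal (g z) \<partial>P) < \<infinity>" "(\<integral>\<^sup>+z. ennreal (- g z) \<partial>P) < \<infinity>"
  shows "integrable P g"
    and "enn2ereal (\<integral>\<^sup>+z. ennreal (g z) \<partial>P) - enn2ereal (\<integral>\<^sup>+z. ennreal (- g z) \<partial>P) = ereal (\<integral>z. g z \<partial>P)"
proof -
  show int: "integrable P g" using assms by (subst real_integrable_def) auto
  have e: "enn2ereal x = ereal (enn2real x)" if "x < \<infinity>" for x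
    using that by (cases x) (auto simp: enn2ereal_ennreal)
  show "enn2ereal (\<integral>\<^sup>+z. ennreal (g z) \<partial>P) - enn2ereal (\<integral>\<^sup>+z. ennreal (- g z) \<partial>P) = ereal (\<integral>z. g z \<partial>P)"
    using assms(2,3) by (simp add: e real_lebesgue_integral_def[OF int])
qed

text \<open>\<open>k\<close> stands for the ratio of a reference density to a true density. Since
  \<open>ln k <= k - 1\<close> and \<open>k\<close> has mean at most 1, replacing an intractable
  marginal by a convenient reference can only increase the bound.\<close>

lemma KL_div_le:
  assumes P: "prob_space P" and Q: "prob_space Q" and [measurable]: "f \<in> borel_measurable Q"
    and f: "\<And>z. 0 \<le> f z" and PQ: "P = density Q (\<lambda>z. ennreal (f z))"
    and g: "integrable P g" and k: "k \<in> borel_measurable P" "\<And>z. 0 \<le> k z" "(\<integral>\<^sup>+z. ennreal (k z) \<partial>P) \<le> 1"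
    and le: "AE z in P. ln (f z) \<le> g z + k z - 1"
  shows "KL_div P Q \<le> ereal (\<integral>z. g z \<partial>P)"
proof -
  interpret P: prob_space P by fact
  note k(1)[measurable]
  have [measurable]: "f \<in> borel_measurable P" by (simp add: PQ)
  have ik: "integrable P k" using k le_less_trans[of _ 1 "\<infinity>::ennreal"] by (intro integrableI_nonneg) auto
  have "(\<integral>\<^sup>+z. ennreal (ln (f z)) \<partial>P) \<le> (\<integral>\<^sup>+z. ennreal (\<bar>g z\<bar> + k z) \<partial>P)"
    using le by (intro nn_integral_mono_AE) (auto elim!: eventually_mono intro!: ennreal_leI)
  also have "\<dots> = ennreal (\<integral>z. \<bar>g z\<bar> + k z \<partial>P)"
    using g ik k by (intro nn_integral_eq_integral) auto
  finally have fin: "(\<integral>\<^sup>+z. ennreal (ln (f z)) \<partial>P) < \<infinity>"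
    by (rule le_less_trans) simp
  note * = enn2ereal_diff_eq_integral[OF _ fin KL_div_density(2)[OF P Q _ f PQ]]
  have "(\<integral>z. ln (f z) \<partial>P) \<le> (\<integral>z. g z + k z - 1 \<partial>P)"
    using g ik le *(1) by (intro integral_mono_AE) auto
  also have "\<dots> = (\<integral>z. g z \<partial>P) + (\<integral>z. k z \<partial>P) - 1"
    using g ik by (simp add: P.prob_space)
  also have "(\<integral>z. k z \<partial>P) \<le> 1"
    using k(3) nn_integral_eq_integral[OF ik] k(2) by simp
  finally show ?thesis
    using *(2) KL_div_density(1)[OF P Q _ f PQ] by simp
qed

text \<open>With \<open>k = exp g / f\<close> one has
  \<open>g = ln f + ln k <= ln f + k - 1\<close>, and the mean of \<open>k\<close> under
  \<open>P\<close> is at most the integral of \<open>exp g\<close> under \<open>Q\<close>.\<close>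

lemma KL_div_ge:
  assumes P: "prob_space P" and Q: "prob_space Q"
    and b: "KL_div P Q \<le> ereal b" and g: "integrable P g"
    and le: "(\<integral>\<^sup>+z. ennreal (exp (g z)) \<partial>Q) \<le> 1"
  shows "(\<integral>z. g z \<partial>P) \<le> b"
proof -
  interpret P: prob_space P by fact
  interpret Q: prob_space Q by fact
  from b have sets[measurable_cong]: "sets P = sets Q" and ac: "absolutely_continuous Q P"
    by (auto simp: KL_div_def split: if_splits)
  have gP[measurable]: "g \<in> borel_measurable P" using g by auto
  then have [measurable]: "g \<in> borel_measurable Q"
    by (subst measurable_cong_sets[OF sets[symmetric] refl])
  define f where "f z = enn2real (RN_deriv Q P z)" for z
  have fQ[measurable]: "f \<in> borel_measurable Q" unfolding f_def by measurable
  have f: "0 \<le> f z" for z by (simp add: f_def)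
  have "AE z in Q. RN_deriv Q P z \<noteq> \<infinity>"
    by (rule Q.RN_deriv_finite) (fact P.sigma_finite_measure_axioms ac sets)+
  then have "AE z in Q. ennreal (f z) = RN_deriv Q P z"
    by eventually_elim (simp add: f_def less_top)
  then have "density Q (\<lambda>z. ennreal (f z)) = density Q (RN_deriv Q P)"
    by (intro density_cong) auto
  then have PQ: "P = density Q (\<lambda>z. ennreal (f z))"
    using Q.density_RN_deriv[OF ac sets] by simp
  have [measurable]: "f \<in> borel_measurable P" by (subst measurable_cong_sets[OF sets refl]) measurable
  note K = KL_div_density[OF P Q fQ f PQ]
  \<comment> \<open>The negative part being finite, an infinite positive part would make the
    divergence infinite, against the bound \<open>b\<close>.\<close>
  have fin: "(\<integral>\<^sup>+z. ennreal (ln (f z)) \<partial>P) < \<infinity>"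
  proof (rule ccontr)
    assume "\<not> ?thesis"
    then have "(\<integral>\<^sup>+z. ennreal (ln (f z)) \<partial>P) = top" by (simp add: less_top[symmetric])
    then have "KL_div P Q = \<infinity>" using K(1,2) by (cases "\<integral>\<^sup>+z. ennreal (- ln (f z)) \<partial>P") (auto simp: enn2ereal_ennreal)
    with b show False by simp
  qed
  note * = enn2ereal_diff_eq_integral[OF _ fin K(2)]
  define k where "k z = exp (g z) / f z" for z
  have [measurable]: "k \<in> borel_measurable P" unfolding k_def by measurable
  have k0: "0 \<le> k z" for z using f by (simp add: k_def)
  have k1: "(\<integral>\<^sup>+z. ennreal (k z) \<partial>P) \<le> 1"
    unfolding k_def using nn_integral_inverse_density_le[OF Q _ _ f _ PQ, of "\<lambda>z. exp (g z)"] le by simp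
  then have ik: "integrable P k" using k0 le_less_trans[of _ 1 "\<infinity>::ennreal"] by (intro integrableI_nonneg) auto
  have "AE z in P. g z \<le> ln (f z) + (k z - 1)"
  proof (rule eventually_mono[OF K(3)])
    fix z assume z: "0 < f z"
    have "g z - ln (f z) = ln (k z)" using z by (simp add: k_def ln_div)
    also have "\<dots> \<le> k z - 1" using z by (intro ln_le_minus_one) (simp add: k_def)
    finally show "g z \<le> ln (f z) + (k z - 1)" by simp
  qed
  then have "(\<integral>z. g z \<partial>P) \<le> (\<integral>z. ln (f z) + (k z - 1) \<partial>P)"
    using g ik *(1) by (intro integral_mono_AE) auto
  also have "\<dots> = (\<integral>z. ln (f z) \<partial>P) + ((\<integral>z. k z \<partial>P) - 1)"
    using *(1) ik by (simp add: P.prob_space)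
  also have "(\<integral>z. k z \<partial>P) \<le> 1"
    using k1 nn_integral_eq_integral[OF ik] k0 by simp
  also have "(\<integral>z. ln (f z) \<partial>P) \<le> b"
    using *(2) K(1) b by simp
  finally show ?thesis by simp
qed

section \<open>Gaussian vectors in eigencoordinates\<close>

lemma orthogonal_matrix_columns:
  assumes "orthogonal_matrix (U :: real^'d^'d)"
  shows "column i U \<bullet> column j U = (if i = j then 1 else 0)"
proof -
  have "transpose U ** U = mat 1" using assms by (simp add: orthogonal_matrix_def)
  then have "(transpose U ** U) $ i $ j = mat 1 $ i $ j" by simp
  then show ?thesis by (simp add: matrix_mult_transpose_dot_column mat_def)
qed

lemma matrix_mult_diag_transpose:
  "(U ** diag_mat v ** transpose U) *v x = (\<Sum>i\<in>UNIV. (v i * (column i U \<bullet> x)) *\<^sub>R column i (U :: real^'d^'d))"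
proof -
  have "((U ** diag_mat v ** transpose U) *v x) $ j = (\<Sum>i\<in>UNIV. (v i * (column i U \<bullet> x)) *\<^sub>R column i U) $ j" for j
  proof -
    have "((U ** diag_mat v ** transpose U) *v x) $ j = (\<Sum>k\<in>UNIV. \<Sum>i\<in>UNIV. U $ j $ i * v i * U $ k $ i * x $ k)"
      by (simp add: matrix_vector_mult_def matrix_matrix_mult_def diag_mat_def transpose_def sum_distrib_right
          if_distrib[of "\<lambda>y. _ * y"] cong: if_cong)
    also have "\<dots> = (\<Sum>i\<in>UNIV. \<Sum>k\<in>UNIV. U $ j $ i * v i * U $ k $ i * x $ k)" by (rule sum.swap)
    finally show ?thesis
      by (simp add: column_def inner_vec_def sum_distrib_left sum_distrib_right mult_ac)
  qed
  then show ?thesis by (simp add: vec_eq_iff)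
qed

lemma orthogonal_matrix_expand:
  assumes "orthogonal_matrix (U :: real^'d^'d)"
  shows "(\<Sum>i\<in>UNIV. (column i U \<bullet> x) *\<^sub>R column i U) = x"
proof -
  have "diag_mat (\<lambda>_. 1) = (mat 1 :: real^'d^'d)" by (simp add: diag_mat_def mat_def)
  then have "(U ** diag_mat (\<lambda>_. 1) ** transpose U) *v x = x"
    using assms by (simp add: orthogonal_matrix_def del: transpose_matrix_vector)
  then show ?thesis by (simp add: matrix_mult_diag_transpose)
qed

lemma inner_column_sum:
  assumes "orthogonal_matrix (U :: real^'d^'d)"
  shows "column j U \<bullet> (\<Sum>i\<in>UNIV. c i *\<^sub>R column i U) = c j"
  using assms by (simp add: inner_sum_right orthogonal_matrix_columns if_distrib[of "\<lambda>y. _ * y"] cong: if_cong)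

lemma orthogonal_matrix_parseval:
  assumes "orthogonal_matrix (U :: real^'d^'d)"
  shows "(\<Sum>i\<in>UNIV. (column i U \<bullet> x)\<^sup>2) = (norm x)\<^sup>2"
proof -
  have "(norm x)\<^sup>2 = x \<bullet> (\<Sum>i\<in>UNIV. (column i U \<bullet> x) *\<^sub>R column i U)"
    using orthogonal_matrix_expand[OF assms, of x] by (simp add: power2_norm_eq_inner)
  then show ?thesis by (simp add: inner_sum_right power2_eq_square inner_commute)
qed

lemma inner_column_matrix_mult_diag:
  assumes "orthogonal_matrix (U :: real^'d^'d)"
  shows "column j U \<bullet> ((U ** diag_mat v ** transpose U) *v x) = v j * (column j U \<bullet> x)"
  using inner_column_sum[OF assms] by (simp add: matrix_mult_diag_transpose)

lemma quadratic_form_diag: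
  "a \<bullet> ((U ** diag_mat v ** transpose U) *v a) = (\<Sum>i\<in>UNIV. v i * (column i (U :: real^'d^'d) \<bullet> a)\<^sup>2)"
  by (simp add: matrix_mult_diag_transpose inner_sum_right power2_eq_square inner_commute mult_ac)

lemma distr_normal_vec_column:
  assumes P: "is_normal_vec P 0 (U ** diag_mat v ** transpose U)" and U: "orthogonal_matrix (U :: real^'d^'d)"
  shows "distr P borel (\<lambda>x. column i U \<bullet> x) = normal1 0 (v i)"
proof -
  have "column i U \<bullet> ((U ** diag_mat v ** transpose U) *v column i U) = v i"
    by (subst inner_column_matrix_mult_diag[OF U]) (simp add: orthogonal_matrix_columns[OF U])
  then show ?thesis using P by (simp add: is_normal_vec_def)
qed

text \<open>A combination of eigencoordinates is the inner product with one vector \<open>a\<close>,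
  so its law is known from \<open>is_normal_vec\<close>. Its characteristic function factors over
  the coordinates, and the Cramer-Wold theorem identifies the joint law; vanishing variances are
  included.\<close>

lemma distr_normal_vec_columns:
  assumes P: "is_normal_vec P 0 (U ** diag_mat v ** transpose U)" and U: "orthogonal_matrix (U :: real^'d^'d)"
    and v: "\<And>i. 0 \<le> v i"
  shows "distr P (PiM UNIV (\<lambda>_. borel)) (\<lambda>x. \<lambda>i\<in>UNIV. column i U \<bullet> x) = PiM UNIV (\<lambda>i. normal1 0 (v i))"
proof -
  from P have pP: "prob_space P" and sP[measurable_cong]: "sets P = sets borel" by (auto simp: is_normal_vec_def)
  interpret pr: product_prob_space "\<lambda>i. normal1 0 (v i)" UNIV
    by (intro product_prob_spaceI prob_space_normal1)
  let ?N = "PiM UNIV (\<lambda>i. normal1 0 (v i))"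
  have sN[measurable_cong]: "sets ?N = sets (PiM UNIV (\<lambda>_. borel))" by (intro sets_PiM_cong) auto
  have eq: "(CLINT x|P. iexp (\<Sum>i\<in>UNIV. c i * (column i U \<bullet> x))) = (CLINT z|?N. iexp (\<Sum>i\<in>UNIV. c i * z i))" for c
  proof -
    define a where "a = (\<Sum>i\<in>UNIV. c i *\<^sub>R column i U)"
    have "(CLINT x|P. iexp (\<Sum>i\<in>UNIV. c i * (column i U \<bullet> x))) = (CLINT x|P. iexp (1 * (a \<bullet> x)))"
      by (simp add: a_def inner_sum_left)
    also have "\<dots> = char (distr P borel (\<lambda>x. a \<bullet> x)) 1"
      unfolding char_def by (subst integral_distr) auto
    also have "distr P borel (\<lambda>x. a \<bullet> x) = normal1 0 (\<Sum>i\<in>UNIV. v i * (c i)\<^sup>2)"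
      using P by (simp add: is_normal_vec_def quadratic_form_diag a_def inner_column_sum[OF U])
    \<comment> \<open>\<open>char_normal1\<close> involves the absolute value of the whole sum;
      nonnegativity of the \<open>v i\<close> lets it pass to the summands.\<close>
    also have "char \<dots> 1 = complex_of_real (exp (\<Sum>i\<in>UNIV. - \<bar>v i\<bar> * (c i)\<^sup>2 / 2))"
      using v by (simp add: char_normal1 sum_nonneg sum_negf sum_divide_distrib)
    also have "\<dots> = (\<Prod>i\<in>UNIV. char (normal1 0 (v i)) (c i))"
      by (simp add: char_normal1 exp_sum)
    also have "\<dots> = (CLINT z|?N. (\<Prod>i\<in>UNIV. iexp (c i * z i)))"
      unfolding char_def
    proof (rule pr.product_integral_prod[symmetric])
      fix i :: 'd
      show "integrable (normal1 0 (v i)) (\<lambda>z. iexp (c i * z))"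
        by (intro finite_measure.integrable_const_bound[of _ _ 1] prob_space.finite_measure prob_space_normal1) auto
    qed simp
    also have "\<dots> = (CLINT z|?N. iexp (\<Sum>i\<in>UNIV. c i * z i))"
      by (simp add: exp_sum[symmetric] sum_distrib_left)
    finally show ?thesis .
  qed
  have "distr P (PiM UNIV (\<lambda>_. borel)) (\<lambda>x. \<lambda>i\<in>UNIV. column i U \<bullet> x)
      = distr ?N (PiM UNIV (\<lambda>_. borel)) (\<lambda>z. \<lambda>i\<in>UNIV. z i)"
    by (rule cramer_wold[OF pP prob_space_PiM[OF prob_space_normal1] _ _ _ eq]) auto
  also have "\<dots> = ?N"
    unfolding restrict_UNIV by (rule distr_id2) (simp add: sN)
  finally show ?thesis .
qed

text \<open>Independence of the eigencoordinates as a factorisation: it reduces shifts, reference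
  densities and tilts to one-dimensional integrals.\<close>

lemma nn_integral_normal_vec_prod:
  assumes P: "is_normal_vec P 0 (U ** diag_mat v ** transpose U)" and U: "orthogonal_matrix (U :: real^'d^'d)"
    and v: "\<And>i. 0 \<le> v i" and f [measurable]: "\<And>i. f i \<in> borel_measurable borel"
  shows "(\<integral>\<^sup>+x. (\<Prod>i\<in>UNIV. f i (column i U \<bullet> x)) \<partial>P) = (\<Prod>i\<in>UNIV. \<integral>\<^sup>+x. f i x \<partial>normal1 0 (v i))"
proof -
  from P have sP[measurable_cong]: "sets P = sets borel" by (auto simp: is_normal_vec_def)
  interpret pr: product_prob_space "\<lambda>i. normal1 0 (v i)" UNIV
    by (intro product_prob_spaceI prob_space_normal1)
  have "(\<integral>\<^sup>+x. (\<Prod>i\<in>UNIV. f i (column i U \<bullet> x)) \<partial>P)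
      = (\<integral>\<^sup>+z. (\<Prod>i\<in>UNIV. f i (z i)) \<partial>distr P (PiM UNIV (\<lambda>_. borel)) (\<lambda>x. \<lambda>i\<in>UNIV. column i U \<bullet> x))"
    by (subst nn_integral_distr) auto
  also have "\<dots> = (\<integral>\<^sup>+z. (\<Prod>i\<in>UNIV. f i (z i)) \<partial>PiM UNIV (\<lambda>i. normal1 0 (v i)))"
    by (simp only: distr_normal_vec_columns[OF P U v])
  also have "\<dots> = (\<Prod>i\<in>UNIV. \<integral>\<^sup>+x. f i x \<partial>normal1 0 (v i))"
    by (rule pr.product_nn_integral_prod) auto
  finally show ?thesis .
qed

text \<open>Boxes aligned with the columns of an orthogonal matrix determine a law, because a vector
  is recovered measurably from its coordinates \<open>?c\<close> by the expansion
  \<open>?d\<close>.\<close>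

lemma measure_eqI_columns:
  fixes P Q :: "(real^'d) measure"
  assumes U: "orthogonal_matrix U" and P: "prob_space P" and s [measurable_cong]: "sets P = sets borel" "sets Q = sets borel"
    and eq: "\<And>A. (\<And>i. A i \<in> sets borel) \<Longrightarrow>
      (\<integral>\<^sup>+x. (\<Prod>i\<in>UNIV. indicator (A i) (column i U \<bullet> x)) \<partial>P) = (\<integral>\<^sup>+x. (\<Prod>i\<in>UNIV. indicator (A i) (column i U \<bullet> x)) \<partial>Q)"
  shows "P = Q"
proof -
  interpret P: prob_space P by fact
  let ?c = "\<lambda>x. \<lambda>i\<in>UNIV. column i U \<bullet> x"
  let ?d = "\<lambda>z. \<Sum>i\<in>UNIV. z i *\<^sub>R column i U"
  let ?P = "distr P (PiM UNIV (\<lambda>_. borel)) ?c" and ?Q = "distr Q (PiM UNIV (\<lambda>_. borel)) ?c"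
  have PQ: "?P = ?Q"
  proof (rule measure_eqI_PiM_finite)
    interpret D: prob_space ?P by (intro P.prob_space_distr) measurable
    show "range (\<lambda>_. Pi\<^sub>E UNIV (\<lambda>_. UNIV)) \<subseteq> prod_algebra UNIV (\<lambda>_::'d. borel :: real measure)"
      using prod_algebraI_finite[of UNIV "\<lambda>_. UNIV" "\<lambda>_::'d. borel :: real measure"] by auto
    show "(\<Union>i. Pi\<^sub>E UNIV (\<lambda>_. UNIV)) = space (PiM UNIV (\<lambda>_::'d. borel :: real measure))"
      by (simp add: space_PiM)
    show "emeasure ?P (Pi\<^sub>E UNIV (\<lambda>_. UNIV)) \<noteq> \<infinity>" by simp
    fix A :: "'d \<Rightarrow> real set" assume A: "\<And>i. i \<in> UNIV \<Longrightarrow> A i \<in> sets borel"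
    have [measurable]: "Pi\<^sub>E UNIV A \<in> sets (PiM UNIV (\<lambda>_. borel))" using A by (intro sets_PiM_I_finite) auto
    have ind: "(\<Prod>i\<in>UNIV. indicator (A i) (column i U \<bullet> x)) = (indicator (Pi\<^sub>E UNIV A) (?c x) :: ennreal)" for x
      by (auto simp: indicator_def PiE_iff prod_zero_iff intro!: prod.neutral)
    have "emeasure ?P (Pi\<^sub>E UNIV A) = (\<integral>\<^sup>+x. indicator (Pi\<^sub>E UNIV A) (?c x) \<partial>P)"
      by (subst nn_integral_distr[symmetric, where M' = "PiM UNIV (\<lambda>_. borel)"]) auto
    moreover have "emeasure ?Q (Pi\<^sub>E UNIV A) = (\<integral>\<^sup>+x. indicator (Pi\<^sub>E UNIV A) (?c x) \<partial>Q)"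
      by (subst nn_integral_distr[symmetric, where M' = "PiM UNIV (\<lambda>_. borel)"]) auto
    ultimately show "emeasure ?P (Pi\<^sub>E UNIV A) = emeasure ?Q (Pi\<^sub>E UNIV A)"
      using eq[of A, OF A[OF UNIV_I]] by (simp only: ind)
  qed auto
  have dc: "distr (distr R (PiM UNIV (\<lambda>_. borel)) ?c) borel ?d = R" if [measurable_cong]: "sets R = sets borel" for R
    by (subst distr_distr) (auto simp: comp_def orthogonal_matrix_expand[OF U] distr_id2 that)
  have "P = distr ?P borel ?d" by (rule dc[OF s(1), symmetric])
  also have "\<dots> = distr ?Q borel ?d" by (simp only: PQ)
  also have "\<dots> = Q" by (rule dc[OF s(2)])
  finally show ?thesis .
qed

text \<open>The Cameron-Martin formula for a possibly degenerate covariance. Along a column with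
  \<open>v i = 0\<close> there is no shift, and the corresponding exponent is 0 since division by
  zero gives zero.\<close>

lemma normal_vec_shift_density:
  assumes P: "is_normal_vec P 0 (U ** diag_mat v ** transpose U)" and U: "orthogonal_matrix (U :: real^'d^'d)"
    and v: "\<And>i. 0 \<le> v i" and m: "\<And>i. v i = 0 \<Longrightarrow> column i U \<bullet> m = 0"
  shows "distr P borel (\<lambda>e. m + e) = density P (\<lambda>x. ennreal (exp (\<Sum>i\<in>UNIV.
    (column i U \<bullet> m) * (column i U \<bullet> x) / v i - (column i U \<bullet> m)\<^sup>2 / (2 * v i))))"
proof (rule measure_eqI_columns[OF U])
  from P have pP: "prob_space P" and sP[measurable_cong]: "sets P = sets borel" by (auto simp: is_normal_vec_def)
  interpret P: prob_space P by fact
  show "prob_space (distr P borel (\<lambda>e. m + e))" by (intro P.prob_space_distr) auto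
  fix A :: "'d \<Rightarrow> real set" assume [measurable]: "\<And>i. A i \<in> sets borel"
  let ?m = "\<lambda>i. column i U \<bullet> m"
  let ?r = "\<lambda>i y. ennreal (exp (?m i * y / v i - (?m i)\<^sup>2 / (2 * v i)))"
  have "(\<integral>\<^sup>+x. (\<Prod>i\<in>UNIV. indicator (A i) (column i U \<bullet> x)) \<partial>density P (\<lambda>x. ennreal (exp (\<Sum>i\<in>UNIV.
      ?m i * (column i U \<bullet> x) / v i - (?m i)\<^sup>2 / (2 * v i)))))
    = (\<integral>\<^sup>+x. (\<Prod>i\<in>UNIV. ?r i (column i U \<bullet> x) * indicator (A i) (column i U \<bullet> x)) \<partial>P)"
    by (subst nn_integral_density) (auto simp: exp_sum prod.distrib prod_ennreal)
  also have "\<dots> = (\<Prod>i\<in>UNIV. \<integral>\<^sup>+y. ?r i y * indicator (A i) y \<partial>normal1 0 (v i))"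
    by (rule nn_integral_normal_vec_prod[OF P U v]) auto
  also have "\<dots> = (\<Prod>i\<in>UNIV. \<integral>\<^sup>+y. indicator (A i) (?m i + y) \<partial>normal1 0 (v i))"
  proof (rule prod.cong)
    fix i
    show "(\<integral>\<^sup>+y. ?r i y * indicator (A i) y \<partial>normal1 0 (v i)) = (\<integral>\<^sup>+y. indicator (A i) (?m i + y) \<partial>normal1 0 (v i))"
      using nn_integral_normal1_shift[of "v i" "indicator (A i)" "?m i"] v[of i] m[of i]
      by (cases "v i = 0") auto
  qed simp
  also have "\<dots> = (\<integral>\<^sup>+x. (\<Prod>i\<in>UNIV. indicator (A i) (?m i + column i U \<bullet> x)) \<partial>P)"
    by (rule nn_integral_normal_vec_prod[OF P U v, symmetric]) auto
  also have "\<dots> = (\<integral>\<^sup>+x. (\<Prod>i\<in>UNIV. indicator (A i) (column i U \<bullet> x)) \<partial>distr P borel (\<lambda>e. m + e))"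
    by (subst nn_integral_distr) (auto simp: inner_add_right)
  finally show "(\<integral>\<^sup>+x. (\<Prod>i\<in>UNIV. indicator (A i) (column i U \<bullet> x)) \<partial>distr P borel (\<lambda>e. m + e))
    = (\<integral>\<^sup>+x. (\<Prod>i\<in>UNIV. indicator (A i) (column i U \<bullet> x)) \<partial>density P (\<lambda>x. ennreal (exp (\<Sum>i\<in>UNIV.
      ?m i * (column i U \<bullet> x) / v i - (?m i)\<^sup>2 / (2 * v i)))))" by (rule sym)
qed (use P in \<open>auto simp: is_normal_vec_def\<close>)

section \<open>Square-integrable and jointly Gaussian variables\<close>

lemma distr_pair_snd':
  assumes "prob_space M" "sigma_finite_measure N"
  shows "distr (M \<Otimes>\<^sub>M N) N snd = N"
proof -
  interpret M: prob_space M by fact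
  interpret N: sigma_finite_measure N by fact
  show ?thesis
  proof (rule measure_eqI)
    fix A assume A: "A \<in> sets (distr (M \<Otimes>\<^sub>M N) N snd)"
    then have "snd -` A \<inter> space (M \<Otimes>\<^sub>M N) = space M \<times> A"
      using sets.sets_into_space by (fastforce simp: space_pair_measure)
    then show "emeasure (distr (M \<Otimes>\<^sub>M N) N snd) A = emeasure N A"
      using A by (simp add: emeasure_distr N.emeasure_pair_measure_Times M.emeasure_space_1)
  qed simp
qed

lemma
  fixes f :: "'a \<Rightarrow> 'c::{banach, second_countable_topology}" and g :: "'b \<Rightarrow> 'c"
  assumes M: "prob_space M" and N: "prob_space N"
  shows integrable_pair_fst: "integrable M f \<Longrightarrow> integrable (M \<Otimes>\<^sub>M N) (\<lambda>z. f (fst z))"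
    and integral_pair_fst: "f \<in> borel_measurable M \<Longrightarrow> (\<integral>z. f (fst z) \<partial>(M \<Otimes>\<^sub>M N)) = (\<integral>x. f x \<partial>M)"
    and integrable_pair_snd: "integrable N g \<Longrightarrow> integrable (M \<Otimes>\<^sub>M N) (\<lambda>z. g (snd z))"
    and integral_pair_snd: "g \<in> borel_measurable N \<Longrightarrow> (\<integral>z. g (snd z) \<partial>(M \<Otimes>\<^sub>M N)) = (\<integral>x. g x \<partial>N)"
proof -
  interpret N: prob_space N by fact
  have 1: "distr (M \<Otimes>\<^sub>M N) M fst = M" by (rule N.distr_pair_fst)
  have 2: "distr (M \<Otimes>\<^sub>M N) N snd = N" by (rule distr_pair_snd'[OF M N.sigma_finite_measure_axioms])
  show "integrable M f \<Longrightarrow> integrable (M \<Otimes>\<^sub>M N) (\<lambda>z. f (fst z))"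
    using integrable_distr[of fst "M \<Otimes>\<^sub>M N" M f] by (simp add: 1)
  show "f \<in> borel_measurable M \<Longrightarrow> (\<integral>z. f (fst z) \<partial>(M \<Otimes>\<^sub>M N)) = (\<integral>x. f x \<partial>M)"
    using integral_distr[of fst "M \<Otimes>\<^sub>M N" M f] by (simp add: 1)
  show "integrable N g \<Longrightarrow> integrable (M \<Otimes>\<^sub>M N) (\<lambda>z. g (snd z))"
    using integrable_distr[of snd "M \<Otimes>\<^sub>M N" N g] by (simp add: 2)
  show "g \<in> borel_measurable N \<Longrightarrow> (\<integral>z. g (snd z) \<partial>(M \<Otimes>\<^sub>M N)) = (\<integral>x. g x \<partial>N)"
    using integral_distr[of snd "M \<Otimes>\<^sub>M N" N g] by (simp add: 2)
qed

section \<open>Square-integrable functions and orthogonal projection\<close>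

definition square_integrable :: "'a measure \<Rightarrow> ('a \<Rightarrow> real) \<Rightarrow> bool" where
  "square_integrable M f \<longleftrightarrow> f \<in> borel_measurable M \<and> integrable M (\<lambda>w. (f w)\<^sup>2)"

lemma square_integrable_mult:
  assumes "square_integrable M f" "square_integrable M g"
  shows "integrable M (\<lambda>w. f w * g w)"
proof (rule Bochner_Integration.integrable_bound)
  show "integrable M (\<lambda>w. (f w)\<^sup>2 + (g w)\<^sup>2)" "(\<lambda>w. f w * g w) \<in> borel_measurable M"
    using assms by (auto simp: square_integrable_def)
  have "\<bar>x * y\<bar> \<le> x\<^sup>2 + y\<^sup>2" for x y :: real
  proof -
    have "2 * (\<bar>x\<bar> * \<bar>y\<bar>) \<le> x\<^sup>2 + y\<^sup>2" using sum_squares_bound[of "\<bar>x\<bar>" "\<bar>y\<bar>"] by simp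
    moreover have "0 \<le> \<bar>x\<bar> * \<bar>y\<bar>" by simp
    ultimately show ?thesis unfolding abs_mult by linarith
  qed
  then show "AE w in M. norm (f w * g w) \<le> norm ((f w)\<^sup>2 + (g w)\<^sup>2)" by simp
qed

lemma square_integrable_add:
  assumes "square_integrable M f" "square_integrable M g"
  shows "square_integrable M (\<lambda>w. f w + g w)"
  using assms square_integrable_mult[OF assms]
  by (auto simp: square_integrable_def power2_sum mult.assoc)

lemma square_integrable_cmult:
  "square_integrable M f \<Longrightarrow> square_integrable M (\<lambda>w. c * f w)"
  by (auto simp: square_integrable_def power_mult_distrib)

lemma square_integrable_diff:
  assumes "square_integrable M f" "square_integrable M g"
  shows "square_integrable M (\<lambda>w. f w - g w)"
  using square_integrable_add[OF assms(1) square_integrable_cmult[OF assms(2), of "-1"]] by simp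

lemma square_integrable_sum:
  "(\<And>i. i \<in> I \<Longrightarrow> square_integrable M (f i)) \<Longrightarrow> square_integrable M (\<lambda>w. \<Sum>i\<in>I. f i w)"
proof (induction I rule: infinite_finite_induct)
  case (insert i I)
  then show ?case by (simp add: square_integrable_add)
qed (auto simp: square_integrable_def)

lemma (in prob_space) square_integrable_imp_integrable:
  assumes "square_integrable M f"
  shows "integrable M f"
proof -
  have "square_integrable M (\<lambda>_. 1)" by (simp add: square_integrable_def)
  from square_integrable_mult[OF assms this] show ?thesis by simp
qed

text \<open>Gram-Schmidt: project \<open>Z\<close> and the new variable \<open>X k\<close> on the
  earlier variables, then remove from the first residual its component along the second. No Gram
  matrix is inverted, so linearly dependent variables are covered.\<close>

lemma L2_projection_exists:
  assumes "finite I" "\<And>i. i \<in> I \<Longrightarrow> square_integrable M (X i)" "square_integrable M Z"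
  shows "\<exists>c. \<forall>j\<in>I. (\<integral>w. (Z w - (\<Sum>i\<in>I. c i * X i w)) * X j w \<partial>M) = (0::real)"
  using assms
proof (induction I arbitrary: Z rule: finite_induct)
  case empty
  then show ?case by simp
next
  case (insert k I)
  have X: "square_integrable M (X k)" "\<And>i. i \<in> I \<Longrightarrow> square_integrable M (X i)" using insert.prems by auto
  have XI: "square_integrable M (X j)" if "j \<in> insert k I" for j using insert.prems that by auto
  obtain c where c: "\<forall>j\<in>I. (\<integral>w. (Z w - (\<Sum>i\<in>I. c i * X i w)) * X j w \<partial>M) = 0"
    using insert.IH[of Z] insert.prems by auto
  obtain d where d: "\<forall>j\<in>I. (\<integral>w. (X k w - (\<Sum>i\<in>I. d i * X i w)) * X j w \<partial>M) = 0"
    using insert.IH[of "X k"] insert.prems by auto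
  define Z' where "Z' w = Z w - (\<Sum>i\<in>I. c i * X i w)" for w
  define R where "R w = X k w - (\<Sum>i\<in>I. d i * X i w)" for w
  have Z': "square_integrable M Z'" and R: "square_integrable M R"
    unfolding Z'_def R_def using X insert.prems
    by (auto intro!: square_integrable_diff square_integrable_sum square_integrable_cmult)
  have ZI: "(\<integral>w. Z' w * X j w \<partial>M) = 0" "(\<integral>w. R w * X j w \<partial>M) = 0" if "j \<in> I" for j
    using c d that by (auto simp: Z'_def R_def)
  have Xk: "X k w = R w + (\<Sum>i\<in>I. d i * X i w)" for w by (simp add: R_def)
  have Vk: "(\<integral>w. V w * X k w \<partial>M) = (\<integral>w. V w * R w \<partial>M)"
    if V: "square_integrable M V" and V0: "\<And>j. j \<in> I \<Longrightarrow> (\<integral>w. V w * X j w \<partial>M) = 0" for V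
  proof -
    have i: "integrable M (\<lambda>w. V w * X j w)" if "j \<in> insert k I" for j
      using V XI[OF that] by (rule square_integrable_mult)
    have "(\<integral>w. V w * X k w \<partial>M) = (\<integral>w. V w * R w + (\<Sum>i\<in>I. d i * (V w * X i w)) \<partial>M)"
      by (subst Xk) (simp add: distrib_left sum_distrib_left mult_ac)
    also have "\<dots> = (\<integral>w. V w * R w \<partial>M) + (\<Sum>i\<in>I. d i * (\<integral>w. V w * X i w \<partial>M))"
      using i square_integrable_mult[OF V R] by (simp add: integral_sum)
    finally show ?thesis using V0 by simp
  qed
  \<comment> \<open>If the residual \<open>R\<close> of \<open>X k\<close> has norm 0, then
    \<open>R\<close> vanishes almost everywhere and there is nothing to remove.\<close>
  define e where "e = (if (\<integral>w. (R w)\<^sup>2 \<partial>M) = 0 then 0 else (\<integral>w. Z' w * R w \<partial>M) / (\<integral>w. (R w)\<^sup>2 \<partial>M))"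
  define W where "W w = Z' w - e * R w" for w
  have W: "square_integrable M W" unfolding W_def using Z' R by (intro square_integrable_diff square_integrable_cmult)
  have WI: "(\<integral>w. W w * X j w \<partial>M) = 0" if "j \<in> I" for j
  proof -
    have "(\<integral>w. W w * X j w \<partial>M) = (\<integral>w. Z' w * X j w \<partial>M) - e * (\<integral>w. R w * X j w \<partial>M)"
      unfolding W_def using square_integrable_mult[OF Z' X(2)[OF that]] square_integrable_mult[OF R X(2)[OF that]]
      by (simp add: left_diff_distrib mult.assoc)
    then show ?thesis using ZI[OF that] by simp
  qed
  have "(\<integral>w. W w * R w \<partial>M) = (\<integral>w. Z' w * R w \<partial>M) - e * (\<integral>w. (R w)\<^sup>2 \<partial>M)"
    unfolding W_def using square_integrable_mult[OF Z' R] square_integrable_mult[OF R R]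
    by (simp add: left_diff_distrib mult.assoc power2_eq_square)
  also have "\<dots> = 0"
  proof (cases "(\<integral>w. (R w)\<^sup>2 \<partial>M) = 0")
    case True
    then have "AE w in M. (R w)\<^sup>2 = 0"
      using R by (subst (asm) integral_nonneg_eq_0_iff_AE) (auto simp: square_integrable_def)
    then have "AE w in M. Z' w * R w = 0" by auto
    then have "(\<integral>w. Z' w * R w \<partial>M) = 0" by (rule integral_eq_zero_AE)
    then show ?thesis using True by simp
  qed (simp add: e_def)
  finally have Wk: "(\<integral>w. W w * X k w \<partial>M) = 0" using Vk[OF W WI] by simp
  define f where "f i = (if i = k then e else c i - e * d i)" for i
  have "(\<Sum>i\<in>insert k I. f i * X i w) = e * X k w + (\<Sum>i\<in>I. (c i - e * d i) * X i w)" for w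
    using insert.hyps by (auto simp: f_def intro!: sum.cong)
  then have "W w = Z w - (\<Sum>i\<in>insert k I. f i * X i w)" for w
    by (simp add: W_def Z'_def R_def algebra_simps sum_subtractf sum_distrib_left)
  then have "(\<integral>w. (Z w - (\<Sum>i\<in>insert k I. f i * X i w)) * X j w \<partial>M) = 0" if "j \<in> insert k I" for j
    using Wk WI that by auto
  then show ?case by blast
qed

text \<open>The variance is left existential, so that closure properties need no bookkeeping;
  \<open>centered_normal_props\<close> recovers it as the second moment. With \<open>v = 0\<close>
  the zero variable is included.\<close>

definition centered_normal :: "'a measure \<Rightarrow> ('a \<Rightarrow> real) \<Rightarrow> bool" where
  "centered_normal M X \<longleftrightarrow> X \<in> borel_measurable M \<and> (\<exists>v. distr M borel X = normal1 0 v)"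

lemma centered_normal_props:
  assumes "centered_normal M X"
  shows "square_integrable M X" and "(\<integral>w. X w \<partial>M) = 0"
    and "(CLINT w|M. iexp (X w)) = complex_of_real (exp (- (\<integral>w. (X w)\<^sup>2 \<partial>M) / 2))"
    and "distr M borel X = normal1 0 (\<integral>w. (X w)\<^sup>2 \<partial>M)"
proof -
  from assms obtain v where X[measurable]: "X \<in> borel_measurable M" and v: "distr M borel X = normal1 0 v"
    by (auto simp: centered_normal_def)
  have "integrable (distr M borel X) (\<lambda>x. x\<^sup>2)" unfolding v by (rule integrable_normal1_moment)
  then show "square_integrable M X" by (simp add: square_integrable_def integrable_distr_eq)
  have "(\<integral>x. x \<partial>distr M borel X) = 0" unfolding v by (rule mean_normal1)
  then show "(\<integral>w. X w \<partial>M) = 0" by (simp add: integral_distr)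
  have "(\<integral>x. x\<^sup>2 \<partial>distr M borel X) = \<bar>v\<bar>" unfolding v by (rule second_moment_normal1)
  then have s: "(\<integral>w. (X w)\<^sup>2 \<partial>M) = \<bar>v\<bar>" by (simp add: integral_distr)
  then show "distr M borel X = normal1 0 (\<integral>w. (X w)\<^sup>2 \<partial>M)"
    unfolding v by (simp add: normal1_eq_distr_std_normal)
  have "(CLINT w|M. iexp (X w)) = char (distr M borel X) 1"
    unfolding char_def by (subst integral_distr) auto
  then show "(CLINT w|M. iexp (X w)) = complex_of_real (exp (- (\<integral>w. (X w)\<^sup>2 \<partial>M) / 2))"
    unfolding v by (simp add: char_normal1 s)
qed

lemma (in prob_space) centered_normal_sum_indep:
  assumes ind: "indep_vars (\<lambda>_. borel) X I" and n: "\<And>i. i \<in> I \<Longrightarrow> centered_normal M (X i)"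
  shows "centered_normal M (\<lambda>w. \<Sum>i\<in>I. X i w)"
proof -
  have [measurable]: "X i \<in> borel_measurable M" if "i \<in> I" for i using n[OF that] by (simp add: centered_normal_def)
  obtain v where v: "\<And>i. i \<in> I \<Longrightarrow> distr M borel (X i) = normal1 0 (v i)"
    using n unfolding centered_normal_def by metis
  have "char (distr M borel (\<lambda>w. \<Sum>i\<in>I. X i w)) s = char (normal1 0 (\<Sum>i\<in>I. \<bar>v i\<bar>)) s" for s
  proof -
    have "char (distr M borel (\<lambda>w. \<Sum>i\<in>I. X i w)) s = (\<Prod>i\<in>I. char (normal1 0 (v i)) s)"
      using char_distr_sum[OF ind] v by simp
    also have "\<dots> = complex_of_real (\<Prod>i\<in>I. exp (- \<bar>v i\<bar> * s\<^sup>2 / 2))"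
      by (simp add: char_normal1)
    also have "(\<Prod>i\<in>I. exp (- \<bar>v i\<bar> * s\<^sup>2 / 2)) = exp (- \<bar>\<Sum>i\<in>I. \<bar>v i\<bar>\<bar> * s\<^sup>2 / 2)"
      by (cases "finite I") (simp_all add: exp_sum[symmetric] sum_negf sum_divide_distrib sum_distrib_right sum_nonneg)
    finally show ?thesis by (simp add: char_normal1)
  qed
  then have "distr M borel (\<lambda>w. \<Sum>i\<in>I. X i w) = normal1 0 (\<Sum>i\<in>I. \<bar>v i\<bar>)"
    by (intro Levy_uniqueness real_distribution_normal1 real_distribution_distr) auto
  then show ?thesis unfolding centered_normal_def by auto
qed

text \<open>Compare \<open>(R, X)\<close> on \<open>M\<close> with \<open>R\<close> and
  \<open>X\<close> read from separate factors of \<open>M \<Otimes>\<^sub>M M\<close>. As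
  \<open>R\<close> is uncorrelated with every \<open>X i\<close>, variances of combinations agree,
  hence so do characteristic functions and, by Cramer-Wold, the laws. On the product the integral
  factors, and \<open>R\<close> has mean 0.\<close>

lemma uncorrelated_gaussian_integral_eq_0:
  fixes X :: "'i \<Rightarrow> 'a \<Rightarrow> real"
  assumes M: "prob_space M" and I: "finite I"
    and cn: "\<And>e c. centered_normal M (\<lambda>w. e * R w + (\<Sum>i\<in>I. c i * X i w))"
    and R [measurable]: "R \<in> borel_measurable M" and X [measurable]: "\<And>i. i \<in> I \<Longrightarrow> X i \<in> borel_measurable M"
    and unc: "\<And>i. i \<in> I \<Longrightarrow> (\<integral>w. R w * X i w \<partial>M) = 0"
    and A [measurable]: "A \<in> sets (PiM I (\<lambda>_. borel))"
  shows "(\<integral>w. R w * indicator A (\<lambda>i\<in>I. X i w) \<partial>M) = 0"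
proof -
  interpret M: prob_space M by fact
  interpret MM: pair_prob_space M M ..
  let ?J = "insert None (Some ` I)"
  define V where "V j w = (case j of None \<Rightarrow> R w | Some i \<Rightarrow> X i w)" for j w
  define V2 where "V2 j z = (case j of None \<Rightarrow> R (fst z) | Some i \<Rightarrow> X i (snd z))" for j z
  have sum: "(\<Sum>j\<in>?J. c j * V j w) = c None * R w + (\<Sum>i\<in>I. c (Some i) * X i w)"
    "(\<Sum>j\<in>?J. c j * V2 j z) = c None * R (fst z) + (\<Sum>i\<in>I. c (Some i) * X i (snd z))" for c w z
    using I by (simp_all add: V_def V2_def sum.reindex)
  have cnR: "centered_normal M (\<lambda>w. e * R w)" for e
    using cn[of e "\<lambda>_. 0"] by simp
  have cnS: "centered_normal M (\<lambda>w. \<Sum>i\<in>I. c i * X i w)" for c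
    using cn[of 0 c] by simp
  have R2: "square_integrable M R" using centered_normal_props(1)[OF cnR[of 1]] by simp
  have X2: "square_integrable M (X i)" if "i \<in> I" for i
  proof -
    have "(\<Sum>k\<in>I. (if k = i then 1 else 0) * X k w) = X i w" for w
      using that I by (simp add: if_distrib[of "\<lambda>y. y * _"] cong: if_cong)
    then show ?thesis using centered_normal_props(1)[OF cnS[of "\<lambda>k. if k = i then 1 else 0"]] by simp
  qed
  have eq: "(CLINT w|M. iexp (\<Sum>j\<in>?J. c j * V j w)) = (CLINT z|M \<Otimes>\<^sub>M M. iexp (\<Sum>j\<in>?J. c j * V2 j z))" for c
  proof -
    define S where "S w = (\<Sum>i\<in>I. c (Some i) * X i w)" for w
    define T where "T w = c None * R w" for w
    have [measurable]: "S \<in> borel_measurable M" "T \<in> borel_measurable M" unfolding S_def T_def by measurable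
    have S2: "square_integrable M S" "square_integrable M T"
      unfolding S_def T_def using R2 X2 by (auto intro!: square_integrable_cmult square_integrable_sum)
    have ints: "integrable M (\<lambda>w. (S w)\<^sup>2)" "integrable M (\<lambda>w. (T w)\<^sup>2)" "integrable M (\<lambda>w. T w * S w)"
      using S2 square_integrable_mult[OF S2(2,1)] by (auto simp: square_integrable_def)
    have "(\<integral>w. T w * S w \<partial>M) = (\<integral>w. (\<Sum>i\<in>I. (c None * c (Some i)) * (R w * X i w)) \<partial>M)"
      by (simp add: T_def S_def sum_distrib_left mult_ac)
    also have "\<dots> = 0"
      using unc square_integrable_mult[OF R2 X2] by (simp add: integral_sum)
    finally have "(\<integral>w. (T w + S w)\<^sup>2 \<partial>M) = (\<integral>w. (T w)\<^sup>2 \<partial>M) + (\<integral>w. (S w)\<^sup>2 \<partial>M)"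
      using ints by (simp add: power2_sum mult.assoc)
    then have "(CLINT w|M. iexp (T w + S w)) = (CLINT w|M. iexp (T w)) * (CLINT w|M. iexp (S w))"
      using centered_normal_props(3)[OF cn[of "c None" "\<lambda>i. c (Some i)"]]
        centered_normal_props(3)[OF cnR[of "c None"]] centered_normal_props(3)[OF cnS[of "\<lambda>i. c (Some i)"]]
      unfolding T_def[symmetric] S_def[symmetric]
      by (simp add: exp_add[symmetric] add_divide_distrib del: of_real_exp flip: of_real_mult)
    also have "\<dots> = (CLINT w|M. CLINT w'|M. iexp (T w) * iexp (S w'))"
      by simp
    also have "\<dots> = (CLINT z|M \<Otimes>\<^sub>M M. iexp (T (fst z)) * iexp (S (snd z)))"
    proof -
      have "integrable (M \<Otimes>\<^sub>M M) (\<lambda>z. iexp (T (fst z)) * iexp (S (snd z)))"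
        by (intro MM.P.integrable_const_bound[of _ 1]) (auto simp: norm_mult)
      from MM.integral_fst'[OF this] show ?thesis by simp
    qed
    finally show ?thesis unfolding sum T_def S_def by (simp add: exp_add[symmetric] distrib_left)
  qed
  have [measurable]: "V j \<in> borel_measurable M" "V2 j \<in> borel_measurable (M \<Otimes>\<^sub>M M)" if "j \<in> ?J" for j
    using that by (auto simp: V_def[abs_def] V2_def[abs_def])
  have D: "distr M (PiM ?J (\<lambda>_. borel)) (\<lambda>w. \<lambda>j\<in>?J. V j w) = distr (M \<Otimes>\<^sub>M M) (PiM ?J (\<lambda>_. borel)) (\<lambda>z. \<lambda>j\<in>?J. V2 j z)"
    by (rule cramer_wold[OF M MM.P.prob_space_axioms _ _ _ eq]) (use I in auto)
  define \<phi> where "\<phi> y = y None * indicator A (\<lambda>i\<in>I. y (Some i))" for y :: "'i option \<Rightarrow> real"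
  have [measurable]: "\<phi> \<in> borel_measurable (PiM ?J (\<lambda>_. borel))" unfolding \<phi>_def by measurable
  have "(\<integral>w. R w * indicator A (\<lambda>i\<in>I. X i w) \<partial>M) = (\<integral>w. \<phi> (\<lambda>j\<in>?J. V j w) \<partial>M)"
    by (simp add: \<phi>_def V_def cong: restrict_cong)
  also have "\<dots> = (\<integral>y. \<phi> y \<partial>distr M (PiM ?J (\<lambda>_. borel)) (\<lambda>w. \<lambda>j\<in>?J. V j w))"
    by (subst integral_distr) auto
  also have "\<dots> = (\<integral>z. \<phi> (\<lambda>j\<in>?J. V2 j z) \<partial>(M \<Otimes>\<^sub>M M))"
    unfolding D by (subst integral_distr) auto
  also have "\<dots> = (\<integral>z. R (fst z) * indicator A (\<lambda>i\<in>I. X i (snd z)) \<partial>(M \<Otimes>\<^sub>M M))"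
    by (simp add: \<phi>_def V2_def cong: restrict_cong)
  also have "\<dots> = (\<integral>w. \<integral>w'. R w * indicator A (\<lambda>i\<in>I. X i w') \<partial>M \<partial>M)"
  proof -
    have "integrable M R" using R2 by (rule M.square_integrable_imp_integrable)
    then have "integrable (M \<Otimes>\<^sub>M M) (\<lambda>z. R (fst z))"
      by (rule integrable_pair_fst[OF M M])
    then have "integrable (M \<Otimes>\<^sub>M M) (\<lambda>z. R (fst z) * indicator A (\<lambda>i\<in>I. X i (snd z)))"
      by (rule Bochner_Integration.integrable_bound) (auto simp: indicator_def)
    from MM.integral_fst'[OF this] show ?thesis by simp
  qed
  also have "\<dots> = 0"
    using centered_normal_props(2)[OF cnR[of 1]] by simp
  finally show ?thesis .
qed

section \<open>The conditional mean in the linear Gaussian model\<close>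

lemma borel_measurable_vec_lambda:
  fixes f :: "'n::finite \<Rightarrow> 'a \<Rightarrow> real"
  assumes "\<And>i. f i \<in> borel_measurable M"
  shows "(\<lambda>x. \<chi> i. f i x) \<in> borel_measurable M"
  using assms by (subst borel_measurable_euclidean_space) (auto simp: Basis_vec_def inner_axis)

lemma borel_measurable_vec_nth [measurable]: "(\<lambda>x. x $ i) \<in> borel_measurable (borel :: (real^'n) measure)"
  by (intro borel_measurable_continuous_onI continuous_intros)

lemma centered_normal_cong:
  assumes "\<And>w. w \<in> space M \<Longrightarrow> X w = Z w" "centered_normal M X"
  shows "centered_normal M Z"
proof -
  have "distr M borel X = distr M borel Z" "X \<in> borel_measurable M \<longleftrightarrow> Z \<in> borel_measurable M"
    using assms(1) by (auto intro!: distr_cong measurable_cong)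
  then show ?thesis using assms(2) by (simp add: centered_normal_def)
qed

lemma centered_normal_inner:
  assumes "is_normal_vec (distr M borel V) 0 S" and [measurable]: "V \<in> borel_measurable M"
  shows "centered_normal M (\<lambda>w. a \<bullet> V w)"
proof -
  have "distr (distr M borel V) borel (\<lambda>x. a \<bullet> x) = normal1 0 (a \<bullet> (S *v a))"
    using assms(1) by (simp add: is_normal_vec_def)
  then have "distr M borel (\<lambda>w. a \<bullet> V w) = normal1 0 (a \<bullet> (S *v a))"
    by (subst (asm) distr_distr) (auto simp: comp_def)
  then show ?thesis unfolding centered_normal_def by auto
qed

locale linear_gaussian_model = prob_space M for M :: "'w measure" +
  fixes theta omega :: "nat \<Rightarrow> 'w \<Rightarrow> real^'d"
    and nu Y :: "nat \<Rightarrow> 'w \<Rightarrow> real^'m"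
    and A :: "real^'d^'d" and C :: "real^'d^'m"
    and Sigma0 Sigmaw :: "real^'d^'d" and Sigmav :: "real^'m^'m"
  assumes meas_theta [measurable]: "\<And>t. theta t \<in> borel_measurable M"
    and meas_omega [measurable]: "\<And>t. omega t \<in> borel_measurable M"
    and meas_nu [measurable]: "\<And>t. nu t \<in> borel_measurable M"
    and meas_Y [measurable]: "\<And>t. Y t \<in> borel_measurable M"
    and law_theta0: "is_normal_vec (distr M borel (theta 0)) 0 Sigma0"
    and law_omega: "\<And>t. is_normal_vec (distr M borel (omega t)) 0 Sigmaw"
    and law_nu: "\<And>t. t \<ge> 1 \<Longrightarrow> is_normal_vec (distr M borel (nu t)) 0 Sigmav"
    and indep: "indep_sets
        (\<lambda>i::unit + nat + nat. case i of
            Inl u \<Rightarrow> {theta 0 -` X \<inter> space M | X. X \<in> sets borel}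
          | Inr (Inl t) \<Rightarrow> {omega t -` X \<inter> space M | X. X \<in> sets borel}
          | Inr (Inr t) \<Rightarrow> {nu t -` X \<inter> space M | X. X \<in> sets borel})
        ({Inl ()} \<union> Inr ` Inl ` UNIV \<union> Inr ` Inr ` {1..})"
    and dyn: "\<And>t w. w \<in> space M \<Longrightarrow> theta (Suc t) w = A *v theta t w + omega t w"
    and obs: "\<And>t w. t \<ge> 1 \<Longrightarrow> w \<in> space M \<Longrightarrow> Y t w = C *v theta t w + nu t w"
begin

text \<open>The recursion is unrolled backwards, which is why \<open>a\<close> is general in the
  induction: the observation at time \<open>Suc t\<close> adds \<open>b (Suc t) v* C\<close> to the
  coefficient of the state, and one step of the dynamics carries the sum \<open>a'\<close> to
  \<open>a' v* A\<close> at time \<open>t\<close>, leaving \<open>a'\<close> on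
  \<open>omega t\<close>.\<close>

lemma noise_representation:
  "\<exists>p q. \<forall>w\<in>space M. a \<bullet> theta t w + (\<Sum>s\<in>{1..t}. b s \<bullet> Y s w)
     = p \<bullet> theta 0 w + (\<Sum>s<t. q s \<bullet> omega s w) + (\<Sum>s\<in>{1..t}. b s \<bullet> nu s w)"
proof (induction t arbitrary: a)
  case 0
  show ?case by (rule exI[of _ a]) simp
next
  case (Suc t)
  define a' where "a' = a + (b (Suc t) v* C)"
  obtain p q where pq: "\<And>w. w \<in> space M \<Longrightarrow> (a' v* A) \<bullet> theta t w + (\<Sum>s\<in>{1..t}. b s \<bullet> Y s w)
     = p \<bullet> theta 0 w + (\<Sum>s<t. q s \<bullet> omega s w) + (\<Sum>s\<in>{1..t}. b s \<bullet> nu s w)"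
    using Suc.IH[of "a' v* A"] by blast
  have "a \<bullet> theta (Suc t) w + (\<Sum>s\<in>{1..Suc t}. b s \<bullet> Y s w)
     = p \<bullet> theta 0 w + (\<Sum>s<Suc t. (q(t := a')) s \<bullet> omega s w) + (\<Sum>s\<in>{1..Suc t}. b s \<bullet> nu s w)"
    if w: "w \<in> space M" for w
  proof -
    have "a \<bullet> theta (Suc t) w + b (Suc t) \<bullet> Y (Suc t) w = a' \<bullet> theta (Suc t) w + b (Suc t) \<bullet> nu (Suc t) w"
      using obs[OF _ w, of "Suc t"] by (simp add: a'_def inner_add_left inner_add_right dot_lmul_matrix)
    also have "a' \<bullet> theta (Suc t) w = (a' v* A) \<bullet> theta t w + a' \<bullet> omega t w"
      using dyn[OF w] by (simp add: inner_add_right dot_lmul_matrix)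
    finally show ?thesis using pq[OF w] by simp
  qed
  then show ?case by blast
qed

lemma noise_combination_normal:
  "centered_normal M (\<lambda>w. p \<bullet> theta 0 w + (\<Sum>s<t. q s \<bullet> omega s w) + (\<Sum>s\<in>{1..t}. b s \<bullet> nu s w))"
proof -
  define W :: "unit + nat + nat \<Rightarrow> 'w \<Rightarrow> real" where
    "W i = (case i of Inl u \<Rightarrow> (\<lambda>w. p \<bullet> theta 0 w) | Inr (Inl s) \<Rightarrow> (\<lambda>w. q s \<bullet> omega s w)
      | Inr (Inr s) \<Rightarrow> (\<lambda>w. b s \<bullet> nu s w))" for i
  let ?J = "insert (Inl ()) (Inr ` Inl ` {..<t} \<union> Inr ` Inr ` {1..t})"
  have cn: "centered_normal M (W i)" if "i \<in> ?J" for i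
    using that law_theta0 law_omega law_nu by (auto simp: W_def intro!: centered_normal_inner)
  \<comment> \<open>A scalar product generates no more events than the vector itself, so
    independence passes from the noise vectors to the summands. The sum type of \<open>W\<close>
    copies the index type of \<open>indep\<close>.\<close>
  have vim: "{(\<lambda>w. a \<bullet> V w) -` X \<inter> space M | X. X \<in> sets borel} \<subseteq> {V -` X \<inter> space M | X. X \<in> sets borel}"
    for a and V :: "'w \<Rightarrow> real^'k"
  proof safe
    fix X :: "real set" assume "X \<in> sets borel"
    then have "(\<lambda>x. a \<bullet> x) -` X \<in> sets borel" using measurable_sets_borel[of "\<lambda>x. a \<bullet> x" borel X] by simp
    then show "\<exists>Z. (\<lambda>w. a \<bullet> V w) -` X \<inter> space M = V -` Z \<inter> space M \<and> Z \<in> sets borel"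
      by (intro exI[of _ "(\<lambda>x. a \<bullet> x) -` X"]) auto
  qed
  have "indep_vars (\<lambda>_. borel) W ?J"
    unfolding indep_vars_def2
  proof (intro conjI ballI)
    show "random_variable borel (W i)" if "i \<in> ?J" for i using cn[OF that] by (simp add: centered_normal_def)
    show "indep_sets (\<lambda>i. {W i -` X \<inter> space M | X. X \<in> sets borel}) ?J"
    proof (rule indep_sets_mono[OF indep])
      show "{W i -` X \<inter> space M | X. X \<in> sets borel} \<subseteq> (case i of
            Inl u \<Rightarrow> {theta 0 -` X \<inter> space M | X. X \<in> sets borel}
          | Inr (Inl t) \<Rightarrow> {omega t -` X \<inter> space M | X. X \<in> sets borel}
          | Inr (Inr t) \<Rightarrow> {nu t -` X \<inter> space M | X. X \<in> sets borel})" if "i \<in> ?J" for i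
        using vim[of p "theta 0"] vim[of "q s" "omega s" for s] vim[of "b s" "nu s" for s]
        by (cases i rule: sum.exhaust) (auto simp: W_def split: sum.splits)
    qed auto
  qed
  from centered_normal_sum_indep[OF this cn]
  have "centered_normal M (\<lambda>w. \<Sum>i\<in>?J. W i w)" .
  moreover have "(\<Sum>i\<in>?J. W i w) = p \<bullet> theta 0 w + (\<Sum>s<t. q s \<bullet> omega s w) + (\<Sum>s\<in>{1..t}. b s \<bullet> nu s w)" for w
  proof -
    have "(\<Sum>i\<in>?J. W i w) = W (Inl ()) w + (\<Sum>i\<in>Inr ` Inl ` {..<t} \<union> Inr ` Inr ` {1..t}. W i w)"
      by (rule sum.insert) auto
    also have "(\<Sum>i\<in>Inr ` Inl ` {..<t} \<union> Inr ` Inr ` {1..t}. W i w)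
      = (\<Sum>i\<in>Inr ` Inl ` {..<t}. W i w) + (\<Sum>i\<in>Inr ` Inr ` {1..t}. W i w)"
      by (rule sum.union_disjoint) auto
    finally show ?thesis by (simp add: sum.reindex W_def)
  qed
  ultimately show ?thesis by simp
qed

text \<open>Joint Gaussianity of the state and the observations in Cramer-Wold form. The
  distributional assumptions of the model enter what follows only through this fact.\<close>

lemma state_observations_normal:
  "centered_normal M (\<lambda>w. a \<bullet> theta t w + (\<Sum>s\<in>{1..t}. b s \<bullet> Y s w))"
proof -
  obtain p q where "\<forall>w\<in>space M. a \<bullet> theta t w + (\<Sum>s\<in>{1..t}. b s \<bullet> Y s w)
     = p \<bullet> theta 0 w + (\<Sum>s<t. q s \<bullet> omega s w) + (\<Sum>s\<in>{1..t}. b s \<bullet> nu s w)"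
    using noise_representation by blast
  then show ?thesis
    using noise_combination_normal[of p q t b] by (auto elim!: centered_normal_cong[rotated])
qed

section \<open>Conditional expectation given the observations\<close>

lemma measurable_Hvec [measurable]: "Hvec Y t \<in> measurable M (Hspace t)"
  unfolding Hvec_def Hspace_def by measurable

lemma Hsigma_sets: "sets (Hsigma M Y t) = {Hvec Y t -` S \<inter> space M | S. S \<in> sets (Hspace t)}"
  unfolding Hsigma_def using measurable_space[OF measurable_Hvec, of _ t] by (subst sets_vimage_algebra2) auto

lemma measurable_Hsigma:
  assumes "g \<in> borel_measurable (Hspace t)"
  shows "(\<lambda>w. g (Hvec Y t w)) \<in> borel_measurable (Hsigma M Y t)"
proof -
  have "Hvec Y t \<in> measurable (Hsigma M Y t) (Hspace t)"
    unfolding Hsigma_def using measurable_space[OF measurable_Hvec, of _ t]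
    by (intro measurable_vimage_algebra1) auto
  then show ?thesis using assms by (rule measurable_compose)
qed

lemma finite_measure_subalgebra_Hsigma: "finite_measure_subalgebra M (Hsigma M Y t)"
proof
  show "subalgebra M (Hsigma M Y t)"
    unfolding subalgebra_def Hsigma_sets using measurable_sets[OF measurable_Hvec, of _ t]
    by (auto simp: Hsigma_def)
qed

lemma state_square_integrable: "square_integrable M (\<lambda>w. theta t w $ k)"
  using centered_normal_props(1)[OF state_observations_normal[of "axis k 1" t "\<lambda>_. 0"]]
  by (simp add: inner_axis')

text \<open>The residual of the projection on the scalar observations is uncorrelated with them, so
  by Gaussianity it integrates to 0 over every event of the history. This is the characterisation of
  the conditional expectation.\<close>

lemma linear_cond_exp:
  "\<exists>c. AE w in M. real_cond_exp M (Hsigma M Y t) (\<lambda>w. theta t w $ k) w = (\<Sum>s\<in>{1..t}. c s \<bullet> Y s w)"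
proof -
  interpret F: finite_measure_subalgebra M "Hsigma M Y t" by (rule finite_measure_subalgebra_Hsigma)
  define I where "I = {1..t} \<times> (UNIV :: 'm set)"
  define X where "X i w = Y (fst i) w $ snd i" for i w
  have I: "finite I" by (simp add: I_def)
  have comb: "(\<Sum>i\<in>I. c i * X i w) = (\<Sum>s\<in>{1..t}. (\<chi> j. c (s, j)) \<bullet> Y s w)" for c w
    by (simp add: I_def X_def sum.cartesian_product' inner_vec_def)
  have [measurable]: "X i \<in> borel_measurable M" for i unfolding X_def by measurable
  have X2: "square_integrable M (X i)" if "i \<in> I" for i
  proof -
    have "(\<Sum>s\<in>{1..t}. (if s = fst i then axis (snd i) 1 else 0) \<bullet> Y s w) = X i w" for w
      using that by (simp add: I_def X_def if_distrib[of "\<lambda>y. y \<bullet> _"] inner_axis' mem_Times_iff cong: if_cong)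
    then show ?thesis
      using centered_normal_props(1)[OF state_observations_normal[of 0 t "\<lambda>s. if s = fst i then axis (snd i) 1 else 0"]]
      by simp
  qed
  obtain c where c: "\<And>j. j \<in> I \<Longrightarrow> (\<integral>w. (theta t w $ k - (\<Sum>i\<in>I. c i * X i w)) * X j w \<partial>M) = 0"
    using L2_projection_exists[of I M X, OF I X2 state_square_integrable[of t k]] by blast
  define R where "R w = theta t w $ k - (\<Sum>i\<in>I. c i * X i w)" for w
  have [measurable]: "R \<in> borel_measurable M" unfolding R_def by measurable
  have R2: "square_integrable M R" unfolding R_def
    using X2 state_square_integrable by (intro square_integrable_diff square_integrable_sum square_integrable_cmult)
  \<comment> \<open>The residual is a state coordinate minus a combination of observations, so every
    such sum is again covered by \<open>state_observations_normal\<close>.\<close>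
  have cn: "centered_normal M (\<lambda>w. e * R w + (\<Sum>i\<in>I. d i * X i w))" for e d
  proof -
    have "e * R w + (\<Sum>i\<in>I. d i * X i w) = (e *\<^sub>R axis k 1) \<bullet> theta t w + (\<Sum>s\<in>{1..t}. (\<chi> j. d (s, j) - e * c (s, j)) \<bullet> Y s w)" for w
      unfolding comb[of "\<lambda>i. d i - e * c i", symmetric]
      by (simp add: R_def inner_axis' left_diff_distrib right_diff_distrib sum_subtractf sum_distrib_left mult.assoc)
    then show ?thesis by (simp only: state_observations_normal)
  qed
  have orth: "(\<integral>w. R w * indicator S (\<lambda>i\<in>I. X i w) \<partial>M) = 0" if "S \<in> sets (PiM I (\<lambda>_. borel))" for S
    by (rule uncorrelated_gaussian_integral_eq_0[OF prob_space_axioms I cn _ _ _ that])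
      (use c in \<open>auto simp: R_def\<close>)
  \<comment> \<open>The regrouping of scalar observations, indexed by time and coordinate, into the
    history; it pulls events of \<open>Hspace t\<close> back to events about the scalars.\<close>
  define \<phi> where "\<phi> z = (\<lambda>s\<in>{1..t}. \<chi> j. z (s, j))" for z :: "nat \<times> 'm \<Rightarrow> real"
  have \<phi>[measurable]: "\<phi> \<in> measurable (PiM I (\<lambda>_. borel)) (Hspace t)"
    unfolding \<phi>_def Hspace_def by (intro measurable_restrict borel_measurable_vec_lambda) (auto simp: I_def)
  have \<phi>X: "\<phi> (\<lambda>i\<in>I. X i w) = Hvec Y t w" for w
    by (auto simp: \<phi>_def Hvec_def I_def X_def fun_eq_iff vec_eq_iff)
  have "AE w in M. real_cond_exp M (Hsigma M Y t) (\<lambda>w. theta t w $ k) w = (\<Sum>i\<in>I. c i * X i w)"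
  proof (rule F.real_cond_exp_charact)
    fix B assume "B \<in> sets (Hsigma M Y t)"
    then obtain S where S[measurable]: "S \<in> sets (Hspace t)" and B: "B = Hvec Y t -` S \<inter> space M"
      by (auto simp: Hsigma_sets)
    have [measurable]: "B \<in> sets M" unfolding B by measurable
    have indB: "indicator B w = (indicator (\<phi> -` S \<inter> space (PiM I (\<lambda>_. borel))) (\<lambda>i\<in>I. X i w) :: real)" if "w \<in> space M" for w
      using that by (auto simp: B indicator_def \<phi>X space_PiM)
    have "(\<integral>w. R w * indicator B w \<partial>M) = (\<integral>w. R w * indicator (\<phi> -` S \<inter> space (PiM I (\<lambda>_. borel))) (\<lambda>i\<in>I. X i w) \<partial>M)"
      by (intro Bochner_Integration.integral_cong) (auto simp: indB)
    also have "\<dots> = 0" by (rule orth) measurable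
    finally have 0: "(\<integral>w. R w * indicator B w \<partial>M) = 0" .
    have i1: "integrable M (\<lambda>w. R w * indicator B w)"
      using square_integrable_imp_integrable[OF R2] by (rule integrable_real_mult_indicator[rotated]) simp
    have "square_integrable M (\<lambda>w. \<Sum>i\<in>I. c i * X i w)"
      using X2 by (intro square_integrable_sum square_integrable_cmult)
    then have i2: "integrable M (\<lambda>w. (\<Sum>i\<in>I. c i * X i w) * indicator B w)"
      by (intro integrable_real_mult_indicator square_integrable_imp_integrable) auto
    have "(\<integral>w. theta t w $ k * indicator B w \<partial>M) = (\<integral>w. R w * indicator B w + (\<Sum>i\<in>I. c i * X i w) * indicator B w \<partial>M)"
      by (simp add: R_def algebra_simps)
    also have "\<dots> = (\<integral>w. (\<Sum>i\<in>I. c i * X i w) * indicator B w \<partial>M)"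
      using i1 i2 0 by simp
    finally show "(\<integral>w\<in>B. theta t w $ k \<partial>M) = (\<integral>w\<in>B. (\<Sum>i\<in>I. c i * X i w) \<partial>M)"
      by (simp add: set_lebesgue_integral_def mult.commute)
  next
    show "integrable M (\<lambda>w. theta t w $ k)"
      by (rule square_integrable_imp_integrable[OF state_square_integrable])
    show "integrable M (\<lambda>w. \<Sum>i\<in>I. c i * X i w)"
      using X2 by (intro square_integrable_imp_integrable square_integrable_sum square_integrable_cmult)
    have "(\<lambda>w. (\<lambda>h. \<Sum>i\<in>I. c i * h (fst i) $ snd i) (Hvec Y t w)) \<in> borel_measurable (Hsigma M Y t)"
    proof (rule measurable_Hsigma)
      have "(\<lambda>h. h (fst i) $ snd i) \<in> borel_measurable (Hspace t)" if "i \<in> I" for i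
        using that by (intro measurable_compose[OF _ borel_measurable_vec_nth])
          (auto simp: Hspace_def I_def intro!: measurable_component_singleton)
      then show "(\<lambda>h. \<Sum>i\<in>I. c i * h (fst i) $ snd i) \<in> borel_measurable (Hspace t)"
        by (intro borel_measurable_sum borel_measurable_times) auto
    qed
    moreover have "(\<Sum>i\<in>I. c i * Hvec Y t w (fst i) $ snd i) = (\<Sum>i\<in>I. c i * X i w)" for w
      by (intro sum.cong) (auto simp: Hvec_def X_def I_def)
    ultimately show "(\<lambda>w. \<Sum>i\<in>I. c i * X i w) \<in> borel_measurable (Hsigma M Y t)" by simp
  qed
  then show ?thesis unfolding comb by (intro exI[of _ "\<lambda>s. \<chi> j. c (s, j)"])
qed

text \<open>\<open>cond_mean\<close> is a version chosen coordinatewise and agrees with a linear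
  function only almost everywhere. \<open>G\<close> is an everywhere defined function on the history
  space, which pushing laws forward along \<open>Hvec\<close> requires.\<close>

lemma cond_mean_linear:
  obtains G where "G \<in> borel_measurable (Hspace t)" "AE w in M. cond_mean M theta Y t w = G (Hvec Y t w)"
    "\<And>a. centered_normal M (\<lambda>w. a \<bullet> G (Hvec Y t w))"
proof -
  obtain c where c: "\<And>k. AE w in M. real_cond_exp M (Hsigma M Y t) (\<lambda>w. theta t w $ k) w = (\<Sum>s\<in>{1..t}. c k s \<bullet> Y s w)"
    using linear_cond_exp[of t] by metis
  define G where "G h = (\<chi> k. \<Sum>s\<in>{1..t}. c k s \<bullet> h s)" for h
  have GH: "G (Hvec Y t w) $ k = (\<Sum>s\<in>{1..t}. c k s \<bullet> Y s w)" for w k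
    by (simp add: G_def Hvec_def)
  show ?thesis
  proof (rule that[of G])
    show "G \<in> borel_measurable (Hspace t)"
      unfolding G_def Hspace_def
      by (intro borel_measurable_vec_lambda borel_measurable_sum borel_measurable_inner) auto
    have "AE w in M. \<forall>k. real_cond_exp M (Hsigma M Y t) (\<lambda>w. theta t w $ k) w = (\<Sum>s\<in>{1..t}. c k s \<bullet> Y s w)"
      using c by (subst AE_all_countable) auto
    then show "AE w in M. cond_mean M theta Y t w = G (Hvec Y t w)"
      by eventually_elim (simp add: vec_eq_iff cond_mean_def GH)
    show "centered_normal M (\<lambda>w. a \<bullet> G (Hvec Y t w))" for a
    proof -
      have "a \<bullet> G (Hvec Y t w) = (\<Sum>k\<in>UNIV. \<Sum>s\<in>{1..t}. a $ k * (c k s \<bullet> Y s w))" for w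
        by (simp add: inner_vec_def[of a] GH sum_distrib_left)
      also have "\<dots> w = (\<Sum>s\<in>{1..t}. \<Sum>k\<in>UNIV. a $ k * (c k s \<bullet> Y s w))" for w
        by (rule sum.swap)
      also have "\<dots> w = 0 \<bullet> theta t w + (\<Sum>s\<in>{1..t}. (\<Sum>k\<in>UNIV. a $ k *\<^sub>R c k s) \<bullet> Y s w)" for w
        by (simp add: inner_sum_left)
      finally have "a \<bullet> G (Hvec Y t w) = 0 \<bullet> theta t w + (\<Sum>s\<in>{1..t}. (\<Sum>k\<in>UNIV. a $ k *\<^sub>R c k s) \<bullet> Y s w)" for w .
      then show ?thesis using state_observations_normal[of 0 t] by simp
    qed
  qed
qed

text \<open>\<open>g\<close> may be unbounded as long as the product is integrable: it will be a
  coordinate of \<open>G\<close> or the mean of a policy's randomised prediction given the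
  history.\<close>

lemma cond_mean_orthogonal:
  assumes GH: "AE w in M. cond_mean M theta Y t w = G (Hvec Y t w)"
    and g: "g \<in> borel_measurable (Hspace t)"
    and i: "integrable M (\<lambda>w. (theta t w $ k - G (Hvec Y t w) $ k) * g (Hvec Y t w))"
    and G [measurable]: "G \<in> borel_measurable (Hspace t)"
  shows "(\<integral>w. (theta t w $ k - G (Hvec Y t w) $ k) * g (Hvec Y t w) \<partial>M) = 0"
proof -
  interpret F: finite_measure_subalgebra M "Hsigma M Y t" by (rule finite_measure_subalgebra_Hsigma)
  let ?F = "Hsigma M Y t"
  let ?f = "\<lambda>w. theta t w $ k - G (Hvec Y t w) $ k"
  have Gk: "(\<lambda>h. G h $ k) \<in> borel_measurable (Hspace t)" by (rule measurable_compose[OF G borel_measurable_vec_nth])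
  have [measurable]: "(\<lambda>w. g (Hvec Y t w)) \<in> borel_measurable M" "(\<lambda>w. G (Hvec Y t w)) \<in> borel_measurable M"
    using g by (auto intro: measurable_compose[OF measurable_Hvec])
  have ce: "AE w in M. real_cond_exp M ?F (\<lambda>w. theta t w $ k) w = G (Hvec Y t w) $ k"
    using GH by eventually_elim (simp add: cond_mean_def vec_eq_iff)
  have th: "integrable M (\<lambda>w. theta t w $ k)"
    by (rule square_integrable_imp_integrable[OF state_square_integrable])
  have "integrable M (real_cond_exp M ?F (\<lambda>w. theta t w $ k))" by (rule F.real_cond_exp_int(1)[OF th])
  then have Gi: "integrable M (\<lambda>w. G (Hvec Y t w) $ k)"
    using ce by (subst (asm) integrable_cong_AE) auto
  have "AE w in M. real_cond_exp M ?F ?f w = real_cond_exp M ?F (\<lambda>w. theta t w $ k) w - real_cond_exp M ?F (\<lambda>w. G (Hvec Y t w) $ k) w"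
    by (rule F.real_cond_exp_diff[OF th Gi])
  moreover have "AE w in M. real_cond_exp M ?F (\<lambda>w. G (Hvec Y t w) $ k) w = G (Hvec Y t w) $ k"
    by (rule F.real_cond_exp_F_meas[OF Gi measurable_Hsigma[OF Gk]])
  ultimately have 0: "AE w in M. g (Hvec Y t w) * real_cond_exp M ?F ?f w = 0"
    using ce by eventually_elim simp
  have "(\<integral>w. g (Hvec Y t w) * ?f w \<partial>M) = (\<integral>w. g (Hvec Y t w) * real_cond_exp M ?F ?f w \<partial>M)"
    by (rule F.real_cond_exp_intg(2)[symmetric]) (use i g measurable_Hsigma in \<open>auto simp: mult.commute\<close>)
  also have "\<dots> = 0" using 0 by (rule integral_eq_zero_AE)
  finally show ?thesis by (simp add: mult.commute)
qed

end

section \<open>Reverse water-filling\<close>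

text \<open>Intermediate value theorem: at \<open>a\<close> the term of index \<open>j\<close> alone
  reaches \<open>2 * B\<close>, while at \<open>b\<close> no \<open>2 * lam i\<close> exceeds the
  level and the sum is 0. For a vanishing eigenvalue the term is 0 because
  \<open>ln 0 = 0\<close>.\<close>

lemma water_level_exists:
  fixes lam :: "'d::finite \<Rightarrow> real"
  assumes lam: "\<And>i. 0 \<le> lam i" and B: "B > 0" and j: "lam j > 0"
  shows "\<exists>eta>0. (\<Sum>i\<in>UNIV. max (ln (2 * lam i / eta)) 0) = 2 * B"
proof -
  define f where "f eta = (\<Sum>i\<in>UNIV. max (ln (2 * lam i / eta)) 0)" for eta
  define a where "a = 2 * lam j * exp (- 2 * B)"
  define b where "b = 2 * (\<Sum>i\<in>UNIV. lam i)"
  have a: "a > 0" using j by (simp add: a_def)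
  have le: "lam i \<le> (\<Sum>i\<in>UNIV. lam i)" for i using lam by (intro member_le_sum) auto
  have "a \<le> 2 * lam j" using j B by (simp add: a_def)
  also have "\<dots> \<le> b" using le[of j] by (simp add: b_def)
  finally have ab: "a \<le> b" .
  have "max (ln (2 * lam i / b)) 0 = 0" for i
    using lam[of i] le[of i] a ab by (cases "lam i = 0") (auto simp: b_def)
  then have fb: "f b = 0" by (simp add: f_def)
  have "2 * B = ln (2 * lam j / a)"
    using j by (simp add: a_def ln_div)
  also have "\<dots> \<le> max (ln (2 * lam j / a)) 0" by simp
  also have "\<dots> \<le> f a" unfolding f_def by (rule member_le_sum) auto
  finally have fa: "2 * B \<le> f a" .
  have "continuous_on {a..b} (\<lambda>eta. max (ln (2 * lam i / eta)) 0)" for i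
  proof (cases "lam i = 0")
    case False
    then show ?thesis using a lam[of i] by (intro continuous_intros) auto
  qed simp
  then have "continuous_on {a..b} f" unfolding f_def by (intro continuous_on_sum)
  then have "\<exists>x\<ge>a. x \<le> b \<and> f x = 2 * B"
    using fa fb B ab by (intro IVT2') auto
  then show ?thesis using a by (auto simp: f_def intro: less_le_trans)
qed

text \<open>The sum is constantly 0 once the level exceeds every \<open>2 * lam i\<close>, so strict
  decrease is available only where its value is still positive; \<open>B > 0\<close> places the
  water level there.\<close>

lemma water_level_unique:
  fixes lam :: "'d::finite \<Rightarrow> real"
  assumes lam: "\<And>i. 0 \<le> lam i" and pos: "x > 0" and xy: "x < y"
    and B: "(\<Sum>i\<in>UNIV. max (ln (2 * lam i / y)) 0) > 0"
  shows "(\<Sum>i\<in>UNIV. max (ln (2 * lam i / y)) 0) < (\<Sum>i\<in>UNIV. max (ln (2 * lam i / x)) 0)"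
proof (rule sum_strict_mono_ex1)
  have less: "ln (2 * lam i / y) < ln (2 * lam i / x)" if "lam i > 0" for i
    using that pos xy by (subst ln_less_cancel_iff) (auto intro!: divide_strict_left_mono)
  show "\<forall>i\<in>UNIV. max (ln (2 * lam i / y)) 0 \<le> max (ln (2 * lam i / x)) 0"
    using less lam by (metis (no_types, lifting) div_0 less_eq_real_def max.mono mult_zero_right order_refl)
  have "\<exists>i\<in>UNIV. max (ln (2 * lam i / y)) 0 > 0"
  proof (rule ccontr)
    assume "\<not> ?thesis"
    then have "(\<Sum>i\<in>UNIV. max (ln (2 * lam i / y)) 0) \<le> 0"
      by (intro sum_nonpos) (auto simp: not_less)
    with B show False by simp
  qed
  then obtain i where i: "max (ln (2 * lam i / y)) 0 > 0" by auto
  then have "lam i \<noteq> 0" by auto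
  with lam[of i] have "lam i > 0" by simp
  from less[OF this] i show "\<exists>i\<in>UNIV. max (ln (2 * lam i / y)) 0 < max (ln (2 * lam i / x)) 0" by (intro bexI[of _ i]) auto
qed simp

lemma water_level_props:
  fixes lam :: "'d::finite \<Rightarrow> real"
  assumes lam: "\<And>i. 0 \<le> lam i" and B: "B > 0" and j: "lam j > 0"
  shows "water_level lam B > 0" and "(\<Sum>i\<in>UNIV. max (ln (2 * lam i / water_level lam B)) 0) = 2 * B"
proof -
  have "\<exists>!eta. eta > 0 \<and> (\<Sum>i\<in>UNIV. max (ln (2 * lam i / eta)) 0) = 2 * B"
  proof (rule ex_ex1I)
    show "\<exists>eta>0. (\<Sum>i\<in>UNIV. max (ln (2 * lam i / eta)) 0) = 2 * B"
      by (rule water_level_exists[of lam, OF lam B j])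
    fix x y assume "0 < x \<and> (\<Sum>i\<in>UNIV. max (ln (2 * lam i / x)) 0) = 2 * B"
      and "0 < y \<and> (\<Sum>i\<in>UNIV. max (ln (2 * lam i / y)) 0) = 2 * B"
    then show "x = y"
      using water_level_unique[of lam x y] water_level_unique[of lam y x] lam B
      by (cases x y rule: linorder_cases) auto
  qed
  from theI'[OF this] show "water_level lam B > 0" "(\<Sum>i\<in>UNIV. max (ln (2 * lam i / water_level lam B)) 0) = 2 * B"
    by (simp_all add: water_level_def)
qed

lemma bits_nonneg: "0 \<le> bits lam B i"
  by (simp add: bits_def)

lemma bits_eq_0: "lam i = 0 \<Longrightarrow> bits lam B i = 0"
  by (simp add: bits_def)

lemma sum_bits:
  fixes lam :: "'d::finite \<Rightarrow> real"
  assumes lam: "\<And>i. 0 \<le> lam i" and B: "B > 0" and j: "lam j > 0"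
  shows "(\<Sum>i\<in>UNIV. bits lam B i) = B"
  using water_level_props(2)[of lam, OF assms] by (simp add: bits_def sum_divide_distrib[symmetric])

text \<open>If all eigenvalues vanish, no water level exists and \<open>water_level\<close> is
  unspecified, but every \<open>bits lam B i\<close> is 0 all the same, since
  \<open>ln 0 = 0\<close>.\<close>

lemma sum_bits_le:
  fixes lam :: "'d::finite \<Rightarrow> real"
  assumes lam: "\<And>i. 0 \<le> lam i" and B: "B > 0"
  shows "(\<Sum>i\<in>UNIV. bits lam B i) \<le> B"
proof (cases "\<exists>j. lam j > 0")
  case True
  then show ?thesis using sum_bits[of lam, OF lam B] by auto
next
  case False
  then have "lam i = 0" for i using lam[of i] by (metis less_eq_real_def)
  then show ?thesis using B by (simp add: bits_eq_0)
qed

text \<open>The fraction of the variance left as distortion: \<open>shrink lam B i * lam i\<close>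
  is half the water level if that is below \<open>lam i\<close>, and \<open>lam i\<close> otherwise,
  provided some eigenvalue is positive.\<close>

definition shrink :: "('d::finite \<Rightarrow> real) \<Rightarrow> real \<Rightarrow> 'd \<Rightarrow> real" where
  "shrink lam B i = exp (- 2 * bits lam B i)"

lemma shrink_bounds: "0 < shrink lam B i" "shrink lam B i \<le> 1"
  using bits_nonneg[of lam B i] by (simp_all add: shrink_def)

lemma shrink_eq_1: "lam i = 0 \<Longrightarrow> shrink lam B i = 1"
  by (simp add: shrink_def bits_eq_0)

text \<open>The exponent of the tilting function of the converse: \<^term>\<open>1 / (2 * lam i)\<close> above the
  water level turns the Gaussian source density into the backward test channel, while
  below it \<^term>\<open>1 / eta\<close> makes \<^term>\<open>0\<close> the best reproduction.\<close>

lemma tilt_integral_le_1: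
  fixes lam :: "'d::finite \<Rightarrow> real" and B :: real
  defines "eta \<equiv> water_level lam B"
  assumes lam: "\<And>i. 0 \<le> lam i" and B: "B > 0" and j: "lam j > 0"
  obtains a where "eta * a * lam i = shrink lam B i * lam i"
    "\<And>x. (\<integral>\<^sup>+y. ennreal (exp (bits lam B i + a * y\<^sup>2 - (y - x)\<^sup>2 / eta)) \<partial>normal1 0 (lam i)) \<le> 1"
proof -
  define h where "h = eta"
  have h: "h > 0" using water_level_props(1)[of lam, OF lam B j] by (simp add: h_def eta_def)
  have red: "(\<integral>\<^sup>+y. ennreal (exp (bits lam B i + a * y\<^sup>2 - (y - x)\<^sup>2 / h)) \<partial>normal1 0 (lam i))
      = ennreal (exp (bits lam B i - x\<^sup>2 / h) * (exp ((2 * x / h)\<^sup>2 * lam i / (2 * (1 + 2 * (1 / h - a) * lam i))) / sqrt (1 + 2 * (1 / h - a) * lam i)))"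
    if k: "1 + 2 * (1 / h - a) * lam i > 0" for a x
  proof -
    have *: "(bits lam B i + a * y\<^sup>2 - (y - x)\<^sup>2 / h) = (bits lam B i - x\<^sup>2 / h) + (- (1 / h - a) * y\<^sup>2 + 2 * x / h * y)" for y
      using h by (simp add: field_simps power2_eq_square)
    have "exp (bits lam B i + a * y\<^sup>2 - (y - x)\<^sup>2 / h)
      = exp (bits lam B i - x\<^sup>2 / h) * exp (- (1 / h - a) * y\<^sup>2 + 2 * x / h * y)" for y
      unfolding * by (rule exp_add)
    then have "(\<integral>\<^sup>+y. ennreal (exp (bits lam B i + a * y\<^sup>2 - (y - x)\<^sup>2 / h)) \<partial>normal1 0 (lam i))
      = (\<integral>\<^sup>+y. ennreal (exp (bits lam B i - x\<^sup>2 / h)) * ennreal (exp (- (1 / h - a) * y\<^sup>2 + 2 * x / h * y)) \<partial>normal1 0 (lam i))"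
      by (simp only: ennreal_mult[OF exp_ge_zero exp_ge_zero])
    also have "\<dots> = ennreal (exp (bits lam B i - x\<^sup>2 / h)) * (\<integral>\<^sup>+y. ennreal (exp (- (1 / h - a) * y\<^sup>2 + 2 * x / h * y)) \<partial>normal1 0 (lam i))"
      by (rule nn_integral_cmult) measurable
    also have "(\<integral>\<^sup>+y. ennreal (exp (- (1 / h - a) * y\<^sup>2 + 2 * x / h * y)) \<partial>normal1 0 (lam i))
      = ennreal (exp ((2 * x / h)\<^sup>2 * lam i / (2 * (1 + 2 * (1 / h - a) * lam i))) / sqrt (1 + 2 * (1 / h - a) * lam i))"
      by (rule nn_integral_exp_quadratic_normal1[OF lam k])
    finally show ?thesis using k by (simp add: ennreal_mult[symmetric])
  qed
  show ?thesis
  \<comment> \<open>Above the level the integral is exactly 1. Otherwise \<open>a = 1 / h\<close>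
    cancels the quadratic term in \<open>y\<close>, and the remaining moment generating function is
    compensated by \<open>exp (- x\<^sup>2 / h)\<close> because
    \<open>2 * lam i <= h\<close>.\<close>
  proof (cases "2 * lam i > h")
    case True
    then have l: "lam i > 0" using h by simp
    have b: "bits lam B i = ln (2 * lam i / h) / 2"
      using True h by (simp add: bits_def h_def[symmetric] eta_def[symmetric] max_def)
    have e: "shrink lam B i = h / (2 * lam i)"
      using l h unfolding shrink_def b by (simp add: exp_minus)
    have k: "1 + 2 * (1 / h - 1 / (2 * lam i)) * lam i = 2 * lam i / h"
      using l h by (simp add: field_simps)
    show ?thesis
    proof (rule that[of "1 / (2 * lam i)"])
      show "eta * (1 / (2 * lam i)) * lam i = shrink lam B i * lam i"
        using e l by (simp add: h_def)
      fix x
      have "exp (bits lam B i) = sqrt (2 * lam i / h)"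
        unfolding b using l h by (simp add: ln_sqrt[symmetric])
      moreover have "(2 * x / h)\<^sup>2 * lam i / (2 * (2 * lam i / h)) = x\<^sup>2 / h"
        using l h by (simp add: field_simps power2_eq_square)
      ultimately have "exp (bits lam B i - x\<^sup>2 / h) * (exp ((2 * x / h)\<^sup>2 * lam i / (2 * (2 * lam i / h))) / sqrt (2 * lam i / h)) = 1"
        using l h by (simp add: exp_diff)
      then show "(\<integral>\<^sup>+y. ennreal (exp (bits lam B i + 1 / (2 * lam i) * y\<^sup>2 - (y - x)\<^sup>2 / eta)) \<partial>normal1 0 (lam i)) \<le> 1"
        using red[of "1 / (2 * lam i)" x] l h unfolding k h_def[symmetric] by simp
    qed
  next
    case False
    have b: "bits lam B i = 0"
      using False h lam[of i] by (cases "lam i = 0") (auto simp: bits_def h_def[symmetric] eta_def[symmetric])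
    have e: "shrink lam B i = 1" by (simp add: shrink_def b)
    show ?thesis
    proof (rule that[of "1 / h"])
      show "eta * (1 / h) * lam i = shrink lam B i * lam i" using h by (simp add: e h_def)
      fix x
      have "(2 * x / h)\<^sup>2 * lam i / 2 = x\<^sup>2 / h * (2 * lam i / h)"
        using h by (simp add: field_simps power2_eq_square)
      also have "\<dots> \<le> x\<^sup>2 / h * 1" using False h by (intro mult_left_mono) auto
      finally have "exp (0 - x\<^sup>2 / h) * exp ((2 * x / h)\<^sup>2 * lam i / 2) \<le> 1"
        by (simp add: exp_add[symmetric])
      then show "(\<integral>\<^sup>+y. ennreal (exp (bits lam B i + 1 / h * y\<^sup>2 - (y - x)\<^sup>2 / eta)) \<partial>normal1 0 (lam i)) \<le> 1"
        using red[of "1 / h" x] unfolding h_def[symmetric] by (simp add: b)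
    qed
  qed
qed

section \<open>Joint laws of randomized policies\<close>

text \<open>Keeping the whole sample point, not just state and history, makes every
  \<open>joint_law\<close> an image of this law and lets functions on \<open>M\<close> be integrated
  through \<open>fst\<close>.\<close>

definition kernel_law :: "'w measure \<Rightarrow> ('w \<Rightarrow> 'x::topological_space measure) \<Rightarrow> ('w \<times> 'x) measure" where
  "kernel_law M K = M \<bind> (\<lambda>w. distr (K w) (M \<Otimes>\<^sub>M borel) (\<lambda>x. (w, x)))"

lemma measurable_kernel_pair:
  assumes [measurable]: "K \<in> measurable M (prob_algebra borel)"
  shows "(\<lambda>w. distr (K w) (M \<Otimes>\<^sub>M borel) (\<lambda>x. (w, x))) \<in> measurable M (prob_algebra (M \<Otimes>\<^sub>M borel))"
  by measurable

lemma sets_kernel_law: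
  assumes "prob_space M" "K \<in> measurable M (prob_algebra borel)"
  shows "sets (kernel_law M K) = sets (M \<Otimes>\<^sub>M borel)"
  unfolding kernel_law_def
  using prob_space.not_empty[OF assms(1)] by (subst sets_bind) auto

lemma kernel_sets:
  assumes "K \<in> measurable M (prob_algebra N)" "w \<in> space M"
  shows "sets (K w) = sets N" "prob_space (K w)"
  using measurable_space[OF assms] by (auto simp: space_prob_algebra)

lemma nn_integral_kernel_law:
  assumes M: "prob_space M" and K: "K \<in> measurable M (prob_algebra borel)"
    and f: "f \<in> borel_measurable (M \<Otimes>\<^sub>M borel)"
  shows "(\<integral>\<^sup>+z. f z \<partial>kernel_law M K) = (\<integral>\<^sup>+w. \<integral>\<^sup>+x. f (w, x) \<partial>K w \<partial>M)"
proof -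
  have "(\<integral>\<^sup>+z. f z \<partial>kernel_law M K) = (\<integral>\<^sup>+w. \<integral>\<^sup>+z. f z \<partial>distr (K w) (M \<Otimes>\<^sub>M borel) (\<lambda>x. (w, x)) \<partial>M)"
    unfolding kernel_law_def
    by (rule nn_integral_bind[OF f measurable_prob_algebraD[OF measurable_kernel_pair[OF K]]])
  also have "\<dots> = (\<integral>\<^sup>+w. \<integral>\<^sup>+x. f (w, x) \<partial>K w \<partial>M)"
  proof (rule nn_integral_cong)
    fix w assume w: "w \<in> space M"
    have [measurable_cong]: "sets (K w) = sets borel" by (rule kernel_sets[OF K w])
    show "(\<integral>\<^sup>+z. f z \<partial>distr (K w) (M \<Otimes>\<^sub>M borel) (\<lambda>x. (w, x))) = (\<integral>\<^sup>+x. f (w, x) \<partial>K w)"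
      using f w by (subst nn_integral_distr) auto
  qed
  finally show ?thesis .
qed

lemma prob_space_kernel_law:
  assumes M: "prob_space M" and K: "K \<in> measurable M (prob_algebra borel)"
  shows "prob_space (kernel_law M K)"
  unfolding kernel_law_def
  by (rule prob_space_bind'[OF _ measurable_kernel_pair[OF K]]) (simp add: space_prob_algebra M)

lemma distr_kernel_law_fst:
  assumes M: "prob_space M" and K: "K \<in> measurable M (prob_algebra borel)"
  shows "distr (kernel_law M K) M fst = M"
proof (rule measure_eqI)
  note [measurable_cong] = sets_kernel_law[OF M K]
  fix X assume X: "X \<in> sets (distr (kernel_law M K) M fst)"
  then have [measurable]: "X \<in> sets M" by simp
  have "emeasure (distr (kernel_law M K) M fst) X = (\<integral>\<^sup>+z. indicator X (fst z) \<partial>kernel_law M K)"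
    by (subst nn_integral_distr[symmetric, where M' = M]) auto
  also have "\<dots> = (\<integral>\<^sup>+w. \<integral>\<^sup>+x. indicator X w \<partial>K w \<partial>M)"
    by (subst nn_integral_kernel_law[OF M K]) auto
  also have "\<dots> = (\<integral>\<^sup>+w. indicator X w \<partial>M)"
  proof (rule nn_integral_cong)
    fix w assume w: "w \<in> space M"
    interpret prob_space "K w" by (rule kernel_sets[OF K w])
    show "(\<integral>\<^sup>+x. indicator X w \<partial>K w) = indicator X w" by (simp add: emeasure_space_1)
  qed
  finally show "emeasure (distr (kernel_law M K) M fst) X = emeasure M X" by simp
qed simp

lemma
  fixes f :: "'w \<Rightarrow> real"
  assumes M: "prob_space M" and K: "K \<in> measurable M (prob_algebra borel)"
  shows integrable_kernel_law_fst: "integrable M f \<Longrightarrow> integrable (kernel_law M K) (\<lambda>z. f (fst z))"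
    and integral_kernel_law_fst: "f \<in> borel_measurable M \<Longrightarrow> (\<integral>z. f (fst z) \<partial>kernel_law M K) = (\<integral>w. f w \<partial>M)"
proof -
  note [measurable_cong] = sets_kernel_law[OF M K]
  show "integrable M f \<Longrightarrow> integrable (kernel_law M K) (\<lambda>z. f (fst z))"
    using integrable_distr[of fst "kernel_law M K" M f] by (simp add: distr_kernel_law_fst[OF M K])
  show "f \<in> borel_measurable M \<Longrightarrow> (\<integral>z. f (fst z) \<partial>kernel_law M K) = (\<integral>w. f w \<partial>M)"
    using integral_distr[of fst "kernel_law M K" M f] by (simp add: distr_kernel_law_fst[OF M K])
qed

lemma square_integrable_kernel_law_fst:
  assumes M: "prob_space M" and K: "K \<in> measurable M (prob_algebra borel)" and f: "square_integrable M f"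
  shows "square_integrable (kernel_law M K) (\<lambda>z. f (fst z))"
proof -
  note [measurable_cong] = sets_kernel_law[OF M K]
  have [measurable]: "f \<in> borel_measurable M" using f by (simp add: square_integrable_def)
  show ?thesis using f integrable_kernel_law_fst[OF M K, of "\<lambda>w. (f w)\<^sup>2"]
    by (auto simp: square_integrable_def)
qed

lemma joint_law_eq_distr_kernel_law:
  assumes M: "prob_space M" and K: "K \<in> measurable M (prob_algebra borel)"
    and [measurable]: "th \<in> borel_measurable M" "H \<in> measurable M S"
  shows "joint_law M th H S K = distr (kernel_law M K) (borel \<Otimes>\<^sub>M S \<Otimes>\<^sub>M borel) (\<lambda>z. (th (fst z), H (fst z), snd z))"
proof -
  note [measurable] = measurable_prob_algebraD[OF measurable_kernel_pair[OF K]]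
  have "distr (kernel_law M K) (borel \<Otimes>\<^sub>M S \<Otimes>\<^sub>M borel) (\<lambda>z. (th (fst z), H (fst z), snd z))
    = M \<bind> (\<lambda>w. distr (distr (K w) (M \<Otimes>\<^sub>M borel) (\<lambda>x. (w, x))) (borel \<Otimes>\<^sub>M S \<Otimes>\<^sub>M borel) (\<lambda>z. (th (fst z), H (fst z), snd z)))"
    unfolding kernel_law_def
    by (rule distr_bind[where K = "M \<Otimes>\<^sub>M borel"]) (use prob_space.not_empty[OF M] in auto)
  also have "\<dots> = joint_law M th H S K"
    unfolding joint_law_def
  proof (rule bind_cong[OF refl])
    fix w assume w: "w \<in> space M"
    have [measurable_cong]: "sets (K w) = sets borel" by (rule kernel_sets[OF K w])
    show "distr (distr (K w) (M \<Otimes>\<^sub>M borel) (\<lambda>x. (w, x))) (borel \<Otimes>\<^sub>M S \<Otimes>\<^sub>M borel) (\<lambda>z. (th (fst z), H (fst z), snd z))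
      = distr (K w) (borel \<Otimes>\<^sub>M S \<Otimes>\<^sub>M borel) (\<lambda>x. (th w, H w, x))"
      using w by (subst distr_distr) (auto simp: comp_def)
  qed
  finally show ?thesis by simp
qed

lemma sq_loss_joint_law:
  assumes M: "prob_space M" and K: "K \<in> measurable M (prob_algebra borel)"
    and [measurable]: "th \<in> borel_measurable M" "H \<in> measurable M S"
  shows "sq_loss (joint_law M th H S K) = (\<integral>\<^sup>+z. ennreal ((norm (th (fst z) - snd z))\<^sup>2) \<partial>kernel_law M K)"
proof -
  note [measurable_cong] = sets_kernel_law[OF M K]
  show ?thesis
    unfolding sq_loss_def joint_law_eq_distr_kernel_law[OF M K assms(3,4)]
    by (subst nn_integral_distr) auto
qed

text \<open>The history marginal is the law of \<open>H\<close> whatever the policy. Hence the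
  reference product in the divergence has a known first factor, against which the converse can
  integrate its tilting function.\<close>

lemma info_HX_joint_law:
  assumes M: "prob_space M" and K: "K \<in> measurable M (prob_algebra borel)"
    and [measurable]: "th \<in> borel_measurable M" "H \<in> measurable M S"
  shows "info_HX S (joint_law M th H S K) =
    KL_div (distr (kernel_law M K) (S \<Otimes>\<^sub>M borel) (\<lambda>z. (H (fst z), snd z)))
      (distr M S H \<Otimes>\<^sub>M distr (kernel_law M K) borel snd)"
proof -
  note [measurable_cong] = sets_kernel_law[OF M K]
  have "distr (kernel_law M K) S (\<lambda>z. H (fst z)) = distr (distr (kernel_law M K) M fst) S H"
    by (subst distr_distr) (auto simp: comp_def)
  then have 1: "distr (kernel_law M K) S (\<lambda>z. H (fst z)) = distr M S H"
    by (simp add: distr_kernel_law_fst[OF M K])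
  have 2: "distr (joint_law M th H S K) (S \<Otimes>\<^sub>M borel) snd = distr (kernel_law M K) (S \<Otimes>\<^sub>M borel) (\<lambda>z. (H (fst z), snd z))"
    unfolding joint_law_eq_distr_kernel_law[OF M K assms(3,4)]
    by (subst distr_distr) (auto simp: comp_def)
  show ?thesis
    unfolding info_HX_def mutual_info_def 2
    by (subst (1 2) distr_distr) (auto simp: comp_def 1)
qed

text \<open>Integrating \<open>psi\<close> over the kernel gives \<open>m (H w)\<close>, a function
  of the history, to which \<open>f\<close> is orthogonal. Nonnegativity of \<open>psi\<close> lets
  \<open>m\<close> be a nonnegative integral, finite almost everywhere by \<open>i1\<close>.\<close>

lemma kernel_orthogonal_nonneg:
  fixes f :: "'w \<Rightarrow> real"
  assumes M: "prob_space M" and q [measurable]: "q \<in> measurable S (prob_algebra borel)"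
    and [measurable]: "H \<in> measurable M S" "f \<in> borel_measurable M" "psi \<in> borel_measurable borel"
    and psi: "\<And>x. 0 \<le> psi x"
    and orth: "\<And>g. g \<in> borel_measurable S \<Longrightarrow> integrable M (\<lambda>w. f w * g (H w)) \<Longrightarrow> (\<integral>w. f w * g (H w) \<partial>M) = 0"
    and i1: "integrable (kernel_law M (\<lambda>w. q (H w))) (\<lambda>z. psi (snd z))"
    and i2: "integrable (kernel_law M (\<lambda>w. q (H w))) (\<lambda>z. f (fst z) * psi (snd z))"
  shows "(\<integral>z. f (fst z) * psi (snd z) \<partial>kernel_law M (\<lambda>w. q (H w))) = 0"
proof -
  let ?K = "\<lambda>w. q (H w)"
  let ?L = "kernel_law M ?K"
  have K[measurable]: "?K \<in> measurable M (prob_algebra borel)" by measurable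
  note [measurable_cong] = sets_kernel_law[OF M K]
  note q' [measurable] = measurable_prob_algebraD[OF q]
  define m where "m h = (\<integral>\<^sup>+x. ennreal (psi x) \<partial>q h)" for h
  have m[measurable]: "m \<in> borel_measurable S" unfolding m_def by measurable
  have "(\<integral>\<^sup>+z. ennreal (psi (snd z)) \<partial>?L) = (\<integral>\<^sup>+w. m (H w) \<partial>M)"
    unfolding m_def by (subst nn_integral_kernel_law[OF M K]) auto
  moreover have "(\<integral>\<^sup>+z. ennreal (psi (snd z)) \<partial>?L) < \<infinity>"
    using i1 psi by (auto simp: integrable_iff_bounded)
  ultimately have "(\<integral>\<^sup>+w. m (H w) \<partial>M) \<noteq> \<infinity>" by simp
  then have fin: "AE w in M. m (H w) \<noteq> \<infinity>" by (intro nn_integral_PInf_AE) auto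
  have nn: "(\<integral>\<^sup>+z. ennreal (g (fst z) * psi (snd z)) \<partial>?L) = (\<integral>\<^sup>+w. ennreal (g w * enn2real (m (H w))) \<partial>M)"
    if [measurable]: "g \<in> borel_measurable M" for g :: "'w \<Rightarrow> real"
  proof -
    have "(\<integral>\<^sup>+z. ennreal (g (fst z) * psi (snd z)) \<partial>?L) = (\<integral>\<^sup>+w. \<integral>\<^sup>+x. ennreal (g w * psi x) \<partial>q (H w) \<partial>M)"
      by (subst nn_integral_kernel_law[OF M K]) auto
    also have "\<dots> = (\<integral>\<^sup>+w. ennreal (g w) * m (H w) \<partial>M)"
    proof (rule nn_integral_cong)
      fix w assume "w \<in> space M"
      then have s: "sets (q (H w)) = sets borel" by (rule kernel_sets[OF K])
      have [measurable]: "psi \<in> borel_measurable (q (H w))"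
        by (subst measurable_cong_sets[OF s refl]) (rule assms(5))
      show "(\<integral>\<^sup>+x. ennreal (g w * psi x) \<partial>q (H w)) = ennreal (g w) * m (H w)"
        unfolding m_def by (simp add: ennreal_mult'' psi nn_integral_cmult)
    qed
    also have "\<dots> = (\<integral>\<^sup>+w. ennreal (g w * enn2real (m (H w))) \<partial>M)"
      using fin by (intro nn_integral_cong_AE) (auto simp: ennreal_mult'' less_top)
    finally show ?thesis .
  qed
  have "integrable M (\<lambda>w. f w * enn2real (m (H w)))"
    using i2 nn[of f] nn[of "\<lambda>w. - f w"] by (subst real_integrable_def) (auto simp: real_integrable_def)
  moreover from orth[OF _ this] have "(\<integral>w. f w * enn2real (m (H w)) \<partial>M) = 0" by simp
  ultimately show ?thesis
    using nn[of f] nn[of "\<lambda>w. - f w"] by (simp add: real_lebesgue_integral_def i2)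
qed

lemma kernel_orthogonal:
  fixes f :: "'w \<Rightarrow> real"
  assumes M: "prob_space M" and q [measurable]: "q \<in> measurable S (prob_algebra borel)"
    and [measurable]: "H \<in> measurable M S" "psi \<in> borel_measurable borel"
    and orth: "\<And>g. g \<in> borel_measurable S \<Longrightarrow> integrable M (\<lambda>w. f w * g (H w)) \<Longrightarrow> (\<integral>w. f w * g (H w) \<partial>M) = 0"
    and f: "square_integrable M f"
    and psi: "square_integrable (kernel_law M (\<lambda>w. q (H w))) (\<lambda>z. psi (snd z))"
  shows "(\<integral>z. f (fst z) * psi (snd z) \<partial>kernel_law M (\<lambda>w. q (H w))) = 0"
proof -
  let ?K = "\<lambda>w. q (H w)"
  let ?L = "kernel_law M ?K"
  have K[measurable]: "?K \<in> measurable M (prob_algebra borel)" by measurable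
  note [measurable_cong] = sets_kernel_law[OF M K]
  interpret L: prob_space ?L by (rule prob_space_kernel_law[OF M K])
  have [measurable]: "f \<in> borel_measurable M" using f by (simp add: square_integrable_def)
  have f': "square_integrable ?L (\<lambda>z. f (fst z))" by (rule square_integrable_kernel_law_fst[OF M K f])
  \<comment> \<open>\<open>s = 1\<close> and \<open>s = -1\<close> give the positive and the
    negative part of \<open>psi\<close>.\<close>
  have part: "square_integrable ?L (\<lambda>z. max 0 (s * psi (snd z)))" if "\<bar>s\<bar> = 1" for s :: real
    unfolding square_integrable_def
  proof
    show "integrable ?L (\<lambda>z. (max 0 (s * psi (snd z)))\<^sup>2)"
    proof (rule Bochner_Integration.integrable_bound)
      show "integrable ?L (\<lambda>z. (psi (snd z))\<^sup>2)" using psi by (simp add: square_integrable_def)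
      have "(max 0 (s * y))\<^sup>2 \<le> y\<^sup>2" for y
        using that by (auto simp: max_def power_mult_distrib abs_if split: if_splits)
      then show "AE z in ?L. norm ((max 0 (s * psi (snd z)))\<^sup>2) \<le> norm ((psi (snd z))\<^sup>2)" by simp
    qed measurable
  qed measurable
  have 0: "(\<integral>z. f (fst z) * max 0 (s * psi (snd z)) \<partial>?L) = 0" if "\<bar>s\<bar> = 1" for s
    by (rule kernel_orthogonal_nonneg[OF M q _ _ _ _ orth, where psi = "\<lambda>x. max 0 (s * psi x)"])
      (simp_all add: square_integrable_mult[OF f' part[OF that]] L.square_integrable_imp_integrable[OF part[OF that]])
  have "(\<integral>z. f (fst z) * psi (snd z) \<partial>?L) = (\<integral>z. f (fst z) * max 0 (1 * psi (snd z)) - f (fst z) * max 0 (- 1 * psi (snd z)) \<partial>?L)"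
    by (intro Bochner_Integration.integral_cong) (auto simp: max_def)
  also have "\<dots> = 0"
    using 0[of 1] 0[of "-1"] square_integrable_mult[OF f' part[of 1]] square_integrable_mult[OF f' part[of "-1"]] by simp
  finally show ?thesis .
qed

section \<open>Information through a Gaussian channel\<close>

lemma normal_vec_column_moments:
  assumes P: "is_normal_vec P 0 (U ** diag_mat v ** transpose U)" and U: "orthogonal_matrix (U :: real^'d^'d)"
  shows "square_integrable P (\<lambda>x. column i U \<bullet> x)" and "(\<integral>x. column i U \<bullet> x \<partial>P) = 0"
    and "(\<integral>x. (column i U \<bullet> x)\<^sup>2 \<partial>P) = \<bar>v i\<bar>"
proof -
  from P have [measurable_cong]: "sets P = sets borel" by (simp add: is_normal_vec_def)
  note D = distr_normal_vec_column[OF P U, of i]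
  have "centered_normal P (\<lambda>x. column i U \<bullet> x)" using D by (auto simp: centered_normal_def)
  then show "square_integrable P (\<lambda>x. column i U \<bullet> x)" "(\<integral>x. column i U \<bullet> x \<partial>P) = 0"
    by (auto dest: centered_normal_props)
  have "(\<integral>y. y\<^sup>2 \<partial>distr P borel (\<lambda>x. column i U \<bullet> x)) = \<bar>v i\<bar>" unfolding D by (rule second_moment_normal1)
  then show "(\<integral>x. (column i U \<bullet> x)\<^sup>2 \<partial>P) = \<bar>v i\<bar>" by (subst (asm) integral_distr) auto
qed

text \<open>Pythagoras for independent variables: the cross term factors, and \<open>g\<close> is
  centered.\<close>

lemma integral_pair_square_sum:
  assumes M: "prob_space M" and N: "prob_space N" and f: "square_integrable M f" and g: "square_integrable N g"
    and g0: "(\<integral>y. g y \<partial>N) = 0"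
  shows "square_integrable (M \<Otimes>\<^sub>M N) (\<lambda>z. f (fst z) + g (snd z))"
    and "(\<integral>z. (f (fst z) + g (snd z))\<^sup>2 \<partial>(M \<Otimes>\<^sub>M N)) = (\<integral>x. (f x)\<^sup>2 \<partial>M) + (\<integral>y. (g y)\<^sup>2 \<partial>N)"
proof -
  interpret M: prob_space M by fact
  interpret N: prob_space N by fact
  interpret MN: pair_prob_space M N ..
  have [measurable]: "f \<in> borel_measurable M" "g \<in> borel_measurable N"
    using f g by (auto simp: square_integrable_def)
  have f': "square_integrable (M \<Otimes>\<^sub>M N) (\<lambda>z. f (fst z))"
    using f integrable_pair_fst[OF M N, of "\<lambda>x. (f x)\<^sup>2"] by (simp add: square_integrable_def)
  have g': "square_integrable (M \<Otimes>\<^sub>M N) (\<lambda>z. g (snd z))"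
    using g integrable_pair_snd[OF M N, of "\<lambda>x. (g x)\<^sup>2"] by (simp add: square_integrable_def)
  show "square_integrable (M \<Otimes>\<^sub>M N) (\<lambda>z. f (fst z) + g (snd z))" using f' g' by (rule square_integrable_add)
  note fg = square_integrable_mult[OF f' g']
  have "(\<integral>z. f (fst z) * g (snd z) \<partial>(M \<Otimes>\<^sub>M N)) = (\<integral>x. \<integral>y. f x * g y \<partial>N \<partial>M)"
    using MN.integral_fst'[OF fg] by simp
  then have c: "(\<integral>z. f (fst z) * g (snd z) \<partial>(M \<Otimes>\<^sub>M N)) = 0" by (simp add: g0)
  have i: "integrable (M \<Otimes>\<^sub>M N) (\<lambda>z. (f (fst z))\<^sup>2)" "integrable (M \<Otimes>\<^sub>M N) (\<lambda>z. (g (snd z))\<^sup>2)"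
    using f' g' by (auto simp: square_integrable_def)
  have "(\<integral>z. (f (fst z) + g (snd z))\<^sup>2 \<partial>(M \<Otimes>\<^sub>M N)) = (\<integral>z. (f (fst z))\<^sup>2 + (g (snd z))\<^sup>2 + 2 * (f (fst z) * g (snd z)) \<partial>(M \<Otimes>\<^sub>M N))"
    by (simp add: power2_sum mult.assoc)
  also have "\<dots> = (\<integral>z. (f (fst z))\<^sup>2 \<partial>(M \<Otimes>\<^sub>M N)) + (\<integral>z. (g (snd z))\<^sup>2 \<partial>(M \<Otimes>\<^sub>M N))"
    using i fg c by simp
  also have "\<dots> = (\<integral>x. (f x)\<^sup>2 \<partial>M) + (\<integral>y. (g y)\<^sup>2 \<partial>N)"
    using integral_pair_fst[OF M N, of "\<lambda>x. (f x)\<^sup>2"] integral_pair_snd[OF M N, of "\<lambda>x. (g x)\<^sup>2"] by simp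
  finally show "(\<integral>z. (f (fst z) + g (snd z))\<^sup>2 \<partial>(M \<Otimes>\<^sub>M N)) = (\<integral>x. (f x)\<^sup>2 \<partial>M) + (\<integral>y. (g y)\<^sup>2 \<partial>N)" .
qed

text \<open>The bound compares the output law with the Gaussian law of the same covariance, so it only
  uses second moments of the input.  Coordinates with \<^term>\<open>v i = 0\<close> carry no signal; there
  all quotients below vanish because division by zero gives zero.\<close>

lemma gaussian_channel_info_le:
  fixes m :: "'h \<Rightarrow> real^'d" and U :: "real^'d^'d"
  assumes N: "prob_space N" and m [measurable]: "m \<in> borel_measurable N"
    and E: "is_normal_vec E 0 (U ** diag_mat v ** transpose U)" and U: "orthogonal_matrix U"
    and s0: "\<And>i. 0 \<le> s i" and v: "\<And>i. v i = exp (- 2 * b i) * s i" and b0: "\<And>i. s i = 0 \<Longrightarrow> b i = 0"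
    and m0: "\<And>i h. s i = 0 \<Longrightarrow> column i U \<bullet> m h = 0"
    and m2: "\<And>i. square_integrable N (\<lambda>h. column i U \<bullet> m h)"
    and s: "\<And>i. (\<integral>h. (column i U \<bullet> m h)\<^sup>2 \<partial>N) + v i = s i"
    and P: "P = distr (N \<Otimes>\<^sub>M E) (N \<Otimes>\<^sub>M borel) (\<lambda>z. (fst z, m (fst z) + snd z))"
  shows "KL_div P (N \<Otimes>\<^sub>M distr P borel snd) \<le> ereal (\<Sum>i\<in>UNIV. b i)"
proof -
  from E have pE: "prob_space E" and sE[measurable_cong]: "sets E = sets borel" by (auto simp: is_normal_vec_def)
  interpret N: prob_space N by fact
  interpret E: prob_space E by fact
  interpret NE: pair_prob_space N E ..
  have v0: "0 \<le> v i" for i using s0[of i] by (simp add: v)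
  have vs: "v i = 0 \<longleftrightarrow> s i = 0" for i by (simp add: v)
  \<comment> \<open>The density of the channel output given \<open>h\<close>, relative to the noise
    law \<open>E\<close>; a reference measure adapted to the noise also serves degenerate
    directions.\<close>
  define r where "r h x = exp (\<Sum>i\<in>UNIV. (column i U \<bullet> m h) * (column i U \<bullet> x) / v i - (column i U \<bullet> m h)\<^sup>2 / (2 * v i))" for h x
  have r[measurable]: "(\<lambda>z. r (fst z) (snd z)) \<in> borel_measurable (N \<Otimes>\<^sub>M borel)" unfolding r_def by measurable
  have [measurable]: "(\<lambda>z. r (snd z) (fst z)) \<in> borel_measurable (borel \<Otimes>\<^sub>M N)" unfolding r_def by measurable
  have r_x[measurable]: "r h \<in> borel_measurable borel" for h unfolding r_def[abs_def] by measurable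
  have [measurable]: "(\<lambda>h. r h x) \<in> borel_measurable N" for x unfolding r_def by measurable
  have rpos: "0 < r h x" for h x by (simp add: r_def)
  have shift: "distr E borel (\<lambda>e. m h + e) = density E (\<lambda>x. ennreal (r h x))" for h
    unfolding r_def by (rule normal_vec_shift_density[OF E U v0]) (simp add: vs m0)
  have pP: "prob_space P" unfolding P by (intro NE.prob_space_distr) auto
  have sP[measurable_cong]: "sets P = sets (N \<Otimes>\<^sub>M borel)" by (simp add: P)
  have sNE[measurable_cong]: "sets (N \<Otimes>\<^sub>M E) = sets (N \<Otimes>\<^sub>M borel)" by (intro sets_pair_measure_cong sE refl)
  have nnP: "(\<integral>\<^sup>+z. g z \<partial>P) = (\<integral>\<^sup>+z. ennreal (r (fst z) (snd z)) * g z \<partial>(N \<Otimes>\<^sub>M E))"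
    if [measurable]: "g \<in> borel_measurable (N \<Otimes>\<^sub>M borel)" for g
  proof -
    have "(\<integral>\<^sup>+z. g z \<partial>P) = (\<integral>\<^sup>+z. g (fst z, m (fst z) + snd z) \<partial>(N \<Otimes>\<^sub>M E))"
      unfolding P by (subst nn_integral_distr) auto
    also have "\<dots> = (\<integral>\<^sup>+h. \<integral>\<^sup>+e. g (h, m h + e) \<partial>E \<partial>N)"
      by (subst E.nn_integral_fst[symmetric]) auto
    also have "\<dots> = (\<integral>\<^sup>+h. \<integral>\<^sup>+x. ennreal (r h x) * g (h, x) \<partial>E \<partial>N)"
    proof (rule nn_integral_cong)
      fix h assume h: "h \<in> space N"
      have "(\<integral>\<^sup>+e. g (h, m h + e) \<partial>E) = (\<integral>\<^sup>+x. g (h, x) \<partial>distr E borel (\<lambda>e. m h + e))"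
        using h by (subst nn_integral_distr) auto
      then show "(\<integral>\<^sup>+e. g (h, m h + e) \<partial>E) = (\<integral>\<^sup>+x. ennreal (r h x) * g (h, x) \<partial>E)"
        unfolding shift using h by (subst (asm) nn_integral_density) auto
    qed
    also have "\<dots> = (\<integral>\<^sup>+z. ennreal (r (fst z) (snd z)) * g z \<partial>(N \<Otimes>\<^sub>M E))"
      by (subst E.nn_integral_fst[symmetric]) auto
    finally show ?thesis .
  qed
  have P_dens: "P = density (N \<Otimes>\<^sub>M E) (\<lambda>z. ennreal (r (fst z) (snd z)))"
  proof (rule measure_eqI)
    show "sets P = sets (density (N \<Otimes>\<^sub>M E) (\<lambda>z. ennreal (r (fst z) (snd z))))" by (simp add: sP sNE)
    fix X assume "X \<in> sets P"
    then have [measurable]: "X \<in> sets (N \<Otimes>\<^sub>M borel)" by (simp add: sP)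
    have "emeasure P X = (\<integral>\<^sup>+z. indicator X z \<partial>P)" by (simp add: sP)
    also have "\<dots> = (\<integral>\<^sup>+z. ennreal (r (fst z) (snd z)) * indicator X z \<partial>(N \<Otimes>\<^sub>M E))" by (rule nnP) simp
    also have "\<dots> = emeasure (density (N \<Otimes>\<^sub>M E) (\<lambda>z. ennreal (r (fst z) (snd z)))) X"
      by (subst emeasure_density) (auto simp: sNE)
    finally show "emeasure P X = emeasure (density (N \<Otimes>\<^sub>M E) (\<lambda>z. ennreal (r (fst z) (snd z)))) X" .
  qed
  \<comment> \<open>The density of the output law relative to \<open>E\<close>. It is finite only
    almost everywhere, so the density \<open>f\<close> of the joint law against the product of
    marginals uses \<open>enn2real\<close>.\<close>
  define R where "R x = (\<integral>\<^sup>+h. ennreal (r h x) \<partial>N)" for x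
  have R[measurable]: "R \<in> borel_measurable borel" unfolding R_def by measurable
  have Rpos: "R x \<noteq> 0" for x
  proof -
    have "ennreal (r h x) \<noteq> 0" for h using rpos[of h x] by (simp add: not_le)
    then show ?thesis unfolding R_def by (subst nn_integral_0_iff_AE) auto
  qed
  have nnPX: "(\<integral>\<^sup>+x. g x \<partial>distr P borel snd) = (\<integral>\<^sup>+x. R x * g x \<partial>E)" if [measurable]: "g \<in> borel_measurable borel" for g
  proof -
    have "(\<integral>\<^sup>+x. g x \<partial>distr P borel snd) = (\<integral>\<^sup>+z. g (snd z) \<partial>P)"
      by (subst nn_integral_distr) auto
    also have "\<dots> = (\<integral>\<^sup>+z. ennreal (r (fst z) (snd z)) * g (snd z) \<partial>(N \<Otimes>\<^sub>M E))" by (rule nnP) simp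
    also have "\<dots> = (\<integral>\<^sup>+x. \<integral>\<^sup>+h. ennreal (r h x) * g x \<partial>N \<partial>E)"
      by (subst NE.nn_integral_snd[symmetric]) auto
    also have "\<dots> = (\<integral>\<^sup>+x. R x * g x \<partial>E)"
      unfolding R_def by (intro nn_integral_cong nn_integral_multc) auto
    finally show ?thesis .
  qed
  have PX: "distr P borel snd = density E R"
  proof (rule measure_eqI)
    fix X assume "X \<in> sets (distr P borel snd)"
    then have [measurable]: "X \<in> sets borel" by simp
    show "emeasure (distr P borel snd) X = emeasure (density E R) X"
      using nnPX[of "indicator X"] by (simp add: emeasure_density sE)
  qed (simp add: sE)
  have pPX: "prob_space (distr P borel snd)" using pP by (intro prob_space.prob_space_distr) auto
  let ?Q = "N \<Otimes>\<^sub>M distr P borel snd"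
  have pQ: "prob_space ?Q" by (intro prob_space_pair N pPX)
  have sQ[measurable_cong]: "sets ?Q = sets (N \<Otimes>\<^sub>M borel)" by (intro sets_pair_measure_cong refl) simp
  have Q_dens: "?Q = density (N \<Otimes>\<^sub>M E) (\<lambda>z. R (snd z))"
  proof -
    have "density N (\<lambda>_. 1) \<Otimes>\<^sub>M density E R = density (N \<Otimes>\<^sub>M E) (\<lambda>(x, y). 1 * R y)"
      by (rule pair_measure_density)
        (use pPX[unfolded PX] in \<open>auto intro: E.sigma_finite_measure_axioms prob_space_imp_sigma_finite\<close>)
    then show ?thesis by (simp add: PX density_1 case_prod_beta')
  qed
  have "(\<integral>\<^sup>+x. R x \<partial>E) = 1"
    using nnPX[of "\<lambda>_. 1"] prob_space.emeasure_space_1[OF pPX] by simp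
  then have "AE x in E. R x \<noteq> \<infinity>" by (intro nn_integral_PInf_AE) auto
  then have "AE x in distr (N \<Otimes>\<^sub>M E) E snd. R x \<noteq> \<infinity>"
    by (subst distr_pair_snd'[OF N E.sigma_finite_measure_axioms])
  then have Rfin: "AE z in N \<Otimes>\<^sub>M E. R (snd z) \<noteq> \<infinity>" by (subst (asm) AE_distr_iff) auto
  have RfinP: "AE z in P. R (snd z) \<noteq> \<infinity>"
    unfolding P_dens by (subst AE_density) (use Rfin in auto)
  define f where "f z = r (fst z) (snd z) / enn2real (R (snd z))" for z
  have f[measurable]: "f \<in> borel_measurable (N \<Otimes>\<^sub>M borel)" unfolding f_def by measurable
  have f0: "0 \<le> f z" for z using rpos[of "fst z" "snd z"] by (simp add: f_def)
  have Rpos': "0 < enn2real (R x)" if "R x \<noteq> \<infinity>" for x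
    using that Rpos[of x] by (simp add: enn2real_positive_iff less_top zero_less_iff_neq_zero)
  have PQ: "P = density ?Q (\<lambda>z. ennreal (f z))"
  proof -
    have "density ?Q (\<lambda>z. ennreal (f z)) = density (N \<Otimes>\<^sub>M E) (\<lambda>z. R (snd z) * ennreal (f z))"
      unfolding Q_dens by (rule density_density_eq) auto
    also have "\<dots> = density (N \<Otimes>\<^sub>M E) (\<lambda>z. ennreal (r (fst z) (snd z)))"
    proof (rule density_cong)
      show "AE z in N \<Otimes>\<^sub>M E. R (snd z) * ennreal (f z) = ennreal (r (fst z) (snd z))"
        using Rfin
      proof eventually_elim
        case (elim z)
        then have "R (snd z) = ennreal (enn2real (R (snd z)))" by (simp add: less_top)
        then have "R (snd z) * ennreal (f z) = ennreal (enn2real (R (snd z)) * f z)"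
          using f0 by (metis enn2real_nonneg ennreal_mult)
        then show ?case using Rpos'[OF elim] by (simp add: f_def)
      qed
    qed auto
    finally show ?thesis by (simp only: P_dens)
  qed
  \<comment> \<open>The density relative to \<open>E\<close> of the Gaussian reference with
    variances \<open>s i\<close>. The factor \<open>exp (- b i)\<close> is its normalisation: it is
    the square root of \<open>v i / s i\<close> when \<open>s i\<close> is positive.\<close>
  define rho where "rho x = exp (\<Sum>i\<in>UNIV. - b i + (column i U \<bullet> x)\<^sup>2 / (2 * v i) - (column i U \<bullet> x)\<^sup>2 / (2 * s i))" for x
  have rho[measurable]: "rho \<in> borel_measurable borel" unfolding rho_def[abs_def] by measurable
  have rhopos: "0 < rho x" for x by (simp add: rho_def)
  have int_rho: "(\<integral>\<^sup>+x. ennreal (rho x) \<partial>E) \<le> 1"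
  proof -
    have "(\<integral>\<^sup>+x. ennreal (rho x) \<partial>E)
        = (\<integral>\<^sup>+x. (\<Prod>i\<in>UNIV. ennreal (exp (- b i + (column i U \<bullet> x)\<^sup>2 / (2 * v i) - (column i U \<bullet> x)\<^sup>2 / (2 * s i)))) \<partial>E)"
      unfolding rho_def by (simp add: exp_sum prod_ennreal)
    also have "\<dots> = (\<Prod>i\<in>UNIV. \<integral>\<^sup>+y. ennreal (exp (- b i + y\<^sup>2 / (2 * v i) - y\<^sup>2 / (2 * s i))) \<partial>normal1 0 (v i))"
      by (rule nn_integral_normal_vec_prod[OF E U v0]) measurable
    also have "\<dots> = (\<Prod>i\<in>(UNIV :: 'd set). 1)"
    proof (rule prod.cong[OF refl])
      fix i :: 'd
      show "(\<integral>\<^sup>+y. ennreal (exp (- b i + y\<^sup>2 / (2 * v i) - y\<^sup>2 / (2 * s i))) \<partial>normal1 0 (v i)) = 1"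
      proof (cases "s i = 0")
        case True
        then show ?thesis using prob_space.emeasure_space_1[OF prob_space_normal1[of 0]] by (simp add: b0 v)
      next
        case False
        then have sp: "s i > 0" and vp: "v i > 0" using s0[of i] v0[of i] vs[of i] by auto
        define a where "a = 1 / (2 * s i) - 1 / (2 * v i)"
        have k: "1 + 2 * a * v i = exp (- 2 * b i)" using sp vp by (simp add: a_def field_simps) (simp add: v)
        have "exp (- b i + y\<^sup>2 / (2 * v i) - y\<^sup>2 / (2 * s i)) = exp (- b i) * exp (- a * y\<^sup>2 + 0 * y)" for y
          by (simp add: exp_add[symmetric] a_def left_diff_distrib)
        then have "(\<integral>\<^sup>+y. ennreal (exp (- b i + y\<^sup>2 / (2 * v i) - y\<^sup>2 / (2 * s i))) \<partial>normal1 0 (v i))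
          = (\<integral>\<^sup>+y. ennreal (exp (- b i)) * ennreal (exp (- a * y\<^sup>2 + 0 * y)) \<partial>normal1 0 (v i))"
          by (simp only: ennreal_mult[OF exp_ge_zero exp_ge_zero])
        also have "\<dots> = ennreal (exp (- b i)) * (\<integral>\<^sup>+y. ennreal (exp (- a * y\<^sup>2 + 0 * y)) \<partial>normal1 0 (v i))"
          by (rule nn_integral_cmult) measurable
        also have "\<dots> = ennreal (exp (- b i)) * ennreal (1 / sqrt (exp (- 2 * b i)))"
          using nn_integral_exp_quadratic_normal1[OF v0, of a i 0] k by simp
        also have "sqrt (exp (- 2 * b i)) = exp (- b i)"
          by (rule real_sqrt_unique) (auto simp: power2_eq_square exp_add[symmetric])
        finally show ?thesis by (simp add: ennreal_mult[symmetric])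
      qed
    qed
    finally show ?thesis by simp
  qed
  \<comment> \<open>Reference over true output density. Then \<open>ln f = g + ln k\<close> with
    \<open>g = ln r - ln rho\<close> explicit and quadratic, as \<open>KL_div_le\<close>
    requires.\<close>
  define k where "k z = rho (snd z) / enn2real (R (snd z))" for z :: "'h \<times> (real^'d)"
  have k[measurable]: "k \<in> borel_measurable (N \<Otimes>\<^sub>M borel)" unfolding k_def by measurable
  have k0: "0 \<le> k z" for z using rhopos[of "snd z"] by (simp add: k_def)
  have "(\<integral>\<^sup>+z. ennreal (k z) \<partial>P) = (\<integral>\<^sup>+x. ennreal (rho x / enn2real (R x)) \<partial>distr P borel snd)"
    unfolding k_def by (subst nn_integral_distr) auto
  also have "\<dots> = (\<integral>\<^sup>+x. R x * ennreal (rho x / enn2real (R x)) \<partial>E)" by (rule nnPX) measurable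
  also have "\<dots> \<le> (\<integral>\<^sup>+x. ennreal (rho x) \<partial>E)"
  proof (rule nn_integral_mono)
    fix x
    show "R x * ennreal (rho x / enn2real (R x)) \<le> ennreal (rho x)"
      using rhopos[of x] by (cases "R x") (auto simp: ennreal_mult[symmetric])
  qed
  also note int_rho
  finally have k1: "(\<integral>\<^sup>+z. ennreal (k z) \<partial>P) \<le> 1" .
  define g where "g z = (\<Sum>i\<in>UNIV. b i - (column i U \<bullet> snd z - column i U \<bullet> m (fst z))\<^sup>2 / (2 * v i)
      + (column i U \<bullet> snd z)\<^sup>2 / (2 * s i))" for z
  have g[measurable]: "g \<in> borel_measurable (N \<Otimes>\<^sub>M borel)" unfolding g_def by measurable
  have lng: "ln (r (fst z) (snd z)) - ln (rho (snd z)) = g z" for z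
  proof -
    have *: "A * x / w - A\<^sup>2 / (2 * w) - (- c + x\<^sup>2 / (2 * w) - x\<^sup>2 / (2 * t)) = c - (x - A)\<^sup>2 / (2 * w) + x\<^sup>2 / (2 * t)" for A x w c t :: real
      by (cases "w = 0") (simp_all add: field_simps power2_eq_square)
    show ?thesis unfolding r_def rho_def g_def ln_exp sum_subtractf[symmetric] by (rule sum.cong[OF refl]) (rule *)
  qed
  have le: "AE z in P. ln (f z) \<le> g z + k z - 1"
    using RfinP
  proof eventually_elim
    case (elim z)
    note Rp = Rpos'[OF elim]
    have "ln (f z) = g z + ln (k z)"
      using rpos[of "fst z" "snd z"] rhopos[of "snd z"] Rp
      by (simp add: f_def k_def ln_div lng[symmetric])
    also have "ln (k z) \<le> k z - 1" using rhopos[of "snd z"] Rp by (intro ln_le_minus_one) (simp add: k_def)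
    finally show ?case by simp
  qed
  note mE = normal_vec_column_moments[OF E U]
  note sq = integral_pair_square_sum[OF N pE m2 mE(1) mE(2)]
  let ?ge = "\<lambda>z. \<Sum>i\<in>UNIV. b i - (column i U \<bullet> snd z)\<^sup>2 / (2 * v i) + (column i U \<bullet> m (fst z) + column i U \<bullet> snd z)\<^sup>2 / (2 * s i)"
  have ge: "g (fst z, m (fst z) + snd z) = ?ge z" for z by (simp add: g_def inner_add_right)
  have i1: "integrable (N \<Otimes>\<^sub>M E) (\<lambda>z. (column i U \<bullet> snd z)\<^sup>2)" for i
    using mE(1)[of i] by (intro integrable_pair_snd[OF N pE, of "\<lambda>x. (column i U \<bullet> x)\<^sup>2"]) (simp add: square_integrable_def)
  have i2: "integrable (N \<Otimes>\<^sub>M E) (\<lambda>z. (column i U \<bullet> m (fst z) + column i U \<bullet> snd z)\<^sup>2)" for i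
    using sq(1)[of i i] by (simp add: square_integrable_def)
  have "integrable (N \<Otimes>\<^sub>M E) ?ge" using i1 i2 by auto
  then have gi: "integrable P g" unfolding P by (subst integrable_distr_eq) (auto simp: ge)
  have "(\<integral>z. g z \<partial>P) = (\<integral>z. ?ge z \<partial>(N \<Otimes>\<^sub>M E))"
    unfolding P by (subst integral_distr) (auto simp: ge)
  also have "\<dots> = (\<Sum>i\<in>UNIV. b i - (\<integral>z. (column i U \<bullet> snd z)\<^sup>2 \<partial>(N \<Otimes>\<^sub>M E)) / (2 * v i)
      + (\<integral>z. (column i U \<bullet> m (fst z) + column i U \<bullet> snd z)\<^sup>2 \<partial>(N \<Otimes>\<^sub>M E)) / (2 * s i))"
    using i1 i2 by (simp add: integral_sum NE.prob_space)
  also have "\<dots> = (\<Sum>i\<in>UNIV. b i)"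
  \<comment> \<open>The second moments of noise and output are \<open>v i\<close> and
    \<open>s i\<close>, so the quadratic terms contribute - 1/2 and 1/2 and cancel. If
    \<open>s i = 0\<close> then \<open>v i = 0\<close>, and both quotients are 0.\<close>
  proof (rule sum.cong[OF refl])
    fix i :: 'd
    have "(\<integral>z. (column i U \<bullet> snd z)\<^sup>2 \<partial>(N \<Otimes>\<^sub>M E)) = v i"
      using integral_pair_snd[OF N pE, of "\<lambda>x. (column i U \<bullet> x)\<^sup>2"] mE(3)[of i] v0[of i] by simp
    moreover have "(\<integral>z. (column i U \<bullet> m (fst z) + column i U \<bullet> snd z)\<^sup>2 \<partial>(N \<Otimes>\<^sub>M E)) = s i"
      using sq(2)[of i i] s[of i] mE(3)[of i] v0[of i] by simp
    ultimately show "b i - (\<integral>z. (column i U \<bullet> snd z)\<^sup>2 \<partial>(N \<Otimes>\<^sub>M E)) / (2 * v i)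
      + (\<integral>z. (column i U \<bullet> m (fst z) + column i U \<bullet> snd z)\<^sup>2 \<partial>(N \<Otimes>\<^sub>M E)) / (2 * s i) = b i"
      using vs[of i] by (cases "s i = 0") auto
  qed
  finally have "(\<integral>z. g z \<partial>P) = (\<Sum>i\<in>UNIV. b i)" .
  moreover have "KL_div P ?Q \<le> ereal (\<integral>z. g z \<partial>P)"
    by (rule KL_div_le[OF pP pQ _ f0 PQ gi _ k0 k1 le]) measurable
  ultimately show ?thesis by simp
qed

section \<open>Rate-distortion bound for a Gaussian source\<close>

lemma norm_square_vec: "(norm (x :: real^'d))\<^sup>2 = (\<Sum>k\<in>UNIV. (x $ k)\<^sup>2)"
  unfolding power2_norm_eq_inner inner_vec_def by (simp add: power2_eq_square)

lemma square_integrable_distr: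
  assumes "T \<in> measurable M N" "f \<in> borel_measurable N" "square_integrable M (\<lambda>x. f (T x))"
  shows "square_integrable (distr M N T) f"
  using assms by (simp add: square_integrable_def integrable_distr_eq)

lemma square_integrable_components:
  assumes U: "orthogonal_matrix (U :: real^'d^'d)" and "\<And>i. square_integrable M (\<lambda>w. column i U \<bullet> X w)"
  shows "square_integrable M (\<lambda>w. X w $ k)"
proof -
  have "X w $ k = (\<Sum>i\<in>UNIV. column i U $ k * (column i U \<bullet> X w))" for w
    by (subst orthogonal_matrix_expand[OF U, of "X w", symmetric]) (simp add: mult.commute)
  then show ?thesis using assms(2) by (simp add: square_integrable_sum square_integrable_cmult)
qed

text \<open>A single period with time removed: \<open>G (H w)\<close> plays the conditional mean,
  and \<open>orth\<close> is the property of conditional expectation from which the loss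
  splits.\<close>

locale gaussian_source = prob_space M for M :: "'w measure" +
  fixes th :: "'w \<Rightarrow> real^'d" and H :: "'w \<Rightarrow> 'h" and S :: "'h measure" and G :: "'h \<Rightarrow> real^'d"
    and U :: "real^'d^'d" and lam :: "'d \<Rightarrow> real" and B :: real and E :: "(real^'d) measure"
  assumes th2: "\<And>k. square_integrable M (\<lambda>w. th w $ k)"
    and th_meas [measurable]: "th \<in> borel_measurable M" and H_meas [measurable]: "H \<in> measurable M S"
    and G_meas [measurable]: "G \<in> borel_measurable S"
    and U: "orthogonal_matrix U" and lam: "\<And>i. 0 \<le> lam i"
    and normal: "is_normal_vec (distr M borel (\<lambda>w. G (H w))) 0 (U ** diag_mat lam ** transpose U)"
    and orth: "\<And>k g. g \<in> borel_measurable S \<Longrightarrow> integrable M (\<lambda>w. (th w $ k - G (H w) $ k) * g (H w)) \<Longrightarrow>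
      (\<integral>w. (th w $ k - G (H w) $ k) * g (H w) \<partial>M) = 0"
    and B: "B > 0" and E: "is_normal_vec E 0 (Psi_mat U lam B)"
begin

lemma
  shows G_coord_square: "square_integrable M (\<lambda>w. column i U \<bullet> G (H w))"
    and G_coord_moment: "(\<integral>w. (column i U \<bullet> G (H w))\<^sup>2 \<partial>M) = lam i"
proof -
  note D = normal_vec_column_moments[OF normal U, of i]
  show "square_integrable M (\<lambda>w. column i U \<bullet> G (H w))"
    using D(1) by (simp add: square_integrable_def integrable_distr_eq)
  show "(\<integral>w. (column i U \<bullet> G (H w))\<^sup>2 \<partial>M) = lam i"
    using D(3) lam[of i] by (simp add: integral_distr)
qed

lemma G_square: "square_integrable M (\<lambda>w. G (H w) $ k)"
  by (rule square_integrable_components[OF U G_coord_square])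

definition residual :: real where
  "residual = (\<Sum>k\<in>UNIV. \<integral>w. (th w $ k - G (H w) $ k)\<^sup>2 \<partial>M)"

text \<open>The error of the conditional mean is orthogonal to \<open>G (H w)\<close> and, by
  \<open>kernel_orthogonal\<close>, also to the randomised prediction. So the cross term vanishes
  and \<open>residual\<close> is the same for every policy.\<close>

lemma loss_decomposition:
  assumes q [measurable]: "q \<in> measurable S (prob_algebra borel)"
    and x2: "\<And>k. square_integrable (kernel_law M (\<lambda>w. q (H w))) (\<lambda>z. snd z $ k)"
  shows "integrable (kernel_law M (\<lambda>w. q (H w))) (\<lambda>z. (norm (G (H (fst z)) - snd z))\<^sup>2)"
    and "(\<integral>\<^sup>+z. ennreal ((norm (th (fst z) - snd z))\<^sup>2) \<partial>kernel_law M (\<lambda>w. q (H w)))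
      = ennreal (residual + (\<integral>z. (norm (G (H (fst z)) - snd z))\<^sup>2 \<partial>kernel_law M (\<lambda>w. q (H w))))"
proof -
  let ?L = "kernel_law M (\<lambda>w. q (H w))"
  have K: "(\<lambda>w. q (H w)) \<in> measurable M (prob_algebra borel)" by measurable
  note M = prob_space_axioms
  note sL[measurable_cong] = sets_kernel_law[OF M K]
  interpret L: prob_space ?L by (rule prob_space_kernel_law[OF M K])
  define f where "f k w = th w $ k - G (H w) $ k" for k w
  have [measurable]: "f k \<in> borel_measurable M" for k unfolding f_def by measurable
  have f2: "square_integrable M (f k)" for k
    unfolding f_def using th2 G_square by (rule square_integrable_diff)
  have f2': "square_integrable ?L (\<lambda>z. f k (fst z))" for k by (rule square_integrable_kernel_law_fst[OF M K f2])
  have G2': "square_integrable ?L (\<lambda>z. G (H (fst z)) $ k)" for k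
    by (rule square_integrable_kernel_law_fst[OF M K G_square])
  have d2: "square_integrable ?L (\<lambda>z. G (H (fst z)) $ k - snd z $ k)" for k
    using G2' x2 by (rule square_integrable_diff)
  then have d2i: "integrable ?L (\<lambda>z. (G (H (fst z)) $ k - snd z $ k)\<^sup>2)" for k by (simp add: square_integrable_def)
  have f2i: "integrable ?L (\<lambda>z. (f k (fst z))\<^sup>2)" for k using f2' by (simp add: square_integrable_def)
  show "integrable ?L (\<lambda>z. (norm (G (H (fst z)) - snd z))\<^sup>2)"
    using d2i by (simp add: norm_square_vec)
  have c1: "(\<integral>z. f k (fst z) * G (H (fst z)) $ k \<partial>?L) = 0" for k
  proof -
    have "(\<integral>z. f k (fst z) * G (H (fst z)) $ k \<partial>?L) = (\<integral>w. f k w * G (H w) $ k \<partial>M)"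
      by (rule integral_kernel_law_fst[OF M K]) measurable
    also have "\<dots> = 0"
      using square_integrable_mult[OF f2[of k] G_square[of k]] unfolding f_def
      by (intro orth[of "\<lambda>h. G h $ k" k]) auto
    finally show ?thesis .
  qed
  have c2: "(\<integral>z. f k (fst z) * snd z $ k \<partial>?L) = 0" for k
    by (rule kernel_orthogonal[OF M q, of H "\<lambda>x. x $ k" "f k"])
      (use orth f2 x2 in \<open>auto simp: f_def\<close>)
  have split: "(\<integral>z. (th (fst z) $ k - snd z $ k)\<^sup>2 \<partial>?L) = (\<integral>w. (f k w)\<^sup>2 \<partial>M) + (\<integral>z. (G (H (fst z)) $ k - snd z $ k)\<^sup>2 \<partial>?L)" for k
  proof -
    have "(th (fst z) $ k - snd z $ k)\<^sup>2 = (f k (fst z))\<^sup>2 + (G (H (fst z)) $ k - snd z $ k)\<^sup>2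
        + (2 * (f k (fst z) * G (H (fst z)) $ k) - 2 * (f k (fst z) * snd z $ k))" for z :: "'w \<times> (real^'d)"
      by (simp add: f_def power2_eq_square algebra_simps)
    then have "(\<integral>z. (th (fst z) $ k - snd z $ k)\<^sup>2 \<partial>?L) = (\<integral>z. (f k (fst z))\<^sup>2 \<partial>?L) + (\<integral>z. (G (H (fst z)) $ k - snd z $ k)\<^sup>2 \<partial>?L)"
      using f2i[of k] d2i[of k] square_integrable_mult[OF f2' G2', of k k] square_integrable_mult[OF f2' x2, of k k] c1[of k] c2[of k]
      by simp
    moreover have "(\<integral>z. (f k (fst z))\<^sup>2 \<partial>?L) = (\<integral>w. (f k w)\<^sup>2 \<partial>M)"
      by (rule integral_kernel_law_fst[OF M K, of "\<lambda>w. (f k w)\<^sup>2"]) measurable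
    ultimately show ?thesis by simp
  qed
  have t2i: "integrable ?L (\<lambda>z. (th (fst z) $ k - snd z $ k)\<^sup>2)" for k
    using square_integrable_diff[OF square_integrable_kernel_law_fst[OF M K th2] x2, of k k] by (simp add: square_integrable_def)
  have "(\<integral>\<^sup>+z. ennreal ((norm (th (fst z) - snd z))\<^sup>2) \<partial>?L) = ennreal (\<integral>z. (norm (th (fst z) - snd z))\<^sup>2 \<partial>?L)"
    using t2i by (intro nn_integral_eq_integral) (simp_all add: norm_square_vec sum_nonneg)
  also have "(\<integral>z. (norm (th (fst z) - snd z))\<^sup>2 \<partial>?L) = (\<Sum>k\<in>UNIV. \<integral>z. (th (fst z) $ k - snd z $ k)\<^sup>2 \<partial>?L)"
    using t2i by (simp add: norm_square_vec integral_sum)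
  also have "\<dots> = residual + (\<Sum>k\<in>UNIV. \<integral>z. (G (H (fst z)) $ k - snd z $ k)\<^sup>2 \<partial>?L)"
    by (simp add: split sum.distrib residual_def f_def)
  also have "(\<Sum>k\<in>UNIV. \<integral>z. (G (H (fst z)) $ k - snd z $ k)\<^sup>2 \<partial>?L) = (\<integral>z. (norm (G (H (fst z)) - snd z))\<^sup>2 \<partial>?L)"
    using d2i by (simp add: norm_square_vec integral_sum)
  finally show "(\<integral>\<^sup>+z. ennreal ((norm (th (fst z) - snd z))\<^sup>2) \<partial>?L)
      = ennreal (residual + (\<integral>z. (norm (G (H (fst z)) - snd z))\<^sup>2 \<partial>?L))" .
qed

lemma rate_distortion_converse:
  assumes q [measurable]: "q \<in> measurable S (prob_algebra borel)"
    and info: "info_HX S (joint_law M th H S (\<lambda>w. q (H w))) \<le> ereal B"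
  shows "ennreal (residual + (\<Sum>i\<in>UNIV. shrink lam B i * lam i)) \<le> sq_loss (joint_law M th H S (\<lambda>w. q (H w)))"
proof -
  let ?L = "kernel_law M (\<lambda>w. q (H w))"
  have K: "(\<lambda>w. q (H w)) \<in> measurable M (prob_algebra borel)" by measurable
  note M = prob_space_axioms
  note sL[measurable_cong] = sets_kernel_law[OF M K]
  interpret L: prob_space ?L by (rule prob_space_kernel_law[OF M K])
  let ?D = "\<Sum>i\<in>UNIV. shrink lam B i * lam i"
  let ?l = "\<integral>\<^sup>+z. ennreal ((norm (th (fst z) - snd z))\<^sup>2) \<partial>?L"
  have loss: "sq_loss (joint_law M th H S (\<lambda>w. q (H w))) = ?l"
    by (rule sq_loss_joint_law[OF M K th_meas H_meas])
  show ?thesis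
  \<comment> \<open>An infinite loss satisfies any lower bound. A finite one makes the error, and
    with the state also the prediction, square integrable.\<close>
  proof (cases "?l = \<infinity>")
    case True
    then show ?thesis by (simp add: loss)
  next
    case False
    have x2: "square_integrable ?L (\<lambda>z. snd z $ k)" for k
    proof -
      have "square_integrable ?L (\<lambda>z. th (fst z) $ k - snd z $ k)"
        unfolding square_integrable_def
      proof
        have "(\<integral>\<^sup>+z. ennreal ((th (fst z) $ k - snd z $ k)\<^sup>2) \<partial>?L) \<le> ?l"
        proof (rule nn_integral_mono)
          fix z :: "'w \<times> (real^'d)"
          have "\<bar>(th (fst z) - snd z) $ k\<bar> \<le> norm (th (fst z) - snd z)" by (rule component_le_norm_cart)
          then have "(th (fst z) $ k - snd z $ k)\<^sup>2 \<le> (norm (th (fst z) - snd z))\<^sup>2"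
            by (simp add: abs_le_square_iff[symmetric])
          then show "ennreal ((th (fst z) $ k - snd z $ k)\<^sup>2) \<le> ennreal ((norm (th (fst z) - snd z))\<^sup>2)"
            by (rule ennreal_leI)
        qed
        with False have "(\<integral>\<^sup>+z. ennreal ((th (fst z) $ k - snd z $ k)\<^sup>2) \<partial>?L) < \<infinity>"
          by (auto simp: less_top[symmetric] top_unique)
        then show "integrable ?L (\<lambda>z. (th (fst z) $ k - snd z $ k)\<^sup>2)"
          by (intro integrableI_nonneg) auto
      qed measurable
      from square_integrable_diff[OF square_integrable_kernel_law_fst[OF M K th2[of k]] this]
      show ?thesis by simp
    qed
    note dec = loss_decomposition[OF q x2]
    define d where "d = (\<integral>z. (norm (G (H (fst z)) - snd z))\<^sup>2 \<partial>?L)"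
    have "?D \<le> d"
    \<comment> \<open>Without a positive eigenvalue there is no water level, but then the claimed
      distortion is 0.\<close>
    proof (cases "\<exists>j. lam j > 0")
      case False
      then have "lam i = 0" for i using lam[of i] by (metis less_eq_real_def)
      then show ?thesis by (simp add: d_def)
    next
      case True
      then obtain j where j: "lam j > 0" ..
      define eta where "eta = water_level lam B"
      have eta: "eta > 0" using water_level_props(1)[of lam, OF lam B j] by (simp add: eta_def)
      define Q where "Q i a \<longleftrightarrow> eta * a * lam i = shrink lam B i * lam i \<and>
          (\<forall>x. (\<integral>\<^sup>+y. ennreal (exp (bits lam B i + a * y\<^sup>2 - (y - x)\<^sup>2 / eta)) \<partial>normal1 0 (lam i)) \<le> 1)" for i a
      have "\<exists>a. Q i a" for i
        unfolding Q_def eta_def by (rule tilt_integral_le_1[of lam B j i, OF lam B j]) auto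
      then obtain a where aa: "\<And>i. Q i (a i)" by metis
      have a: "eta * a i * lam i = shrink lam B i * lam i"
        "(\<integral>\<^sup>+y. ennreal (exp (bits lam B i + a i * y\<^sup>2 - (y - x)\<^sup>2 / eta)) \<partial>normal1 0 (lam i)) \<le> 1" for i x
        using aa[of i] unfolding Q_def by auto
      let ?N = "distr M S H"
      let ?P = "distr ?L (S \<Otimes>\<^sub>M borel) (\<lambda>z. (H (fst z), snd z))"
      let ?X = "distr ?L borel snd"
      interpret N: prob_space ?N by (intro prob_space_distr) auto
      interpret X: prob_space ?X by (intro L.prob_space_distr) auto
      interpret NX: pair_prob_space ?N ?X ..
      \<comment> \<open>The budget \<open>B\<close> is distributed over the coordinates as
        \<open>bits lam B i\<close>, so that \<open>exp g\<close> factors and each factor is bounded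
        by 1 separately.\<close>
      define g where "g z = (\<Sum>i\<in>UNIV. bits lam B i + a i * (column i U \<bullet> G (fst z))\<^sup>2
        - (column i U \<bullet> G (fst z) - column i U \<bullet> snd z)\<^sup>2 / eta)" for z
      have [measurable]: "g \<in> borel_measurable (S \<Otimes>\<^sub>M borel)" unfolding g_def by measurable
      have gx: "(\<integral>\<^sup>+h. ennreal (exp (g (h, x))) \<partial>?N) \<le> 1" for x
      proof -
        have "(\<integral>\<^sup>+h. ennreal (exp (g (h, x))) \<partial>?N) = (\<integral>\<^sup>+y. (\<Prod>i\<in>UNIV. ennreal (exp (bits lam B i + a i * (column i U \<bullet> y)\<^sup>2
            - (column i U \<bullet> y - column i U \<bullet> x)\<^sup>2 / eta))) \<partial>distr M borel (\<lambda>w. G (H w)))"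
          by (simp add: nn_integral_distr g_def exp_sum prod_ennreal)
        also have "\<dots> = (\<Prod>i\<in>UNIV. \<integral>\<^sup>+y. ennreal (exp (bits lam B i + a i * y\<^sup>2
            - (y - column i U \<bullet> x)\<^sup>2 / eta)) \<partial>normal1 0 (lam i))"
          by (rule nn_integral_normal_vec_prod[OF normal U lam]) measurable
        also have "\<dots> \<le> (\<Prod>i\<in>(UNIV :: 'd set). 1)"
          by (intro prod_mono_ennreal a)
        finally show ?thesis by simp
      qed
      \<comment> \<open>The bound holds for each fixed prediction, so the unknown output law enters
        only through its total mass.\<close>
      have e1: "(\<integral>\<^sup>+z. ennreal (exp (g z)) \<partial>(?N \<Otimes>\<^sub>M ?X)) \<le> 1"
      proof -
        have "(\<integral>\<^sup>+z. ennreal (exp (g z)) \<partial>(?N \<Otimes>\<^sub>M ?X)) = (\<integral>\<^sup>+x. \<integral>\<^sup>+h. ennreal (exp (g (h, x))) \<partial>?N \<partial>?X)"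
          by (subst NX.nn_integral_snd[symmetric]) auto
        also have "\<dots> \<le> (\<integral>\<^sup>+x. 1 \<partial>?X)" using gx by (intro nn_integral_mono)
        also have "\<dots> = 1" using X.emeasure_space_1 by simp
        finally show ?thesis .
      qed
      have gL: "g (H (fst z), snd z) = B + (\<Sum>i\<in>UNIV. a i * (column i U \<bullet> G (H (fst z)))\<^sup>2) - (norm (G (H (fst z)) - snd z))\<^sup>2 / eta" for z :: "'w \<times> (real^'d)"
        using sum_bits[of lam, OF lam B j]
        by (simp add: g_def sum.distrib sum_subtractf orthogonal_matrix_parseval[OF U, symmetric]
            inner_diff_right sum_divide_distrib)
      have Gi: "integrable ?L (\<lambda>z. (column i U \<bullet> G (H (fst z)))\<^sup>2)" for i
        using square_integrable_kernel_law_fst[OF M K G_coord_square[of i]] by (simp add: square_integrable_def)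
      have GL: "(\<integral>z. (column i U \<bullet> G (H (fst z)))\<^sup>2 \<partial>?L) = lam i" for i
        using integral_kernel_law_fst[OF M K, of "\<lambda>w. (column i U \<bullet> G (H w))\<^sup>2"] G_coord_moment[of i] by simp
      have gi: "integrable ?P g"
        using dec(1) Gi by (subst integrable_distr_eq) (auto simp: gL)
      have "(\<integral>z. g z \<partial>?P) = (\<integral>z. g (H (fst z), snd z) \<partial>?L)" by (subst integral_distr) auto
      also have "\<dots> = B + (\<Sum>i\<in>UNIV. a i * lam i) - d / eta"
        unfolding gL d_def using dec(1) Gi by (simp add: integral_sum L.prob_space GL)
      finally have gP: "(\<integral>z. g z \<partial>?P) = B + (\<Sum>i\<in>UNIV. a i * lam i) - d / eta" .
      have "(\<integral>z. g z \<partial>?P) \<le> B"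
      proof (rule KL_div_ge[OF _ _ _ gi e1])
        show "prob_space ?P" by (intro L.prob_space_distr) auto
        show "prob_space (?N \<Otimes>\<^sub>M ?X)" by (rule NX.prob_space_axioms)
        show "KL_div ?P (?N \<Otimes>\<^sub>M ?X) \<le> ereal B"
          using info unfolding info_HX_joint_law[OF M K th_meas H_meas] .
      qed
      \<comment> \<open>The budget cancels against \<open>B\<close> in the mean of \<open>g\<close>;
        multiplying by \<open>eta\<close> turns each \<open>a i * lam i\<close> into the distortion
        \<open>shrink lam B i * lam i\<close>.\<close>
      then have "(\<Sum>i\<in>UNIV. a i * lam i) \<le> d / eta" unfolding gP by simp
      then have "eta * (\<Sum>i\<in>UNIV. a i * lam i) \<le> d" using eta by (simp add: field_simps)
      moreover have "eta * (\<Sum>i\<in>UNIV. a i * lam i) = ?D"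
        by (simp add: sum_distrib_left mult.assoc[symmetric] a)
      ultimately show ?thesis by simp
    qed
    then show ?thesis unfolding loss dec(2) d_def by (intro ennreal_leI) simp
  qed
qed

end

section \<open>Attainment by the proposed Gaussian channel\<close>

lemma borel_measurable_matrix_vector_mult [measurable (raw)]:
  fixes A :: "real^'n^'m"
  assumes "f \<in> borel_measurable M"
  shows "(\<lambda>x. A *v f x) \<in> borel_measurable M"
  using assms
  by (intro measurable_compose[OF assms] borel_measurable_continuous_onI linear_continuous_on
      linear_conv_bounded_linear[THEN iffD1] matrix_vector_mul_linear)

lemma measurable_shifted_kernel:
  assumes E: "prob_space E" "sets E = sets borel" and [measurable]: "m \<in> measurable S borel"
  shows "(\<lambda>h. distr E borel (\<lambda>e. m h + e :: 'x::{second_countable_topology, real_normed_vector}))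
    \<in> measurable S (prob_algebra borel)"
proof -
  have [measurable]: "(\<lambda>_. E) \<in> measurable S (prob_algebra borel)"
    using E by (intro measurable_const) (simp add: space_prob_algebra)
  show ?thesis by measurable
qed

text \<open>Drawing from the shifted noise law amounts to adding noise that is independent of the
  sample point, realised as the second factor of a product.\<close>

lemma kernel_law_shifted:
  fixes m :: "'w \<Rightarrow> 'x::{second_countable_topology, real_normed_vector}"
  assumes M: "prob_space M" and E: "prob_space E" and sE [measurable_cong]: "sets E = sets borel"
    and m [measurable]: "m \<in> borel_measurable M"
  shows "kernel_law M (\<lambda>w. distr E borel (\<lambda>e. m w + e))
    = distr (M \<Otimes>\<^sub>M E) (M \<Otimes>\<^sub>M borel) (\<lambda>z. (fst z, m (fst z) + snd z))"
proof (rule measure_eqI)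
  interpret E: prob_space E by fact
  note K = measurable_shifted_kernel[OF E sE m]
  note s = sets_kernel_law[OF M K]
  show "sets (kernel_law M (\<lambda>w. distr E borel (\<lambda>e. m w + e)))
      = sets (distr (M \<Otimes>\<^sub>M E) (M \<Otimes>\<^sub>M borel) (\<lambda>z. (fst z, m (fst z) + snd z)))" by (simp add: s)
  fix X assume "X \<in> sets (kernel_law M (\<lambda>w. distr E borel (\<lambda>e. m w + e)))"
  then have [measurable]: "X \<in> sets (M \<Otimes>\<^sub>M borel)" by (simp add: s)
  have "emeasure (kernel_law M (\<lambda>w. distr E borel (\<lambda>e. m w + e))) X
      = (\<integral>\<^sup>+z. indicator X z \<partial>kernel_law M (\<lambda>w. distr E borel (\<lambda>e. m w + e)))" by (simp add: s)
  also have "\<dots> = (\<integral>\<^sup>+w. \<integral>\<^sup>+x. indicator X (w, x) \<partial>distr E borel (\<lambda>e. m w + e) \<partial>M)"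
    by (rule nn_integral_kernel_law[OF M K]) simp
  also have "\<dots> = (\<integral>\<^sup>+w. \<integral>\<^sup>+e. indicator X (w, m w + e) \<partial>E \<partial>M)"
    by (intro nn_integral_cong nn_integral_distr) auto
  also have "\<dots> = (\<integral>\<^sup>+z. indicator X (fst z, m (fst z) + snd z) \<partial>(M \<Otimes>\<^sub>M E))"
    by (subst E.nn_integral_fst[symmetric]) auto
  also have "\<dots> = emeasure (distr (M \<Otimes>\<^sub>M E) (M \<Otimes>\<^sub>M borel) (\<lambda>z. (fst z, m (fst z) + snd z))) X"
    by (subst nn_integral_distr[symmetric, where M' = "M \<Otimes>\<^sub>M borel"]) auto
  finally show "emeasure (kernel_law M (\<lambda>w. distr E borel (\<lambda>e. m w + e))) X
    = emeasure (distr (M \<Otimes>\<^sub>M E) (M \<Otimes>\<^sub>M borel) (\<lambda>z. (fst z, m (fst z) + snd z))) X" .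
qed

lemma F_mat_shrink: "F_mat U lam B = U ** diag_mat (\<lambda>i. 1 - shrink lam B i) ** transpose U"
  by (simp add: F_mat_def shrink_def)

lemma Psi_mat_shrink:
  "Psi_mat U lam B = U ** diag_mat (\<lambda>i. (1 - shrink lam B i) * shrink lam B i * lam i) ** transpose U"
  by (simp add: Psi_mat_def shrink_def)

context gaussian_source
begin

definition optimal_kernel :: "'h \<Rightarrow> (real^'d) measure" where
  "optimal_kernel h = distr E borel (\<lambda>e. F_mat U lam B *v G h + e)"

lemma prob_space_E: "prob_space E" and sets_E [measurable_cong]: "sets E = sets borel"
  using E by (auto simp: is_normal_vec_def)

lemma E_spectral: "is_normal_vec E 0 (U ** diag_mat (\<lambda>i. (1 - shrink lam B i) * shrink lam B i * lam i) ** transpose U)"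
  using E by (simp add: Psi_mat_shrink)

lemma noise_var_nonneg: "0 \<le> (1 - shrink lam B i) * shrink lam B i * lam i"
  using shrink_bounds[of lam B i] lam[of i] by simp

lemma measurable_optimal_kernel [measurable]: "optimal_kernel \<in> measurable S (prob_algebra borel)"
  unfolding optimal_kernel_def[abs_def]
  by (rule measurable_shifted_kernel[OF prob_space_E sets_E]) measurable

lemma kernel_law_optimal:
  "kernel_law M (\<lambda>w. optimal_kernel (H w))
    = distr (M \<Otimes>\<^sub>M E) (M \<Otimes>\<^sub>M borel) (\<lambda>z. (fst z, F_mat U lam B *v G (H (fst z)) + snd z))"
  unfolding optimal_kernel_def
  by (rule kernel_law_shifted[OF prob_space_axioms prob_space_E sets_E]) measurable

lemma column_F_mat: "column i U \<bullet> (F_mat U lam B *v x) = (1 - shrink lam B i) * (column i U \<bullet> x)"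
  unfolding F_mat_shrink by (rule inner_column_matrix_mult_diag[OF U])

text \<open>With c = \<open>shrink lam B i\<close>, the error of coordinate i is c times the
  conditional mean's coordinate minus the noise, with second moment c^2 lam_i + (1 - c) c lam_i = c
  lam_i.\<close>

lemma optimal_loss:
  "sq_loss (joint_law M th H S (\<lambda>w. optimal_kernel (H w)))
    = ennreal (residual + (\<Sum>i\<in>UNIV. shrink lam B i * lam i))"
proof -
  let ?L = "kernel_law M (\<lambda>w. optimal_kernel (H w))"
  let ?T = "\<lambda>z. (fst z, F_mat U lam B *v G (H (fst z)) + snd z)"
  note M = prob_space_axioms
  have K: "(\<lambda>w. optimal_kernel (H w)) \<in> measurable M (prob_algebra borel)" by measurable
  note mE = normal_vec_column_moments[OF E_spectral U]
  have cE: "square_integrable E (\<lambda>e. c * (column i U \<bullet> e))" "(\<integral>e. c * (column i U \<bullet> e) \<partial>E) = 0"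
    "(\<integral>e. (c * (column i U \<bullet> e))\<^sup>2 \<partial>E) = c\<^sup>2 * ((1 - shrink lam B i) * shrink lam B i * lam i)" for c i
    using mE[of i] noise_var_nonneg[of i] by (auto simp: square_integrable_cmult power_mult_distrib abs_of_nonneg)
  have cG: "square_integrable M (\<lambda>w. c * (column i U \<bullet> G (H w)))"
    "(\<integral>w. (c * (column i U \<bullet> G (H w)))\<^sup>2 \<partial>M) = c\<^sup>2 * lam i" for c i
    using G_coord_square[of i] G_coord_moment[of i] by (auto simp: square_integrable_cmult power_mult_distrib)
  note sq = integral_pair_square_sum[OF M prob_space_E cG(1) cE(1) cE(2)]
  have "square_integrable (M \<Otimes>\<^sub>M E) (\<lambda>z. column i U \<bullet> (F_mat U lam B *v G (H (fst z)) + snd z))" for i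
    using sq(1)[of "1 - shrink lam B i" i 1 i] by (simp add: inner_add_right column_F_mat)
  then have "square_integrable (M \<Otimes>\<^sub>M E) (\<lambda>z. (F_mat U lam B *v G (H (fst z)) + snd z) $ k)" for k
    by (rule square_integrable_components[OF U])
  then have x2: "square_integrable ?L (\<lambda>z. snd z $ k)" for k
    unfolding kernel_law_optimal by (intro square_integrable_distr) auto
  note dec = loss_decomposition[OF measurable_optimal_kernel x2]
  have dist: "(norm (G (H (fst z)) - (F_mat U lam B *v G (H (fst z)) + snd z)))\<^sup>2
      = (\<Sum>i\<in>UNIV. (shrink lam B i * (column i U \<bullet> G (H (fst z))) + (-1) * (column i U \<bullet> snd z))\<^sup>2)" for z
    unfolding orthogonal_matrix_parseval[OF U, symmetric]
    by (simp add: inner_diff_right inner_add_right column_F_mat left_diff_distrib)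
  have "(\<integral>z. (norm (G (H (fst z)) - snd z))\<^sup>2 \<partial>?L)
      = (\<integral>z. (\<Sum>i\<in>UNIV. (shrink lam B i * (column i U \<bullet> G (H (fst z))) + (-1) * (column i U \<bullet> snd z))\<^sup>2) \<partial>(M \<Otimes>\<^sub>M E))"
    unfolding kernel_law_optimal by (subst integral_distr) (auto simp only: dist fst_conv snd_conv, measurable)
  also have "\<dots> = (\<Sum>i\<in>UNIV. \<integral>z. (shrink lam B i * (column i U \<bullet> G (H (fst z))) + (-1) * (column i U \<bullet> snd z))\<^sup>2 \<partial>(M \<Otimes>\<^sub>M E))"
    by (intro Bochner_Integration.integral_sum) (rule sq(1)[unfolded square_integrable_def, THEN conjunct2])
  also have "\<dots> = (\<Sum>i\<in>UNIV. shrink lam B i * lam i)"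
    unfolding sq(2) cE(3) cG(2) by (intro sum.cong refl) (simp add: power2_eq_square algebra_simps)
  finally show ?thesis
    unfolding sq_loss_joint_law[OF M K th_meas H_meas] dec(2) by simp
qed

text \<open>With c = \<open>shrink lam B i\<close>, the output variance is (1 - c)^2 lam_i + (1 - c)
  c lam_i = (1 - c) lam_i. The noise variance is c times this and c =
  \<open>exp (- 2 * bits lam B i)\<close>, so coordinate i contributes \<open>bits lam B i\<close>
  to the bound.\<close>

lemma optimal_info: "info_HX S (joint_law M th H S (\<lambda>w. optimal_kernel (H w))) \<le> ereal B"
proof -
  let ?L = "kernel_law M (\<lambda>w. optimal_kernel (H w))"
  let ?N = "distr M S H"
  let ?m = "\<lambda>h. F_mat U lam B *v G h"
  note M = prob_space_axioms
  have K: "(\<lambda>w. optimal_kernel (H w)) \<in> measurable M (prob_algebra borel)" by measurable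
  note sL[measurable_cong] = sets_kernel_law[OF M K]
  interpret E: prob_space E by (rule prob_space_E)
  interpret N: prob_space ?N by (intro prob_space_distr) auto
  \<comment> \<open>The information concerns the history, not the sample point, so the channel is
    transported to the law of \<open>H\<close>.\<close>
  have "?N \<Otimes>\<^sub>M distr E E (\<lambda>x. x) = distr (M \<Otimes>\<^sub>M E) (S \<Otimes>\<^sub>M E) (\<lambda>(x, y). (H x, y))"
    by (rule pair_measure_distr) (auto simp: E.sigma_finite_measure_axioms)
  then have NE: "?N \<Otimes>\<^sub>M E = distr (M \<Otimes>\<^sub>M E) (S \<Otimes>\<^sub>M E) (\<lambda>z. (H (fst z), snd z))"
    by (simp add: case_prod_beta')
  define P where "P = distr (?N \<Otimes>\<^sub>M E) (?N \<Otimes>\<^sub>M borel) (\<lambda>z. (fst z, ?m (fst z) + snd z))"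
  have "P = distr (?N \<Otimes>\<^sub>M E) (S \<Otimes>\<^sub>M borel) (\<lambda>z. (fst z, ?m (fst z) + snd z))"
    unfolding P_def by (intro distr_cong refl sets_pair_measure_cong) auto
  also have "\<dots> = distr (M \<Otimes>\<^sub>M E) (S \<Otimes>\<^sub>M borel) (\<lambda>z. (H (fst z), ?m (H (fst z)) + snd z))"
    unfolding NE by (subst distr_distr) (auto simp: comp_def)
  also have "\<dots> = distr ?L (S \<Otimes>\<^sub>M borel) (\<lambda>z. (H (fst z), snd z))"
    unfolding kernel_law_optimal by (subst distr_distr) (auto simp: comp_def)
  finally have P: "P = distr ?L (S \<Otimes>\<^sub>M borel) (\<lambda>z. (H (fst z), snd z))" .
  have PX: "distr ?L borel snd = distr P borel snd"
    unfolding P by (subst distr_distr) (auto simp: comp_def)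
  let ?s = "\<lambda>i. (1 - shrink lam B i) * lam i"
  have s0: "bits lam B i = 0 \<and> shrink lam B i = 1" if "?s i = 0" for i
  proof (cases "lam i = 0")
    case False
    then have "shrink lam B i = 1" using that by simp
    then show ?thesis by (simp add: shrink_def)
  qed (simp add: bits_eq_0 shrink_eq_1)
  have m2: "square_integrable ?N (\<lambda>h. column i U \<bullet> ?m h)" for i
    using G_coord_square[of i] unfolding column_F_mat
    by (intro square_integrable_distr square_integrable_cmult) auto
  have "KL_div P (?N \<Otimes>\<^sub>M distr P borel snd) \<le> ereal (\<Sum>i\<in>UNIV. bits lam B i)"
  proof (rule gaussian_channel_info_le[OF N.prob_space_axioms _ E_spectral U, where s = ?s, OF _ _ _ _ _ m2 _ P_def])
    show "?m \<in> borel_measurable ?N" by simp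
    show "0 \<le> ?s i" for i using shrink_bounds[of lam B i] lam[of i] by simp
    show "(1 - shrink lam B i) * shrink lam B i * lam i = exp (- 2 * bits lam B i) * ?s i" for i
      by (simp add: shrink_def)
    show "bits lam B i = 0" if "?s i = 0" for i using s0[OF that] by simp
    show "column i U \<bullet> ?m h = 0" if "?s i = 0" for i h using s0[OF that] by (simp add: column_F_mat)
    have "(\<integral>h. (column i U \<bullet> ?m h)\<^sup>2 \<partial>?N) = (1 - shrink lam B i)\<^sup>2 * lam i" for i
      by (simp add: column_F_mat integral_distr power_mult_distrib G_coord_moment)
    then show "(\<integral>h. (column i U \<bullet> ?m h)\<^sup>2 \<partial>?N) + (1 - shrink lam B i) * shrink lam B i * lam i = ?s i" for i
      by (simp add: power2_eq_square algebra_simps)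
  qed
  also have "\<dots> \<le> ereal B" using sum_bits_le[of lam, OF lam B] by simp
  finally show ?thesis
    unfolding info_HX_joint_law[OF M K th_meas H_meas] PX P[symmetric] .
qed

end

section \<open>Optimality\<close>

lemma inner_matrix_vector_mult:
  "a \<bullet> (C *v a) = (\<Sum>i\<in>UNIV. \<Sum>j\<in>UNIV. a $ i * C $ i $ j * a $ (j :: 'd::finite))" for a :: "real^'d"
  by (simp add: inner_vec_def matrix_vector_mult_def sum_distrib_left mult.assoc)

text \<open>The covariance in the theorem belongs to the version \<open>cond_mean\<close>, the
  Gaussian law to the linear function \<open>G\<close>. Almost sure equality and vanishing means
  make both the same matrix of second moments.\<close>

lemma (in linear_gaussian_model) cond_mean_normal:
  assumes [measurable]: "G \<in> borel_measurable (Hspace t)"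
    and GH: "AE w in M. cond_mean M theta Y t w = G (Hvec Y t w)"
    and cn: "\<And>a. centered_normal M (\<lambda>w. a \<bullet> G (Hvec Y t w))"
  shows "is_normal_vec (distr M borel (\<lambda>w. G (Hvec Y t w))) 0 (cov_mat M (cond_mean M theta Y t))"
    and "a \<bullet> (cov_mat M (cond_mean M theta Y t) *v a) = (\<integral>w. (a \<bullet> G (Hvec Y t w))\<^sup>2 \<partial>M)"
proof -
  let ?X = "\<lambda>w. G (Hvec Y t w)"
  have cm[measurable]: "(\<lambda>w. cond_mean M theta Y t w $ i) \<in> borel_measurable M" for i
    unfolding cond_mean_def by simp
  have X2: "square_integrable M (\<lambda>w. ?X w $ i)" and X0: "(\<integral>w. ?X w $ i \<partial>M) = 0" for i
    using centered_normal_props(1,2)[OF cn[of "axis i 1"]] by (auto simp: inner_axis')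
  have ae: "AE w in M. cond_mean M theta Y t w $ i = ?X w $ i" for i
    using GH by eventually_elim simp
  have m0: "(\<integral>w. cond_mean M theta Y t w $ i \<partial>M) = 0" for i
    using integral_cong_AE[OF _ _ ae[of i]] X0[of i] by simp
  have cov: "cov_mat M (cond_mean M theta Y t) $ i $ j = (\<integral>w. ?X w $ i * ?X w $ j \<partial>M)" for i j
  proof -
    have "AE w in M. cond_mean M theta Y t w $ i * cond_mean M theta Y t w $ j = ?X w $ i * ?X w $ j"
      using ae[of i] ae[of j] by eventually_elim simp
    then show ?thesis
      unfolding cov_mat_def m0 by (simp add: integral_cong_AE)
  qed
  show quad: "a \<bullet> (cov_mat M (cond_mean M theta Y t) *v a) = (\<integral>w. (a \<bullet> ?X w)\<^sup>2 \<partial>M)" for a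
  proof -
    have "(a \<bullet> ?X w)\<^sup>2 = (\<Sum>i\<in>UNIV. \<Sum>j\<in>UNIV. a $ i * a $ j * (?X w $ i * ?X w $ j))" for w
      by (simp add: power2_eq_square inner_vec_def sum_product mult_ac)
    then have "(\<integral>w. (a \<bullet> ?X w)\<^sup>2 \<partial>M) = (\<Sum>i\<in>UNIV. \<Sum>j\<in>UNIV. a $ i * a $ j * (\<integral>w. ?X w $ i * ?X w $ j \<partial>M))"
      using square_integrable_mult[OF X2 X2] by simp
    then show ?thesis by (simp add: inner_matrix_vector_mult cov mult_ac)
  qed
  show "is_normal_vec (distr M borel ?X) 0 (cov_mat M (cond_mean M theta Y t))"
    unfolding is_normal_vec_def
  proof (intro conjI allI)
    show "prob_space (distr M borel ?X)" by (intro prob_space_distr) measurable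
    show "distr (distr M borel ?X) borel (\<lambda>x. a \<bullet> x) = normal1 (a \<bullet> 0) (a \<bullet> (cov_mat M (cond_mean M theta Y t) *v a))" for a
      using centered_normal_props(4)[OF cn[of a]] unfolding quad by (subst distr_distr) (auto simp: comp_def)
  qed simp
qed

lemma (in linear_gaussian_model) single_period_optimality:
  assumes B: "B > 0" and U: "orthogonal_matrix U"
    and eig: "cov_mat M (cond_mean M theta Y t) ** U = U ** diag_mat lam"
    and E: "is_normal_vec E 0 (Psi_mat U lam B)"
  defines "J \<equiv> \<lambda>K. joint_law M (theta t) (Hvec Y t) (Hspace t) K"
    and "Kopt \<equiv> \<lambda>w. distr E borel (\<lambda>e. F_mat U lam B *v cond_mean M theta Y t w + e)"
  shows "info_HX (Hspace t) (J Kopt) \<le> ereal B"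
    and "q \<in> measurable (Hspace t) (prob_algebra borel) \<Longrightarrow>
      info_HX (Hspace t) (J (\<lambda>w. q (Hvec Y t w))) \<le> ereal B \<Longrightarrow>
      sq_loss (J Kopt) \<le> sq_loss (J (\<lambda>w. q (Hvec Y t w)))"
proof -
  obtain G where G[measurable]: "G \<in> borel_measurable (Hspace t)"
    and GH: "AE w in M. cond_mean M theta Y t w = G (Hvec Y t w)"
    and cn: "\<And>a. centered_normal M (\<lambda>w. a \<bullet> G (Hvec Y t w))"
    by (rule cond_mean_linear[of t], rule that)
  let ?C = "cov_mat M (cond_mean M theta Y t)"
  have "?C = ?C ** (U ** transpose U)" using U by (simp add: orthogonal_matrix_def)
  also have "\<dots> = U ** diag_mat lam ** transpose U" using eig by (simp add: matrix_mul_assoc)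
  finally have C: "?C = U ** diag_mat lam ** transpose U" .
  \<comment> \<open>The eigenvalues enter only through the matrix equation; each is the quadratic
    form at a unit column, hence a second moment.\<close>
  have lam: "0 \<le> lam i" for i
  proof -
    have "lam i = column i U \<bullet> (?C *v column i U)"
      unfolding C by (subst inner_column_matrix_mult_diag[OF U]) (simp add: orthogonal_matrix_columns[OF U])
    also have "\<dots> = (\<integral>w. (column i U \<bullet> G (Hvec Y t w))\<^sup>2 \<partial>M)" by (rule cond_mean_normal(2)[OF G GH cn])
    also have "\<dots> \<ge> 0" by simp
    finally show ?thesis .
  qed
  interpret gaussian_source M "theta t" "Hvec Y t" "Hspace t" G U lam B E
  proof
    show "is_normal_vec (distr M borel (\<lambda>w. G (Hvec Y t w))) 0 (U ** diag_mat lam ** transpose U)"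
      using cond_mean_normal(1)[OF G GH cn] unfolding C .
    show "(\<integral>w. (theta t w $ k - G (Hvec Y t w) $ k) * g (Hvec Y t w) \<partial>M) = 0"
      if "g \<in> borel_measurable (Hspace t)" "integrable M (\<lambda>w. (theta t w $ k - G (Hvec Y t w) $ k) * g (Hvec Y t w))" for k g
      by (rule cond_mean_orthogonal[OF GH that G])
  qed (fact state_square_integrable meas_theta measurable_Hvec G U lam B E)+
  have [measurable]: "(\<lambda>w. cond_mean M theta Y t w) \<in> borel_measurable M"
    unfolding cond_mean_def[abs_def] by (intro borel_measurable_vec_lambda) simp
  \<comment> \<open>The policy of the theorem uses \<open>cond_mean\<close>, which is a function of
    the history only up to a null set; the joint law does not see the difference.\<close>
  have J: "J Kopt = J (\<lambda>w. optimal_kernel (Hvec Y t w))"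
    unfolding J_def joint_law_def
  proof (rule bind_cong_AE)
    have "Kopt \<in> measurable M (prob_algebra borel)"
      unfolding Kopt_def by (rule measurable_shifted_kernel[OF prob_space_E sets_E]) measurable
    then have [measurable]: "Kopt \<in> measurable M (prob_algebra borel)"
      "(\<lambda>w. optimal_kernel (Hvec Y t w)) \<in> measurable M (prob_algebra borel)" by auto
    show "(\<lambda>w. distr (Kopt w) (borel \<Otimes>\<^sub>M Hspace t \<Otimes>\<^sub>M borel) (\<lambda>x. (theta t w, Hvec Y t w, x)))
        \<in> measurable M (subprob_algebra (borel \<Otimes>\<^sub>M Hspace t \<Otimes>\<^sub>M borel))"
      by (rule measurable_prob_algebraD) measurable
    show "(\<lambda>w. distr (optimal_kernel (Hvec Y t w)) (borel \<Otimes>\<^sub>M Hspace t \<Otimes>\<^sub>M borel) (\<lambda>x. (theta t w, Hvec Y t w, x)))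
        \<in> measurable M (subprob_algebra (borel \<Otimes>\<^sub>M Hspace t \<Otimes>\<^sub>M borel))"
      by (rule measurable_prob_algebraD) measurable
    show "AE w in M. distr (Kopt w) (borel \<Otimes>\<^sub>M Hspace t \<Otimes>\<^sub>M borel) (\<lambda>x. (theta t w, Hvec Y t w, x))
        = distr (optimal_kernel (Hvec Y t w)) (borel \<Otimes>\<^sub>M Hspace t \<Otimes>\<^sub>M borel) (\<lambda>x. (theta t w, Hvec Y t w, x))"
      using GH by eventually_elim (simp add: Kopt_def optimal_kernel_def)
  qed simp
  show "info_HX (Hspace t) (J Kopt) \<le> ereal B"
    unfolding J unfolding J_def by (rule optimal_info)
  show "sq_loss (J Kopt) \<le> sq_loss (J (\<lambda>w. q (Hvec Y t w)))"
    if "q \<in> measurable (Hspace t) (prob_algebra borel)"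
      "info_HX (Hspace t) (J (\<lambda>w. q (Hvec Y t w))) \<le> ereal B"
    unfolding J using rate_distortion_converse[OF that(1)] that(2) unfolding J_def optimal_loss by blast
qed

theorem theorem2:
  fixes M :: "'w measure"
    and theta omega :: "nat \<Rightarrow> 'w \<Rightarrow> real^'d::finite"
    and nu Y :: "nat \<Rightarrow> 'w \<Rightarrow> real^'m::finite"
    and A :: "real^'d^'d" and C :: "real^'d^'m"
    and Sigma0 Sigmaw :: "real^'d^'d" and Sigmav :: "real^'m^'m"
    and T :: nat and B :: real
    and lam :: "nat \<Rightarrow> 'd \<Rightarrow> real" and U :: "nat \<Rightarrow> real^'d^'d"
    and E :: "nat \<Rightarrow> (real^'d) measure"
  assumes M: "prob_space M"
    and meas_theta: "\<And>t. theta t \<in> borel_measurable M"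
    and meas_omega: "\<And>t. omega t \<in> borel_measurable M"
    and meas_nu: "\<And>t. nu t \<in> borel_measurable M"
    and meas_Y: "\<And>t. Y t \<in> borel_measurable M"
    and law_theta0: "is_normal_vec (distr M borel (theta 0)) 0 Sigma0"
    and law_omega: "\<And>t. is_normal_vec (distr M borel (omega t)) 0 Sigmaw"
    and law_nu: "\<And>t. t \<ge> 1 \<Longrightarrow> is_normal_vec (distr M borel (nu t)) 0 Sigmav"
    and indep: "prob_space.indep_sets M
        (\<lambda>i::unit + nat + nat. case i of
            Inl u \<Rightarrow> {theta 0 -` X \<inter> space M | X. X \<in> sets borel}
          | Inr (Inl t) \<Rightarrow> {omega t -` X \<inter> space M | X. X \<in> sets borel}
          | Inr (Inr t) \<Rightarrow> {nu t -` X \<inter> space M | X. X \<in> sets borel})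
        ({Inl ()} \<union> Inr ` Inl ` UNIV \<union> Inr ` Inr ` {1..})"
    and dyn: "\<And>t w. w \<in> space M \<Longrightarrow> theta (Suc t) w = A *v theta t w + omega t w"
    and obs: "\<And>t w. t \<ge> 1 \<Longrightarrow> w \<in> space M \<Longrightarrow> Y t w = C *v theta t w + nu t w"
    and T: "T \<ge> 1" and B: "B > 0"
    and eig: "\<And>t. t \<in> {1..T} \<Longrightarrow> orthogonal_matrix (U t) \<and>
               cov_mat M (cond_mean M theta Y t) ** U t = U t ** diag_mat (lam t)"
    and eps: "\<And>t. t \<in> {1..T} \<Longrightarrow> is_normal_vec (E t) 0 (Psi_mat (U t) (lam t) B)"
  shows "(\<forall>t\<in>{1..T}. info_HX (Hspace t)
             (joint_law M (theta t) (Hvec Y t) (Hspace t)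
                (\<lambda>w. distr (E t) borel (\<lambda>e. F_mat (U t) (lam t) B *v cond_mean M theta Y t w + e)))
           \<le> ereal B)
      \<and> (\<forall>q :: nat \<Rightarrow> (nat \<Rightarrow> real^'m) \<Rightarrow> (real^'d) measure.
           (\<forall>t\<in>{1..T}. q t \<in> measurable (Hspace t) (prob_algebra borel) \<and>
              info_HX (Hspace t) (joint_law M (theta t) (Hvec Y t) (Hspace t) (\<lambda>w. q t (Hvec Y t w)))
                \<le> ereal B)
           \<longrightarrow> (\<Sum>t\<in>{1..T}. sq_loss (joint_law M (theta t) (Hvec Y t) (Hspace t)
                  (\<lambda>w. distr (E t) borel (\<lambda>e. F_mat (U t) (lam t) B *v cond_mean M theta Y t w + e))))
               \<le> (\<Sum>t\<in>{1..T}. sq_loss (joint_law M (theta t) (Hvec Y t) (Hspace t) (\<lambda>w. q t (Hvec Y t w)))))"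
proof -
  interpret prob_space M by (rule M)
  interpret linear_gaussian_model M theta omega nu Y A C Sigma0 Sigmaw Sigmav
    by (intro linear_gaussian_model.intro linear_gaussian_model_axioms.intro;
        fact M meas_theta meas_omega meas_nu meas_Y law_theta0 law_omega law_nu indep dyn obs)
  note opt = single_period_optimality[OF B conjunct1[OF eig] conjunct2[OF eig] eps]
  show ?thesis
    using opt by (auto intro!: sum_mono)
qed

end
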